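(* Let $H$ be a tree or a unicyclic graph, with at least two edges. Then there exists a constant $\gamma=\gamma(H)\in(0,1)$ such that the following holds for the $(1:b)$ Avoider--Enforcer $H$-game played on $K_n$. If $$8v(H)n\le b+1\le \gamma n^{e(H)/(e(H)-1)},$$ and if furthermore $b$ is even whenever $H$ is unicyclic, then Enforcer has a strategy in which, at some point of the game, either he has already won or the number of $H$-threats is greater than $$\gamma^{e(H)-1}\,\frac{n^{v(H)}}{(b+1)^{e(H)-1}}.$$ Moreover, if $8v(H)n\le b+1\le \gamma n^{e(H)/(e(H)-1)}$, and if furthermore $b$ is even whenever $H$ is unicyclic, then also for the modified game in which in the first round (and only then) Avoider is allowed to select any number of edges she wishes (possibly none), while Enforcer has to select exactly $r$ edges, for some fixed number $r\in\{0,1,\ldots,b\}$, Enforcer has a strategy in which, at some point of the game, either he has already won or the number of $H$-threats is greater than $\gamma^{e(H)-1}\,n^{v(H)}/(b+1)^{e(H)-1}$.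
   Context: All graphs are finite and simple. A graph is unicyclic if it is connected and contains exactly one cycle. $v(H)$ and $e(H)$ are the numbers of vertices and edges of $H$. In the $(1:b)$ (strict) Avoider--Enforcer $H$-game on $K_n$ ($n,b$ positive integers), Avoider and Enforcer alternately claim previously unclaimed edges of $K_n$, Avoider moving first. Avoider claims exactly one edge per turn and Enforcer claims exactly $b$ edges per turn; if strictly fewer than $b$ edges are unclaimed before a move of Enforcer, he claims all of them. Avoider loses (Enforcer wins) if Avoider's graph contains a copy of $H$ when all edges are claimed; thus "Enforcer has already won" at some point means that Avoider's graph already contains a copy of $H$. At a given point of the game, an edge $e\in E(K_n)$ is an $H$-threat if $e$ has not been claimed by either player and adding $e$ to Avoider's graph would create a new copy of $H$ in her graph. *)

theory Defs
  imports Complex_Main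
begin

section \<open>Finite simple graphs\<close>

type_synonym 'a ugraph = "'a set \<times> 'a set set"

abbreviation verts :: "'a ugraph \<Rightarrow> 'a set" where "verts G \<equiv> fst G"
abbreviation edges :: "'a ugraph \<Rightarrow> 'a set set" where "edges G \<equiv> snd G"

definition simple_graph :: "'a ugraph \<Rightarrow> bool" where
  "simple_graph G \<longleftrightarrow> finite (verts G) \<and> (\<forall>e\<in>edges G. e \<subseteq> verts G \<and> card e = 2)"

definition connected_graph :: "'a ugraph \<Rightarrow> bool" where
  "connected_graph G \<longleftrightarrow> verts G \<noteq> {} \<and>
     (\<forall>u\<in>verts G. \<forall>v\<in>verts G. (u, v) \<in> {(x, y). {x, y} \<in> edges G}\<^sup>*)"

text \<open>A cycle of length at least 3 is determined by its set of edges, so cycles are counted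
  as edge sets: different cyclic orderings of the same cycle are identified.\<close>

definition cycles :: "'a ugraph \<Rightarrow> 'a set set set" where
  "cycles G = {C. C \<subseteq> edges G \<and> (\<exists>vs. distinct vs \<and> length vs \<ge> 3 \<and>
     C = {{vs ! i, vs ! (Suc i mod length vs)} | i. i < length vs})}"

definition is_tree :: "'a ugraph \<Rightarrow> bool" where
  "is_tree G \<longleftrightarrow> simple_graph G \<and> connected_graph G \<and> cycles G = {}"

definition unicyclic :: "'a ugraph \<Rightarrow> bool" where
  "unicyclic G \<longleftrightarrow> simple_graph G \<and> connected_graph G \<and> (\<exists>!C. C \<in> cycles G)"

definition complete_graph :: "nat \<Rightarrow> nat ugraph" where
  "complete_graph n = ({..<n}, {e. e \<subseteq> {..<n} \<and> card e = 2})"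

text \<open>The copies of \<open>H\<close> in \<open>G\<close>: the (not necessarily induced) subgraphs of \<open>G\<close> isomorphic
  to \<open>H\<close>.\<close>

definition copies :: "'a ugraph \<Rightarrow> 'b ugraph \<Rightarrow> 'b ugraph set" where
  "copies H G = {(f ` verts H, (`) f ` edges H) | f.
     inj_on f (verts H) \<and> f ` verts H \<subseteq> verts G \<and> (`) f ` edges H \<subseteq> edges G}"

section \<open>Avoider--Enforcer games on \<open>K\<^sub>n\<close>\<close>

text \<open>A history lists the completed rounds, each as the pair of the sets of edges claimed in it
  by Avoider, who moves first, and by Enforcer.\<close>

type_synonym edge = "nat set"
type_synonym history = "(edge set \<times> edge set) list"

definition avoider_edges :: "history \<Rightarrow> edge set" where
  "avoider_edges h = (\<Union>(X, Y)\<in>set h. X)"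

definition enforcer_edges :: "history \<Rightarrow> edge set" where
  "enforcer_edges h = (\<Union>(X, Y)\<in>set h. Y)"

definition unclaimed :: "nat \<Rightarrow> edge set \<Rightarrow> edge set \<Rightarrow> edge set" where
  "unclaimed n A B = edges (complete_graph n) - A - B"

text \<open>Rules \<open>R\<close>: \<open>fst R i\<close> is the set of admissible sizes of Avoider's move, and \<open>snd R i\<close> the
  prescribed size of Enforcer's move, in round \<open>i\<close> (counted from 0). If fewer than \<open>snd R i\<close>
  edges are unclaimed, Enforcer claims all of them.\<close>

type_synonym rules = "(nat \<Rightarrow> nat set) \<times> (nat \<Rightarrow> nat)"

definition avoider_legal :: "nat \<Rightarrow> rules \<Rightarrow> history \<Rightarrow> edge set \<Rightarrow> bool" where
  "avoider_legal n R h X \<longleftrightarrow>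
     X \<subseteq> unclaimed n (avoider_edges h) (enforcer_edges h) \<and> card X \<in> fst R (length h)"

definition enforcer_legal :: "nat \<Rightarrow> rules \<Rightarrow> history \<Rightarrow> edge set \<Rightarrow> edge set \<Rightarrow> bool" where
  "enforcer_legal n R h X Y \<longleftrightarrow>
     (let U = unclaimed n (avoider_edges h \<union> X) (enforcer_edges h)
      in Y \<subseteq> U \<and> card Y = min (snd R (length h)) (card U))"

definition strict_rules :: "nat \<Rightarrow> rules" where
  "strict_rules b = ((\<lambda>i. {1}), (\<lambda>i. b))"

definition modified_rules :: "nat \<Rightarrow> nat \<Rightarrow> rules" where
  "modified_rules b r = ((\<lambda>i. if i = 0 then UNIV else {1}), (\<lambda>i. if i = 0 then r else b))"

text \<open>An Enforcer strategy maps the history and Avoider's move in the current round to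
  Enforcer's reply.\<close>

type_synonym strategy = "history \<Rightarrow> edge set \<Rightarrow> edge set"

inductive follows :: "nat \<Rightarrow> rules \<Rightarrow> strategy \<Rightarrow> history \<Rightarrow> bool"
  for n :: nat and R :: rules and \<sigma> :: strategy where
  start: "follows n R \<sigma> []"
| round: "follows n R \<sigma> h \<Longrightarrow> avoider_legal n R h X \<Longrightarrow> follows n R \<sigma> (h @ [(X, \<sigma> h X)])"

definition legal_strategy :: "nat \<Rightarrow> rules \<Rightarrow> strategy \<Rightarrow> bool" where
  "legal_strategy n R \<sigma> \<longleftrightarrow>
     (\<forall>h X. follows n R \<sigma> h \<longrightarrow> avoider_legal n R h X \<longrightarrow> enforcer_legal n R h X (\<sigma> h X))"

definition game_over :: "nat \<Rightarrow> history \<Rightarrow> bool" where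
  "game_over n h \<longleftrightarrow> unclaimed n (avoider_edges h) (enforcer_edges h) = {}"

text \<open>The points of a play: the positions (Avoider's edges, Enforcer's edges) at the start and
  after each complete move of either player.\<close>

definition positions :: "history \<Rightarrow> (edge set \<times> edge set) set" where
  "positions h =
     {(avoider_edges (take k h), enforcer_edges (take k h)) | k. k \<le> length h} \<union>
     {(avoider_edges (take k h) \<union> fst (h ! k), enforcer_edges (take k h)) | k. k < length h}"

definition enforcer_can_reach ::
    "nat \<Rightarrow> rules \<Rightarrow> (edge set \<Rightarrow> edge set \<Rightarrow> bool) \<Rightarrow> bool" where
  "enforcer_can_reach n R P \<longleftrightarrow>
     (\<exists>\<sigma>. legal_strategy n R \<sigma> \<and>
        (\<forall>h. follows n R \<sigma> h \<longrightarrow> game_over n h \<longrightarrow> (\<exists>(A, B)\<in>positions h. P A B)))"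

definition enforcer_has_won :: "nat \<Rightarrow> 'a ugraph \<Rightarrow> edge set \<Rightarrow> bool" where
  "enforcer_has_won n H A \<longleftrightarrow> copies H ({..<n}, A) \<noteq> {}"

definition threats :: "nat \<Rightarrow> 'a ugraph \<Rightarrow> edge set \<Rightarrow> edge set \<Rightarrow> edge set" where
  "threats n H A B =
     {e \<in> unclaimed n A B. copies H ({..<n}, insert e A) - copies H ({..<n}, A) \<noteq> {}}"

end

theory Submission
  imports Defs "HOL-Library.Disjoint_Sets"
begin

text \<open>Write \<open>q = n / (b + 1)\<close>. Enforcer keeps a family of vertex-disjoint partial copies of \<open>H\<close> whose types
  partition \<open>V(H)\<close>, such that all edges of \<open>K\<^sub>n\<close> joining partial copies of different types and representing an
  edge of \<open>H\<close> are unclaimed; a type on \<open>j\<close> vertices has of the order of \<open>n q\<^bsup>j - 1\<^esup>\<close> copies, as in a random graph.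
  He first claims all edges that are irrelevant for this family. When these run out, he sacrifices edges
  between half of the copies of two adjacent types, chosen such that their numbers have the largest product.
  Every relevant edge that Avoider claims merges two partial copies, after which the new irrelevant edges
  fit into a single move of Enforcer since \<open>b + 1\<close> is larger than \<open>v(H) n\<close>. So Avoider has to merge until a new
  type is frequent, and this type coarsens the partition. After at most \<open>e(H)\<close> such stages a single edge of
  \<open>H\<close> is missing, and every way to place it is a threat. If two edges of a cycle join the same two types, then
  the sacrificed edges are claimed in pairs, which is possible for even \<open>b\<close>. If the first move of Avoider in the
  modified game has more than a linear number of edges, then it already contains \<open>H\<close> or creates enough threats;
  otherwise it leaves a linear independent set to play on.\<close>

section \<open>Winning positions\<close>

text \<open>Avoider decides which types she merges, so Enforcer cannot plan for a particular new
  type. This is why the product \<open>Z\<close> of the two sacrificed counts has to be the largest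
  one: the stage then has room for about \<open>Z / (b + 1)\<close> merges, and \<open>Z\<close>
  also dominates the product for every other adjacent pair that Avoider may use. The identity
  \<open>g i * g j = g (i + j + 1) * real (b + 1)\<close> turns this into the right order of
  magnitude for whatever type emerges. The upper bound on \<open>b\<close> says that
  \<open>g (card E - 1)\<close> is at least a large constant, which keeps all the counts above fixed
  thresholds. The main danger is a waiting move. If Enforcer takes only one of two pattern edges
  between the same two pieces, the other becomes worthless and Avoider can claim it without helping
  him. Bounding the number of such edges is the reason for the parity assumption. Labels are fixed
  in advance so that, in a disjoint family of pieces, an edge belongs to one bundle only. All losses
  are constant factors; the constant is squared in each stage because two counts are
  multiplied.\<close>

text \<open>Positions with Avoider to move from which Enforcer can force a position satisfying \<open>Q\<close> when Avoider
  claims one edge per turn.\<close>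

inductive win :: "nat \<Rightarrow> nat \<Rightarrow> (edge set \<Rightarrow> edge set \<Rightarrow> bool) \<Rightarrow> edge set \<Rightarrow> edge set \<Rightarrow> bool"
  for n b :: nat and Q where
  now: "Q A B \<Longrightarrow> win n b Q A B"
| step: "unclaimed n A B \<noteq> {} \<Longrightarrow>
    (\<And>e. e \<in> unclaimed n A B \<Longrightarrow>
      \<exists>Y. Y \<subseteq> unclaimed n (insert e A) B \<and> card Y = min b (card (unclaimed n (insert e A) B)) \<and>
          win n b Q (insert e A) (B \<union> Y)) \<Longrightarrow> win n b Q A B"

lemma avoider_edges_snoc [simp]: "avoider_edges (h @ [(X, Y)]) = avoider_edges h \<union> X"
  by (auto simp: avoider_edges_def)

lemma enforcer_edges_snoc [simp]: "enforcer_edges (h @ [(X, Y)]) = enforcer_edges h \<union> Y"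
  by (auto simp: enforcer_edges_def)

lemma positions_append: "positions h \<subseteq> positions (h @ [r])"
proof
  fix p assume "p \<in> positions h"
  then consider k where "k \<le> length h" "p = (avoider_edges (take k h), enforcer_edges (take k h))"
    | k where "k < length h" "p = (avoider_edges (take k h) \<union> fst (h ! k), enforcer_edges (take k h))"
    by (auto simp: positions_def)
  then show "p \<in> positions (h @ [r])"
  proof cases
    case 1
    then have "k \<le> length (h @ [r])" "take k (h @ [r]) = take k h" by auto
    with 1(2) show ?thesis unfolding positions_def by (metis (mono_tags, lifting) UnI1 mem_Collect_eq)
  next
    case 2
    then have "k < length (h @ [r])" "take k (h @ [r]) = take k h" "(h @ [r]) ! k = h ! k"
      by (auto simp: nth_append)
    with 2(2) show ?thesis unfolding positions_def by (metis (mono_tags, lifting) UnI2 mem_Collect_eq)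
  qed
qed

lemma positions_last: "(avoider_edges h, enforcer_edges h) \<in> positions h"
  by (auto simp: positions_def intro!: exI[of _ "length h"])

lemma positions_mid: "(avoider_edges h \<union> X, enforcer_edges h) \<in> positions (h @ [(X, Y)])"
  by (auto simp: positions_def intro!: exI[of _ "length h"])

lemma finite_unclaimed: "finite (unclaimed n A B)"
  by (rule finite_subset[of _ "Pow {..<n}"]) (auto simp: unclaimed_def complete_graph_def)

lemma enforcer_legal_exists: "\<exists>Y. enforcer_legal n R h X Y"
  using obtain_subset_with_card_n[of "min (snd R (length h)) (card (unclaimed n (avoider_edges h \<union> X) (enforcer_edges h)))"
      "unclaimed n (avoider_edges h \<union> X) (enforcer_edges h)"]
  unfolding enforcer_legal_def Let_def by (metis min.cobounded2)

text \<open>Bridges strategies on histories and the positional predicate \<open>win\<close>. The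
  first round is separate because only there the rules may differ from one edge against
  \<open>b\<close>; \<open>ne\<close> excludes a game that is over before it starts.\<close>

lemma enforcer_can_reachI:
  assumes rules: "\<And>i. i \<ge> 1 \<Longrightarrow> fst R i = {1} \<and> snd R i = b"
    and ne: "unclaimed n {} {} \<noteq> {}"
    and first: "\<And>X. avoider_legal n R [] X \<Longrightarrow>
       Q X {} \<or> (\<exists>Y. enforcer_legal n R [] X Y \<and> win n b Q X Y)"
  shows "enforcer_can_reach n R Q"
proof -
  define good where "good h X Y \<longleftrightarrow> enforcer_legal n R h X Y \<and>
      win n b Q (avoider_edges h \<union> X) (enforcer_edges h \<union> Y)" for h X Y
  \<comment> \<open>The second branch makes \<open>\<sigma>\<close> legal also at histories without
    a winning reply.\<close>
  define \<sigma> where "\<sigma> h X = (if \<exists>Y. good h X Y then SOME Y. good h X Y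
      else SOME Y. enforcer_legal n R h X Y)" for h X
  have good: "good h X (\<sigma> h X)" if "\<exists>Y. good h X Y" for h X
    using someI_ex[OF that] that by (simp add: \<sigma>_def)
  have legal: "enforcer_legal n R h X (\<sigma> h X)" for h X
  proof (cases "\<exists>Y. good h X Y")
    case True
    then show ?thesis using good[OF True] good_def by blast
  next
    case False
    then show ?thesis using someI_ex[OF enforcer_legal_exists[of n R h X]] by (simp add: \<sigma>_def)
  qed
  have main: "h = [] \<or> (\<exists>(A, B)\<in>positions h. Q A B) \<or> win n b Q (avoider_edges h) (enforcer_edges h)"
    if "follows n R \<sigma> h" for h
    using that
  proof induction
    case start
    then show ?case by simp
  next
    case (round h X)
    let ?h' = "h @ [(X, \<sigma> h X)]"
    show ?case
    proof (cases "\<exists>(A, B)\<in>positions h. Q A B")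
      case True
      then show ?thesis using positions_append[of h "(X, \<sigma> h X)"] by blast
    next
      case False
      have "Q (avoider_edges h \<union> X) (enforcer_edges h) \<or> (\<exists>Y. good h X Y)"
      proof (cases "h = []")
        case True
        then show ?thesis using first[of X] round.hyps(2)
          by (auto simp: good_def avoider_edges_def enforcer_edges_def)
      next
        case h: False
        with False round.IH have w: "win n b Q (avoider_edges h) (enforcer_edges h)" by blast
        have notQ: "\<not> Q (avoider_edges h) (enforcer_edges h)"
          using False positions_last[of h] by blast
        have len: "length h \<ge> 1" using h by (cases h) auto
        obtain e where e: "X = {e}" "e \<in> unclaimed n (avoider_edges h) (enforcer_edges h)"
          using round.hyps(2) rules[OF len] by (auto simp: avoider_legal_def card_1_singleton_iff)
        from w notQ e(2) obtain Y where "Y \<subseteq> unclaimed n (insert e (avoider_edges h)) (enforcer_edges h)"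
          "card Y = min b (card (unclaimed n (insert e (avoider_edges h)) (enforcer_edges h)))"
          "win n b Q (insert e (avoider_edges h)) (enforcer_edges h \<union> Y)"
          by (cases rule: win.cases) auto
        then have "good h X Y" using rules[OF len] e(1)
          by (simp add: good_def enforcer_legal_def Let_def)
        then show ?thesis by blast
      qed
      then show ?thesis
      proof
        assume "Q (avoider_edges h \<union> X) (enforcer_edges h)"
        then show ?thesis using positions_mid[of h X "\<sigma> h X"] by blast
      next
        assume "\<exists>Y. good h X Y"
        from good[OF this] show ?thesis by (simp add: good_def)
      qed
    qed
  qed
  have "\<exists>(A, B)\<in>positions h. Q A B" if "follows n R \<sigma> h" "game_over n h" for h
  proof -
    have "h \<noteq> []" using that(2) ne by (auto simp: game_over_def avoider_edges_def enforcer_edges_def)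
    with main[OF that(1)] consider "\<exists>(A, B)\<in>positions h. Q A B"
      | "win n b Q (avoider_edges h) (enforcer_edges h)" by blast
    then show ?thesis
    proof cases
      case 2
      \<comment> \<open>No edge is left, so \<open>win\<close> must come from \<open>now\<close>;
        this is why \<open>step\<close> demands an unclaimed edge.\<close>
      then have "Q (avoider_edges h) (enforcer_edges h)"
        using that(2) by (cases rule: win.cases) (auto simp: game_over_def)
      then show ?thesis using positions_last[of h] by blast
    qed
  qed
  then show ?thesis unfolding enforcer_can_reach_def legal_strategy_def using legal by blast
qed

section \<open>Connected graphs with at most one cycle\<close>

text \<open>The set \<open>R\<close> is empty for a tree and consists of one edge of the cycle for a unicyclic graph, so that
  \<open>E - R\<close> is a spanning tree.\<close>

locale pattern =
  fixes V :: "'v set" and E R :: "'v set set"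
  assumes finite_V: "finite V"
    and edgeD: "h \<in> E \<Longrightarrow> h \<subseteq> V \<and> card h = 2"
    and R_sub: "R \<subseteq> E" and card_R: "card R \<le> 1"
    and tree_crossing: "X \<noteq> {} \<Longrightarrow> X \<subset> V \<Longrightarrow> \<exists>x\<in>X. \<exists>y\<in>V - X. {x, y} \<in> E - R"
    and forest: "S \<subseteq> V \<Longrightarrow> S \<noteq> {} \<Longrightarrow> card {h \<in> E - R. h \<subseteq> S} < card S"
    and two_le: "2 \<le> card E"
begin

text \<open>Connectedness of the induced subgraph, stated with cuts instead of paths so that joining
  two such sets by an edge is plain set algebra.\<close>

definition conn :: "'v set \<Rightarrow> bool" where
  "conn S \<longleftrightarrow> (\<forall>X. X \<noteq> {} \<longrightarrow> X \<subset> S \<longrightarrow> (\<exists>x\<in>X. \<exists>y\<in>S - X. {x, y} \<in> E))"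

definition inner :: "'v set \<Rightarrow> 'v set set" where
  "inner S = {h \<in> E. h \<subseteq> S}"

definition cross :: "'v set \<Rightarrow> 'v set \<Rightarrow> 'v set set" where
  "cross C D = {h \<in> E. \<exists>x\<in>C. \<exists>y\<in>D. h = {x, y}}"

lemma finite_E: "finite E"
  by (rule finite_subset[of _ "Pow V"]) (use finite_V edgeD in auto)

lemma finite_R: "finite R"
  using R_sub finite_E finite_subset by blast

lemma finite_inner [simp]: "finite (inner S)" and finite_cross [simp]: "finite (cross C D)"
  unfolding inner_def cross_def using finite_E by auto

lemma edge_ne: "{x, y} \<in> E \<Longrightarrow> x \<noteq> y"
  using edgeD[of "{x, y}"] by auto

lemma conn_singleton: "conn {x}"
  unfolding conn_def by blast

lemma conn_Un:
  assumes "conn S" "conn S'" "x \<in> S" "y \<in> S'" "{x, y} \<in> E"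
  shows "conn (S \<union> S')"
  unfolding conn_def
proof (intro allI impI)
  fix X assume X: "X \<noteq> {}" "X \<subset> S \<union> S'"
  show "\<exists>a\<in>X. \<exists>b\<in>S \<union> S' - X. {a, b} \<in> E"
  proof (cases "X \<inter> S \<noteq> {} \<and> X \<inter> S \<subset> S")
    case True
    with assms(1) obtain a b where "a \<in> X \<inter> S" "b \<in> S - X \<inter> S" "{a, b} \<in> E"
      unfolding conn_def by meson
    then show ?thesis by blast
  next
    case F1: False
    show ?thesis
    proof (cases "X \<inter> S' \<noteq> {} \<and> X \<inter> S' \<subset> S'")
      case True
      with assms(2) obtain a b where "a \<in> X \<inter> S'" "b \<in> S' - X \<inter> S'" "{a, b} \<in> E"
        unfolding conn_def by meson
      then show ?thesis by blast
    next
      case F2: False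
      have "(S \<subseteq> X \<and> S' \<inter> X = {}) \<or> (S' \<subseteq> X \<and> S \<inter> X = {})" using F1 F2 X by blast
      then show ?thesis
      proof
        assume "S \<subseteq> X \<and> S' \<inter> X = {}"
        then have "x \<in> X" "y \<in> S \<union> S' - X" using assms(3,4) by blast+
        then show ?thesis using assms(5) by blast
      next
        assume "S' \<subseteq> X \<and> S \<inter> X = {}"
        then have "y \<in> X" "x \<in> S \<union> S' - X" using assms(3,4) by blast+
        moreover have "{y, x} \<in> E" using assms(5) by (simp add: insert_commute)
        ultimately show ?thesis by blast
      qed
    qed
  qed
qed

lemma card_inner_minus: "card (inner S) \<le> card {h \<in> E - R. h \<subseteq> S} + card R"
proof -
  have "inner S \<subseteq> {h \<in> E - R. h \<subseteq> S} \<union> R" by (auto simp: inner_def)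
  then have "card (inner S) \<le> card ({h \<in> E - R. h \<subseteq> S} \<union> R)"
    by (intro card_mono) (auto simp: finite_E finite_R)
  then show ?thesis using card_Un_le order_trans by blast
qed

lemma card_inner_le: "S \<subseteq> V \<Longrightarrow> S \<noteq> {} \<Longrightarrow> card (inner S) < card S + card R"
  using card_inner_minus[of S] forest[of S] by linarith

text \<open>As \<open>E - R\<close> is a forest, an edge surplus can only come from the removed
  edge. That edge cannot lie in two disjoint sets, which gives
  \<open>not_both_dense\<close>.\<close>

lemma R_sub_dense:
  assumes "S \<subseteq> V" "S \<noteq> {}" "card S \<le> card (inner S)"
  shows "R \<noteq> {} \<and> R \<subseteq> inner S"
proof (rule ccontr)
  assume a: "\<not> ?thesis"
  have "R \<inter> inner S = {}"
  proof (rule ccontr)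
    assume "R \<inter> inner S \<noteq> {}"
    then obtain h where h: "h \<in> R" "h \<in> inner S" by blast
    have "R \<subseteq> {h}" using h(1) card_R finite_R card_le_Suc0_iff_eq[of R] by auto
    then show False using a h by blast
  qed
  then have "inner S = {h \<in> E - R. h \<subseteq> S}" by (auto simp: inner_def)
  with forest[OF assms(1,2)] assms(3) show False by simp
qed

lemma not_both_dense:
  assumes "S \<subseteq> V" "S' \<subseteq> V" "S \<noteq> {}" "S' \<noteq> {}" "S \<inter> S' = {}"
    and "card S \<le> card (inner S)" "card S' \<le> card (inner S')"
  shows False
proof -
  obtain h where "h \<in> inner S" "h \<in> inner S'" "h \<in> E"
    using R_sub_dense[of S] R_sub_dense[of S'] R_sub assms by blast
  then have "h \<subseteq> S \<inter> S'" by (auto simp: inner_def)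
  then show False using edgeD[OF \<open>h \<in> E\<close>] assms(5) by auto
qed

lemma inner_Un:
  "inner (C \<union> D) = inner C \<union> inner D \<union> cross C D"
proof (intro equalityI subsetI)
  fix h assume h: "h \<in> inner (C \<union> D)"
  then obtain x y where "h = {x, y}" "x \<noteq> y" using edgeD[of h] by (auto simp: inner_def card_2_iff)
  then show "h \<in> inner C \<union> inner D \<union> cross C D" using h
    by (auto simp: inner_def cross_def insert_commute)
qed (auto simp: inner_def cross_def)

lemma card_inner_Un:
  assumes "C \<inter> D = {}"
  shows "card (inner (C \<union> D)) = card (inner C) + card (inner D) + card (cross C D)"
proof -
  have 1: "inner C \<inter> inner D = {}"
  proof (rule ccontr)
    assume "inner C \<inter> inner D \<noteq> {}"
    then obtain h where "h \<in> E" "h \<subseteq> C \<inter> D" by (auto simp: inner_def)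
    then show False using edgeD[of h] assms by auto
  qed
  have 2: "(inner C \<union> inner D) \<inter> cross C D = {}" using assms by (auto simp: inner_def cross_def)
  show ?thesis unfolding inner_Un using 1 2
    by (subst card_Un_disjoint) (auto simp: card_Un_disjoint)
qed

lemma inner_V: "inner V = E"
  using edgeD by (auto simp: inner_def)

text \<open>The counterpart of \<open>forest\<close>: growing a set along crossing edges gains an
  edge per vertex. Together they determine \<open>card E\<close> exactly.\<close>

lemma tree_growth: "k < card V \<Longrightarrow> \<exists>S. S \<subseteq> V \<and> card S = Suc k \<and> k \<le> card {h \<in> E - R. h \<subseteq> S}"
proof (induction k)
  case 0
  then obtain x where "x \<in> V" by (metis card.empty less_numeral_extra(3) subsetI subset_empty)
  then show ?case by (intro exI[of _ "{x}"]) auto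
next
  case (Suc k)
  then obtain S where S: "S \<subseteq> V" "card S = Suc k" "k \<le> card {h \<in> E - R. h \<subseteq> S}" by auto
  then have "S \<noteq> {}" "S \<subset> V" using Suc.prems by auto
  then obtain x y where xy: "x \<in> S" "y \<in> V - S" "{x, y} \<in> E - R" using tree_crossing by meson
  let ?S = "insert y S"
  have "insert {x, y} {h \<in> E - R. h \<subseteq> S} \<subseteq> {h \<in> E - R. h \<subseteq> ?S}" using xy by auto
  moreover have "finite {h \<in> E - R. h \<subseteq> ?S}" using finite_E by auto
  ultimately have "card (insert {x, y} {h \<in> E - R. h \<subseteq> S}) \<le> card {h \<in> E - R. h \<subseteq> ?S}"
    by (rule card_mono[rotated])
  moreover have "card (insert {x, y} {h \<in> E - R. h \<subseteq> S}) = Suc (card {h \<in> E - R. h \<subseteq> S})"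
    using xy finite_E by (subst card_insert_disjoint) auto
  ultimately have "Suc k \<le> card {h \<in> E - R. h \<subseteq> ?S}" using S by linarith
  then show ?case using S xy finite_V by (intro exI[of _ ?S]) (auto simp: finite_subset)
qed

lemma V_ne: "V \<noteq> {}"
proof
  assume "V = {}"
  then have "E = {}" using edgeD by fastforce
  then show False using two_le by simp
qed

lemma card_E: "Suc (card E) = card V + card R"
proof -
  have "card V > 0" using V_ne finite_V by auto
  then obtain S where S: "S \<subseteq> V" "card S = card V" "card V - 1 \<le> card {h \<in> E - R. h \<subseteq> S}"
    using tree_growth[of "card V - 1"] by auto
  then have "S = V" using card_subset_eq finite_V by blast
  then have "{h \<in> E - R. h \<subseteq> S} = E - R" using edgeD by auto
  with S forest[of V] V_ne \<open>S = V\<close> have "Suc (card (E - R)) = card V" by simp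
  moreover have "card (E - R) + card R = card E"
    using card_Diff_subset[OF finite_R R_sub] card_mono[OF finite_E R_sub] by simp
  ultimately show ?thesis by simp
qed

lemma card_E_V: "2 \<le> card E" "2 \<le> card V"
  using two_le card_E card_R by linarith+

lemma card_V_unicyclic: "R \<noteq> {} \<Longrightarrow> card V = card E"
  using card_E card_R finite_R by (cases "card R") auto

lemma card_inner_le_E: "card (inner S) \<le> card E"
  by (rule card_mono) (auto simp: inner_def finite_E)

lemma crossing: "X \<noteq> {} \<Longrightarrow> X \<subset> V \<Longrightarrow> \<exists>x\<in>X. \<exists>y\<in>V - X. {x, y} \<in> E"
  using tree_crossing by blast

end

section \<open>Labelled vertices and pieces\<close>

text \<open>Every vertex \<open>u\<close> of \<open>K\<^sub>n\<close> may only play the role of the vertex \<open>lab u\<close> of the pattern, so a partial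
  copy of the pattern is just a vertex set on which \<open>lab\<close> is injective.\<close>

locale labelled = pattern V E R for V :: "'v set" and E R :: "'v set set" +
  fixes lab :: "nat \<Rightarrow> 'v" and n b :: nat
  assumes n_pos: "0 < n" and b_pos: "0 < b" and b_large: "8 * card V * n \<le> b + 1"
    and b_even: "R \<noteq> {} \<Longrightarrow> even b"
begin

text \<open>Only edges whose labels form a pattern edge ever matter. With \<open>W = W'\<close>
  these are the edges of a partial copy, so no embedding has to be carried along.\<close>

definition bet :: "nat set \<Rightarrow> nat set \<Rightarrow> edge set" where
  "bet W W' = {e. \<exists>u\<in>W. \<exists>w\<in>W'. e = {u, w} \<and> {lab u, lab w} \<in> E}"

definition cl :: "edge set \<Rightarrow> nat set \<Rightarrow> nat" where
  "cl A W = card (bet W W \<inter> A)"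

lemma bet_commute: "bet W W' = bet W' W"
  unfolding bet_def using insert_commute by (fastforce simp: insert_commute)

lemma bet_Un: "bet (W \<union> W') X = bet W X \<union> bet W' X" "bet X (W \<union> W') = bet X W \<union> bet X W'"
  unfolding bet_def by blast+

lemma bet_sub: "e \<in> bet W W' \<Longrightarrow> e \<subseteq> W \<union> W'"
  unfolding bet_def by auto

lemma bet_edges: "W \<subseteq> {..<n} \<Longrightarrow> W' \<subseteq> {..<n} \<Longrightarrow> bet W W' \<subseteq> edges (complete_graph n)"
proof
  fix e assume a: "W \<subseteq> {..<n}" "W' \<subseteq> {..<n}" "e \<in> bet W W'"
  then obtain u w where uw: "u \<in> W" "w \<in> W'" "e = {u, w}" "{lab u, lab w} \<in> E"
    unfolding bet_def by blast
  have "u \<noteq> w" using edge_ne uw(4) by blast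
  then show "e \<in> edges (complete_graph n)" using a uw by (auto simp: complete_graph_def)
qed

lemma finite_bet: "finite W \<Longrightarrow> finite W' \<Longrightarrow> finite (bet W W')"
  by (rule finite_subset[of _ "Pow (W \<union> W')"]) (auto dest: bet_sub)

lemma bij_bet_cross:
  assumes "inj_on lab (W \<union> W')"
  shows "bij_betw ((`) lab) (bet W W') (cross (lab ` W) (lab ` W'))"
proof (rule bij_betw_imageI)
  have "inj_on ((`) lab) (Pow (W \<union> W'))" using assms by (rule inj_on_image_Pow)
  then show "inj_on ((`) lab) (bet W W')" by (rule inj_on_subset) (auto dest: bet_sub)
  show "(`) lab ` bet W W' = cross (lab ` W) (lab ` W')"
  proof (intro equalityI subsetI)
    fix h assume "h \<in> cross (lab ` W) (lab ` W')"
    then obtain u w where "u \<in> W" "w \<in> W'" "h = {lab u, lab w}" "h \<in> E" unfolding cross_def by blast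
    then have "{u, w} \<in> bet W W'" "h = lab ` {u, w}" unfolding bet_def by auto
    then show "h \<in> (`) lab ` bet W W'" by blast
  qed (auto simp: bet_def cross_def)
qed

lemma card_bet: "inj_on lab (W \<union> W') \<Longrightarrow> card (bet W W') = card (cross (lab ` W) (lab ` W'))"
  by (rule bij_betw_same_card[OF bij_bet_cross])

lemma cross_self: "cross C C = inner C"
proof (intro equalityI subsetI)
  fix h assume h: "h \<in> inner C"
  then obtain x y where "h = {x, y}" using edgeD[of h] by (auto simp: inner_def card_2_iff)
  then show "h \<in> cross C C" using h by (auto simp: inner_def cross_def)
qed (auto simp: inner_def cross_def)

lemma card_bet_self: "inj_on lab W \<Longrightarrow> card (bet W W) = card (inner (lab ` W))"
  using card_bet[of W W] by (simp add: cross_self)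

lemma inj_on_lab_Un:
  "inj_on lab W \<Longrightarrow> inj_on lab W' \<Longrightarrow> lab ` W \<inter> lab ` W' = {} \<Longrightarrow> inj_on lab (W \<union> W')"
  unfolding inj_on_Un by blast

lemma cl_le:
  assumes "inj_on lab W" "finite W"
  shows "cl A W \<le> card (inner (lab ` W))"
proof -
  have "cl A W \<le> card (bet W W)"
    unfolding cl_def by (rule card_mono) (use finite_bet assms(2) in auto)
  with card_bet_self[OF assms(1)] show ?thesis by simp
qed

text \<open>By disjointness each end of an edge determines its piece. All case distinctions on where
  a claimed edge lies, and the counting of bundles and threats, rest on this.\<close>

lemma bet_unique:
  assumes "disjoint K" "W \<in> K" "W' \<in> K" "X \<in> K" "X' \<in> K" "e \<in> bet W W'" "e \<in> bet X X'"
  shows "X = W \<and> X' = W' \<or> X = W' \<and> X' = W"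
proof -
  obtain u w x y where "u \<in> W" "w \<in> W'" "e = {u, w}" "x \<in> X" "y \<in> X'" "e = {x, y}"
    using assms(6,7) unfolding bet_def by blast
  then have "(x \<in> W \<and> y \<in> W') \<or> (x \<in> W' \<and> y \<in> W)" "x \<in> X" "y \<in> X'" by (auto simp: doubleton_eq_iff)
  moreover have "S = T" if "z \<in> S" "z \<in> T" "S \<in> K" "T \<in> K" for z S T
    using disjointD[OF assms(1) that(3,4)] that(1,2) by blast
  ultimately show ?thesis using assms(2-5) by blast
qed

definition pieces :: "edge set \<Rightarrow> edge set \<Rightarrow> nat set set \<Rightarrow> bool" where
  "pieces A B K \<longleftrightarrow> disjoint K \<and> (\<forall>W\<in>K. W \<noteq> {} \<and> W \<subseteq> {..<n} \<and> inj_on lab W \<and>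
     lab ` W \<subseteq> V \<and> conn (lab ` W) \<and> bet W W \<inter> B = {})"

definition cnt :: "nat set set \<Rightarrow> 'v set \<Rightarrow> nat" where
  "cnt K C = card {W \<in> K. lab ` W = C}"

text \<open>\<open>P\<close> is the set of types and \<open>f C\<close> the number of edges claimed by Avoider in each piece of type \<open>C\<close>. The
  condition \<open>card C \<le> f C + 1\<close> allows pieces in which one edge of the cycle is still unclaimed.\<close>

definition layout ::
  "edge set \<Rightarrow> edge set \<Rightarrow> 'v set set \<Rightarrow> ('v set \<Rightarrow> nat) \<Rightarrow> nat set set \<Rightarrow> bool" where
  "layout A B P f K \<longleftrightarrow> pieces A B K \<and> partition_on V P \<and>
     (\<forall>C\<in>P. card C \<le> f C + 1 \<and> 0 < cnt K C) \<and>
     (\<forall>W\<in>K. lab ` W \<in> P \<and> cl A W = f (lab ` W)) \<and>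
     (\<forall>W\<in>K. \<forall>W'\<in>K. lab ` W \<noteq> lab ` W' \<longrightarrow> bet W W' \<inter> (A \<union> B) = {})"

lemma piecesD:
  assumes "pieces A B K"
  shows "disjoint K" "finite K"
    "W \<in> K \<Longrightarrow> W \<noteq> {}" "W \<in> K \<Longrightarrow> W \<subseteq> {..<n}" "W \<in> K \<Longrightarrow> finite W" "W \<in> K \<Longrightarrow> inj_on lab W"
    "W \<in> K \<Longrightarrow> lab ` W \<subseteq> V" "W \<in> K \<Longrightarrow> conn (lab ` W)" "W \<in> K \<Longrightarrow> bet W W \<inter> B = {}"
proof -
  show sub: "W \<subseteq> {..<n}" if "W \<in> K" for W using assms that unfolding pieces_def by simp
  then show "finite K" "W \<in> K \<Longrightarrow> finite W"
    using finite_subset[of K "Pow {..<n}"] finite_subset[of W "{..<n}"] by auto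
qed (use assms in \<open>simp_all add: pieces_def\<close>)

lemma layoutD:
  assumes "layout A B P f K"
  shows "finite P" "C \<in> P \<Longrightarrow> C \<noteq> {}" "C \<in> P \<Longrightarrow> C \<subseteq> V" "C \<in> P \<Longrightarrow> finite C"
    "C \<in> P \<Longrightarrow> D \<in> P \<Longrightarrow> C \<noteq> D \<Longrightarrow> C \<inter> D = {}" "\<Union>P = V"
    "C \<in> P \<Longrightarrow> card C \<le> f C + 1" "C \<in> P \<Longrightarrow> 0 < cnt K C" "C \<in> P \<Longrightarrow> f C \<le> card (inner C)"
    "pieces A B K" "W \<in> K \<Longrightarrow> cl A W = f (lab ` W)"
proof -
  have part: "partition_on V P" using assms by (simp add: layout_def)
  show "finite P" using part finite_V finite_elements by blast
  show "C \<in> P \<Longrightarrow> C \<noteq> {}" "\<Union>P = V" using part by (auto simp: partition_on_def)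
  show sub: "C \<in> P \<Longrightarrow> C \<subseteq> V" for C using part by (auto simp: partition_on_def)
  then show "C \<in> P \<Longrightarrow> finite C" using finite_V finite_subset by blast
  show "C \<in> P \<Longrightarrow> D \<in> P \<Longrightarrow> C \<noteq> D \<Longrightarrow> C \<inter> D = {}" using part by (auto simp: partition_on_def disjoint_def)
  show "C \<in> P \<Longrightarrow> card C \<le> f C + 1" and cp: "C \<in> P \<Longrightarrow> 0 < cnt K C"
    and pc: "pieces A B K" and cl: "\<And>W. W \<in> K \<Longrightarrow> cl A W = f (lab ` W)"
    using assms by (simp_all add: layout_def)
  show "f C \<le> card (inner C)" if "C \<in> P"
  proof -
    obtain W where W: "W \<in> K" "lab ` W = C" using cp[OF \<open>C \<in> P\<close>] unfolding cnt_def card_gt_0_iff by blast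
    then show ?thesis using cl_le[OF piecesD(6,5)[OF pc W(1)], of A] cl[OF W(1)] by simp
  qed
qed

lemma pieces_inj2:
  assumes "pieces A B K" "W \<in> K" "W' \<in> K" "lab ` W \<inter> lab ` W' = {}"
  shows "inj_on lab (W \<union> W')" "W \<inter> W' = {}"
proof -
  show "inj_on lab (W \<union> W')" using inj_on_lab_Un piecesD(6)[OF assms(1)] assms(2-4) by blast
  show "W \<inter> W' = {}" using assms(4) by blast
qed

lemma card_pieces_le: 
  assumes "pieces A B K" shows "card K \<le> n"
proof -
  have "card K \<le> card (\<Union>K)"
  proof -
    have "card (\<Union>K) = (\<Sum>W\<in>K. card W)"
      using piecesD[OF assms] by (intro card_Union_disjoint) (auto simp: disjoint_def pairwise_def disjnt_def)
    also have "\<dots> \<ge> (\<Sum>W\<in>K. 1)"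
      using piecesD[OF assms] by (intro sum_mono) (simp add: Suc_le_eq card_gt_0_iff)
    finally show ?thesis by simp
  qed
  also have "\<dots> \<le> card {..<n}" using piecesD[OF assms] by (intro card_mono) auto
  finally show ?thesis by simp
qed

lemma card_lab: "inj_on lab W \<Longrightarrow> card (lab ` W) = card W"
  by (rule card_image)

end

section \<open>One stage of the game\<close>

text \<open>The edges between pieces in \<open>D1\<close> and pieces in \<open>D2\<close> may be sacrificed by Enforcer. Pieces outside
  \<open>D1\<close> and \<open>D2\<close> keep all their edges to all other pieces.\<close>

locale stage = labelled V E R lab n b
  for V :: "'v set" and E R :: "'v set set" and lab :: "nat \<Rightarrow> 'v" and n b :: nat +
  fixes A0 B0 :: "edge set" and P :: "'v set set" and f :: "'v set \<Rightarrow> nat" and K0 :: "nat set set"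
    and C1 C2 :: "'v set" and D1 D2 :: "nat set set"
  assumes layout0: "layout A0 B0 P f K0"
    and C12: "C1 \<in> P" "C2 \<in> P" "C1 \<noteq> C2" "cross C1 C2 \<noteq> {}"
    and D1_sub: "D1 \<subseteq> {W \<in> K0. lab ` W = C1}" and D2_sub: "D2 \<subseteq> {W \<in> K0. lab ` W = C2}"
begin

text \<open>Measured on vertices rather than by membership in \<open>D1\<close> and
  \<open>D2\<close>, so that a merged piece inherits the lost edges of its constituents.\<close>

definition hot :: "nat set \<Rightarrow> nat set \<Rightarrow> bool" where
  "hot W W' \<longleftrightarrow> W \<inter> \<Union>D1 \<noteq> {} \<and> W' \<inter> \<Union>D2 \<noteq> {} \<or> W \<inter> \<Union>D2 \<noteq> {} \<and> W' \<inter> \<Union>D1 \<noteq> {}"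

definition parts :: "nat set \<Rightarrow> 'v set set" where
  "parts W = {C \<in> P. C \<subseteq> lab ` W}"

text \<open>The sum condition says that a piece made of \<open>m\<close> old parts holds the edges
  of these parts and at least \<open>m - 1\<close> connecting ones. The bound on
  \<open>card K\<close> serves \<open>total_le\<close>.\<close>

definition inv :: "edge set \<Rightarrow> edge set \<Rightarrow> nat set set \<Rightarrow> bool" where
  "inv A B K \<longleftrightarrow> pieces A B K \<and>
     (\<forall>W\<in>K. (\<forall>C\<in>P. C \<subseteq> lab ` W \<or> C \<inter> lab ` W = {}) \<and> (\<Sum>C\<in>parts W. f C + 1) \<le> cl A W + 1) \<and>
     (\<forall>W0\<in>K0. \<exists>W\<in>K. W0 \<subseteq> W) \<and> card K \<le> card K0 \<and>
     (\<forall>W\<in>K. \<forall>W'\<in>K. lab ` W \<inter> lab ` W' = {} \<longrightarrow> \<not> hot W W' \<longrightarrow> bet W W' \<inter> (A \<union> B) = {})"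

text \<open>Enforcer's reserve: intact bundles between unmerged pieces. Once Enforcer takes an edge
  of a bundle, a remaining edge of it is no longer protected.\<close>

definition live :: "edge set \<Rightarrow> edge set \<Rightarrow> nat set set \<Rightarrow> (nat set \<times> nat set) set" where
  "live A B K = {(W1, W2). W1 \<in> D1 \<inter> K \<and> W2 \<in> D2 \<inter> K \<and> bet W1 W2 \<inter> (A \<union> B) = {}}"

text \<open>The edges that Enforcer does not claim freely. If Avoider claims one, she merges two
  pieces or adds an edge inside one.\<close>

definition prot :: "edge set \<Rightarrow> edge set \<Rightarrow> nat set set \<Rightarrow> edge set" where
  "prot A B K = {e. (\<exists>W\<in>K. e \<in> bet W W) \<or>
     (\<exists>W\<in>K. \<exists>W'\<in>K. lab ` W \<inter> lab ` W' = {} \<and> \<not> hot W W' \<and> e \<in> bet W W') \<or>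
     (\<exists>(W, W')\<in>live A B K. e \<in> bet W W')}"

definition spare :: "edge set \<Rightarrow> edge set \<Rightarrow> nat set set \<Rightarrow> edge set" where
  "spare A B K = unclaimed n A B - prot A B K"

text \<open>Covers both ways of altering an old piece: a merge removes it from \<open>K\<close>, an
  edge inside it changes \<open>cl\<close>.\<close>

definition touched :: "edge set \<Rightarrow> nat set set \<Rightarrow> 'v set \<Rightarrow> nat set set" where
  "touched A K C = {W \<in> K0. lab ` W = C \<and> \<not> (W \<in> K \<and> cl A W = f C)}"

definition total :: "edge set \<Rightarrow> nat set set \<Rightarrow> nat" where
  "total A K = (\<Sum>W\<in>K. cl A W)"

lemma part: "partition_on V P" and pieces0: "pieces A0 B0 K0"
  using layout0 by (simp_all add: layout_def)

lemmas finite_P = layoutD(1)[OF layout0] and P_D = layoutD(2,3)[OF layout0] and P_disjoint = layoutD(5)[OF layout0]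
  and card_le_f = layoutD(7)[OF layout0] and f_le_inner = layoutD(9)[OF layout0]

lemma lab_K0: "W \<in> K0 \<Longrightarrow> lab ` W \<in> P" "W \<in> K0 \<Longrightarrow> cl A0 W = f (lab ` W)"
  using layout0 by (simp_all add: layout_def)

lemma finite_D: "finite D1" "finite D2"
  using D1_sub D2_sub piecesD(2)[OF pieces0] finite_subset[of _ K0] by blast+

lemma D12_disjoint: "D1 \<inter> D2 = {}"
  using D1_sub D2_sub C12 by blast

lemma card_D: "card D1 + card D2 \<le> n"
proof -
  have "card D1 + card D2 = card (D1 \<union> D2)"
    using finite_D D12_disjoint by (simp add: card_Un_disjoint)
  also have "\<dots> \<le> card K0"
    by (rule card_mono) (use D1_sub D2_sub piecesD(2)[OF pieces0] in auto)
  also have "\<dots> \<le> n" by (rule card_pieces_le[OF pieces0])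
  finally show ?thesis .
qed

lemma finite_live: "finite (live A B K)"
  by (rule finite_subset[of _ "D1 \<times> D2"]) (use finite_D in \<open>auto simp: live_def\<close>)

lemma live_D:
  assumes "(W, W') \<in> live A B K"
  shows "W \<in> D1" "W' \<in> D2" "W \<in> K" "W' \<in> K" "lab ` W = C1" "lab ` W' = C2" "W \<noteq> W'"
    "bet W W' \<inter> (A \<union> B) = {}" "lab ` W \<inter> lab ` W' = {}"
proof -
  show 1: "W \<in> D1" "W' \<in> D2" "W \<in> K" "W' \<in> K" "bet W W' \<inter> (A \<union> B) = {}"
    using assms by (simp_all add: live_def)
  show 2: "lab ` W = C1" "lab ` W' = C2" using 1(1,2) D1_sub D2_sub by auto
  show "W \<noteq> W'" using 2 C12(3) by metis
  show "lab ` W \<inter> lab ` W' = {}" using P_disjoint C12 2 by simp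
qed

lemma live_hot:
  assumes "inv A B K" "(W, W') \<in> live A B K" shows "hot W W'"
proof -
  have "pieces A B K" using assms(1) by (simp add: inv_def)
  then have "W \<noteq> {}" "W' \<noteq> {}" using live_D[OF assms(2)] piecesD(3) by blast+
  then show ?thesis using live_D(1,2)[OF assms(2)] unfolding hot_def by blast
qed

lemma inv_0: "inv A0 B0 K0"
proof -
  have parts: "parts W = {lab ` W}" if "W \<in> K0" for W
  proof -
    have "C = lab ` W" if "C \<in> P" "C \<subseteq> lab ` W" for C
      using P_disjoint[of C "lab ` W"] lab_K0(1)[OF \<open>W \<in> K0\<close>] P_D(1)[OF that(1)] that by blast
    then show ?thesis using lab_K0(1)[OF that] unfolding parts_def by blast
  qed
  have sat: "C \<subseteq> lab ` W \<or> C \<inter> lab ` W = {}" if "W \<in> K0" "C \<in> P" for W C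
    using P_disjoint[of C "lab ` W"] lab_K0(1)[OF that(1)] that(2) by blast
  have "bet W W' \<inter> (A0 \<union> B0) = {}" if "W \<in> K0" "W' \<in> K0" "lab ` W \<inter> lab ` W' = {}" for W W'
  proof -
    have "lab ` W \<noteq> lab ` W'" using that P_D(1)[OF lab_K0(1)[OF that(1)]] by auto
    then show ?thesis using layout0 that unfolding layout_def by blast
  qed
  then show ?thesis unfolding inv_def using pieces0 sat parts lab_K0(2) by auto
qed

lemma invD:
  assumes "inv A B K"
  shows "pieces A B K" "X \<in> K \<Longrightarrow> C \<in> P \<Longrightarrow> C \<subseteq> lab ` X \<or> C \<inter> lab ` X = {}"
    "X \<in> K \<Longrightarrow> (\<Sum>C\<in>parts X. f C + 1) \<le> cl A X + 1" "W0 \<in> K0 \<Longrightarrow> \<exists>X\<in>K. W0 \<subseteq> X"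
    "card K \<le> card K0"
    "X \<in> K \<Longrightarrow> X' \<in> K \<Longrightarrow> lab ` X \<inter> lab ` X' = {} \<Longrightarrow> \<not> hot X X' \<Longrightarrow> bet X X' \<inter> (A \<union> B) = {}"
  using assms unfolding inv_def by (simp, meson, meson, meson, simp, meson)

section \<open>Effect of Avoider's moves on the invariant\<close>

lemma inv_waste:
  assumes inv: "inv A B K" and e: "e \<in> spare A B K"
  shows "inv (insert e A) B K" "live (insert e A) B K = live A B K"
    "spare (insert e A) B K = spare A B K - {e}" "\<And>W. W \<in> K \<Longrightarrow> cl (insert e A) W = cl A W"
proof -
  have np: "e \<notin> prot A B K" using e by (simp add: spare_def)
  show cl: "cl (insert e A) W = cl A W" if "W \<in> K" for W
  proof -
    have "e \<notin> bet W W" using np that unfolding prot_def by blast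
    then show ?thesis by (simp add: cl_def)
  qed
  have "pieces (insert e A) B K" using inv by (simp add: inv_def pieces_def)
  moreover have "e \<notin> bet W W'" if "W \<in> K" "W' \<in> K" "lab ` W \<inter> lab ` W' = {}" "\<not> hot W W'" for W W'
    using np that unfolding prot_def by blast
  ultimately show "inv (insert e A) B K" using inv cl unfolding inv_def by auto
  show live: "live (insert e A) B K = live A B K"
    using np unfolding prot_def live_def by auto
  have "prot (insert e A) B K = prot A B K" unfolding prot_def live ..
  then show "spare (insert e A) B K = spare A B K - {e}" by (auto simp: spare_def unclaimed_def)
qed

text \<open>The edge lies in no other bundle, so only the claimed count of \<open>W\<close> changes;
  having been protected, it was not spare.\<close>

lemma inv_close:
  assumes inv: "inv A B K" and e: "e \<in> unclaimed n A B" and W: "W \<in> K" "e \<in> bet W W"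
  shows "inv (insert e A) B K" "live (insert e A) B K = live A B K"
    "spare (insert e A) B K = spare A B K" "cl (insert e A) W = cl A W + 1"
    "\<And>X. X \<in> K \<Longrightarrow> X \<noteq> W \<Longrightarrow> cl (insert e A) X = cl A X"
proof -
  have pc: "pieces A B K" using inv by (simp add: inv_def)
  note pD = piecesD[OF pc]
  have eA: "e \<notin> A" using e by (auto simp: unclaimed_def)
  have "bet W W \<inter> insert e A = insert e (bet W W \<inter> A)" using W(2) by blast
  then show clW: "cl (insert e A) W = cl A W + 1"
    using eA finite_bet[of W W] pD(5)[OF W(1)] by (simp add: cl_def)
  have other: "e \<notin> bet X X'" if "X \<in> K" "X' \<in> K" "X \<noteq> W \<or> X' \<noteq> W" for X X'
    using bet_unique[OF pD(1) W(1) W(1) that(1,2) W(2)] that by blast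
  then show clX: "cl (insert e A) X = cl A X" if "X \<in> K" "X \<noteq> W" for X
    using that by (simp add: cl_def)
  have cl_ge: "cl A X \<le> cl (insert e A) X" if "X \<in> K" for X
    using clX[OF that] clW by (cases "X = W") simp_all
  have "pieces (insert e A) B K" using pc by (simp add: pieces_def)
  moreover have "e \<notin> bet X X'" if "X \<in> K" "X' \<in> K" "lab ` X \<inter> lab ` X' = {}" for X X'
    using other[OF that(1,2)] that(3) pD(3)[OF W(1)] by auto
  ultimately show "inv (insert e A) B K" using inv unfolding inv_def
    by (smt (verit) Int_insert_right Un_insert_left add_le_mono1 cl_ge order_trans)
  have "e \<notin> bet X X'" if "X \<in> D1 \<inter> K" "X' \<in> D2 \<inter> K" for X X'
    using other[of X X'] that D12_disjoint by blast
  then show live: "live (insert e A) B K = live A B K" unfolding live_def by auto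
  have "prot (insert e A) B K = prot A B K" unfolding prot_def live ..
  moreover have "e \<in> prot A B K" using W unfolding prot_def by blast
  ultimately show "spare (insert e A) B K = spare A B K" by (auto simp: spare_def unclaimed_def)
qed

lemma card_incident:
  assumes "Z \<subseteq> {..<n}"
  shows "card {e \<in> edges (complete_graph n). e \<inter> Z \<noteq> {}} \<le> card Z * n"
proof -
  have "{e \<in> edges (complete_graph n). e \<inter> Z \<noteq> {}} \<subseteq> (\<lambda>(u, w). {u, w}) ` (Z \<times> {..<n})"
  proof
    fix e assume "e \<in> {e \<in> edges (complete_graph n). e \<inter> Z \<noteq> {}}"
    then obtain u where u: "u \<in> e" "u \<in> Z" "card e = 2" "e \<subseteq> {..<n}" by (auto simp: complete_graph_def)
    then obtain w where w: "e = {u, w}" unfolding card_2_iff by blast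
    then have "(u, w) \<in> Z \<times> {..<n}" using u by auto
    then show "e \<in> (\<lambda>(u, w). {u, w}) ` (Z \<times> {..<n})" using w by force
  qed
  moreover have "finite Z" using assms finite_subset by blast
  ultimately show ?thesis
    using surj_card_le[of "Z \<times> {..<n}"] by (simp add: card_cartesian_product)
qed

text \<open>Damage is confined to the new piece: at most
  \<open>2 * (card D1 + card D2) \<le> 2 * n\<close> live pairs contain \<open>W\<close> or
  \<open>W'\<close>, and every newly spare edge meets one of at most \<open>card V\<close>
  vertices.\<close>

lemma inv_merge:
  assumes inv: "inv A B K" and e: "e \<in> unclaimed n A B" and W: "W \<in> K" "W' \<in> K"
    and dj: "lab ` W \<inter> lab ` W' = {}" and eb: "e \<in> bet W W'" and free: "bet W W' \<inter> (A \<union> B) = {}"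
  defines "K' \<equiv> insert (W \<union> W') (K - {W, W'})" and "A' \<equiv> insert e A"
  shows "inv A' B K'" "card (live A B K) \<le> card (live A' B K') + 2 * n"
    "card (spare A' B K') \<le> card (spare A B K) + card V * n"
    "total A' K' = total A K + 1" "\<And>X. X \<in> K \<Longrightarrow> X \<noteq> W \<Longrightarrow> X \<noteq> W' \<Longrightarrow> X \<in> K' \<and> cl A' X = cl A X"
proof -
  have pc: "pieces A B K" using inv by (simp add: inv_def)
  note pD = piecesD[OF pc]
  have eA: "e \<notin> A" "e \<notin> B" using e by (auto simp: unclaimed_def)
  have dW: "W \<inter> W' = {}" "inj_on lab (W \<union> W')" using pieces_inj2[OF pc W dj] by blast+
  then have neW: "W \<noteq> W'" using pD(3) W by blast
  have uniq: "(X = W \<and> X' = W') \<or> (X = W' \<and> X' = W)" if "X \<in> K" "X' \<in> K" "e \<in> bet X X'" for X X'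
    using bet_unique[OF pD(1) W that(1,2) eb that(3)] by blast
  have disjK: "X \<inter> Y = {}" if "X \<in> K" "Y \<in> K" "X \<noteq> Y" for X Y
    using pD(1) that by (simp add: disjointD)
  have newK: "W \<union> W' \<notin> K - {W, W'}"
    using disjK[of "W \<union> W'" W] W pD(3)[OF W(1)] by blast
  have nself: "e \<notin> bet X X" if "X \<in> K" for X using uniq[OF that that] neW by blast
  have clX: "cl A' X = cl A X" if "X \<in> K" for X
    using nself[OF that] by (simp add: cl_def A'_def)
  then show "\<And>X. X \<in> K \<Longrightarrow> X \<noteq> W \<Longrightarrow> X \<noteq> W' \<Longrightarrow> X \<in> K' \<and> cl A' X = cl A X"
    by (simp add: K'_def)
  have clW: "cl A' (W \<union> W') = cl A W + cl A W' + 1"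
  proof -
    have eq: "bet (W \<union> W') (W \<union> W') \<inter> A' = insert e ((bet W W \<inter> A) \<union> (bet W' W' \<inter> A))"
      using eb free unfolding bet_Un bet_commute[of W' W] A'_def by blast
    have "bet W W \<inter> bet W' W' = {}"
      using bet_unique[OF pD(1) W(1) W(1) W(2) W(2)] neW by blast
    moreover have fin: "finite (bet W W)" "finite (bet W' W')" using finite_bet pD(5) W by blast+
    ultimately have "card ((bet W W \<inter> A) \<union> (bet W' W' \<inter> A)) = cl A W + cl A W'"
      unfolding cl_def by (intro card_Un_disjoint) auto
    then show ?thesis unfolding cl_def[of A' "W \<union> W'"] eq using eA fin
      by (subst card_insert_disjoint) auto
  qed
  have finK: "finite K" using pD(2) .
  have sumK: "K = insert W (insert W' (K - {W, W'}))" using W by blast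
  have "total A K = cl A W + (cl A W' + (\<Sum>X\<in>K - {W, W'}. cl A X))"
    unfolding total_def by (subst sumK) (use finK neW in simp)
  moreover have "total A' K' = cl A' (W \<union> W') + (\<Sum>X\<in>K - {W, W'}. cl A' X)"
    unfolding total_def K'_def using finK newK by simp
  moreover have "(\<Sum>X\<in>K - {W, W'}. cl A' X) = (\<Sum>X\<in>K - {W, W'}. cl A X)"
    by (rule sum.cong) (use clX in auto)
  ultimately show "total A' K' = total A K + 1" using clW by simp
  note sat = invD(2)[OF inv] and sums = invD(3)[OF inv] and cover = invD(4)[OF inv]
    and cK = invD(5)[OF inv] and btw = invD(6)[OF inv]
  show "inv A' B K'"
    unfolding inv_def
  proof (intro conjI ballI impI)
    obtain u w where uw: "u \<in> W" "w \<in> W'" "e = {u, w}" "{lab u, lab w} \<in> E"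
      using eb unfolding bet_def by blast
    have "conn (lab ` (W \<union> W'))" unfolding image_Un
      by (rule conn_Un[of _ _ "lab u" "lab w"]) (use pD(8) W uw in auto)
    moreover have "disjoint K'" unfolding K'_def
    proof (rule disjointI)
      fix X Y assume "X \<in> insert (W \<union> W') (K - {W, W'})" "Y \<in> insert (W \<union> W') (K - {W, W'})" "X \<noteq> Y"
      then show "X \<inter> Y = {}" using disjK W by blast
    qed
    moreover have "bet (W \<union> W') (W \<union> W') \<inter> B = {}"
      using pD(9)[OF W(1)] pD(9)[OF W(2)] free unfolding bet_Un bet_commute[of W' W] by blast
    moreover have "lab x \<in> V" if "x \<in> W \<union> W'" for x
      using that pD(7)[OF W(1)] pD(7)[OF W(2)] by auto
    ultimately show "pieces A' B K'"
      using pc W dW(2) unfolding pieces_def K'_def by auto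
    show "C \<subseteq> lab ` X \<or> C \<inter> lab ` X = {}" if "X \<in> K'" "C \<in> P" for X C
    proof -
      have "C \<subseteq> l \<union> l' \<or> C \<inter> (l \<union> l') = {}" if "C \<subseteq> l \<or> C \<inter> l = {}" "C \<subseteq> l' \<or> C \<inter> l' = {}" for l l'
        using that by blast
      from this[OF sat[OF W(1) that(2)] sat[OF W(2) that(2)]] show ?thesis
        using sat[of X C] that unfolding K'_def image_Un[symmetric] by auto
    qed
    show "(\<Sum>C\<in>parts X. f C + 1) \<le> cl A' X + 1" if X: "X \<in> K'" for X
    proof (cases "X = W \<union> W'")
      case True
      have "parts X = parts W \<union> parts W'"
      proof -
        have "C \<subseteq> l \<union> l' \<longleftrightarrow> C \<subseteq> l \<or> C \<subseteq> l'" if "C \<subseteq> l \<or> C \<inter> l = {}" "C \<subseteq> l' \<or> C \<inter> l' = {}" for C :: "'v set" and l l'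
          using that by blast
        from this[OF sat[OF W(1)] sat[OF W(2)]] show ?thesis
          unfolding parts_def True image_Un by blast
      qed
      moreover have "parts W \<inter> parts W' = {}"
      proof -
        have "C = {}" if "C \<subseteq> lab ` W" "C \<subseteq> lab ` W'" for C using dj that by (metis Int_greatest subset_empty)
        then show ?thesis using P_D(1) unfolding parts_def by blast
      qed
      moreover have "finite (parts W)" "finite (parts W')" using finite_P by (auto simp: parts_def)
      ultimately have "(\<Sum>C\<in>parts X. f C + 1) = (\<Sum>C\<in>parts W. f C + 1) + (\<Sum>C\<in>parts W'. f C + 1)"
        by (simp add: sum.union_disjoint)
      then show ?thesis using sums[OF W(1)] sums[OF W(2)] clW True by simp
    next
      case False
      then have "X \<in> K" using X by (simp add: K'_def)
      then show ?thesis using sums clX by simp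
    qed
    show "\<exists>X\<in>K'. W0 \<subseteq> X" if "W0 \<in> K0" for W0
    proof -
      obtain X where X: "X \<in> K" "W0 \<subseteq> X" using cover[OF \<open>W0 \<in> K0\<close>] by auto
      show ?thesis
      proof (cases "X = W \<or> X = W'")
        case True
        then have "W0 \<subseteq> W \<union> W'" using X(2) by auto
        then show ?thesis unfolding K'_def by (rule bexI) simp
      next
        case False
        then show ?thesis using X unfolding K'_def by (intro bexI[of _ X]) auto
      qed
    qed
    have "card K' \<le> card K"
    proof -
      have "card (K - {W, W'}) = card K - 2" using W neW finK by (simp add: card_Diff_subset)
      moreover have "card {W, W'} \<le> card K" by (rule card_mono) (use W finK in auto)
      ultimately show ?thesis unfolding K'_def using newK finK neW by simp
    qed
    then show "card K' \<le> card K0" using cK by simp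
    show "bet X X' \<inter> (A' \<union> B) = {}"
      if X: "X \<in> K'" "X' \<in> K'" "lab ` X \<inter> lab ` X' = {}" "\<not> hot X X'" for X X'
    proof -
      have *: "bet Y Z \<inter> (A' \<union> B) = {}"
        if "Y \<in> K" "Z \<in> K" "Z \<notin> {W, W'}" "lab ` Y \<inter> lab ` Z = {}" "\<not> hot Y Z" for Y Z
        using btw[OF that(1,2,4,5)] uniq[OF that(1,2)] that(3) unfolding A'_def by blast
      have sym: "hot Y Z \<longleftrightarrow> hot Z Y" for Y Z unfolding hot_def by blast
      \<comment> \<open>A hot constituent would make the union hot, so coldness passes down to
        \<open>W\<close> and \<open>W'\<close>.\<close>
      have **: "bet (W \<union> W') Z \<inter> (A' \<union> B) = {}"
        if "Z \<in> K" "Z \<notin> {W, W'}" "lab ` (W \<union> W') \<inter> lab ` Z = {}" "\<not> hot (W \<union> W') Z" for Z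
      proof -
        have "\<not> hot W Z" "\<not> hot W' Z" using that(4) unfolding hot_def by blast+
        moreover have "lab ` W \<inter> lab ` Z = {}" "lab ` W' \<inter> lab ` Z = {}"
          using that(3) unfolding image_Un Int_Un_distrib2 by simp_all
        ultimately have "bet W Z \<inter> (A' \<union> B) = {}" "bet W' Z \<inter> (A' \<union> B) = {}"
          using *[of W Z] *[of W' Z] W that(1,2) by auto
        then show ?thesis unfolding bet_Un by blast
      qed
      have "X \<noteq> {}" using X(1) pD(3) W unfolding K'_def by blast
      then have "X \<noteq> X'" using X(3) by auto
      then consider "X = W \<union> W'" "X' \<in> K - {W, W'}" | "X' = W \<union> W'" "X \<in> K - {W, W'}"
        | "X \<in> K" "X' \<in> K" "X' \<notin> {W, W'}" using X(1,2) unfolding K'_def by blast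
      then show ?thesis
      proof cases
        case 1 then show ?thesis using **[of X'] X by simp
      next
        case 2
        then have "bet X' X \<inter> (A' \<union> B) = {}" using **[of X] X sym by (simp add: Int_commute)
        then show ?thesis by (simp add: bet_commute)
      next
        case 3 then show ?thesis using *[of X X'] X by simp
      qed
    qed
  qed
  have live_sub: "p \<in> live A' B K' \<or> p \<in> {W, W'} \<times> D2 \<or> p \<in> D1 \<times> {W, W'}" if "p \<in> live A B K" for p
  proof -
    obtain X X' where p: "p = (X, X')" by (cases p)
    note l = live_D[OF that[unfolded p]]
    show ?thesis
    proof (cases "X \<in> {W, W'} \<or> X' \<in> {W, W'}")
      case True then show ?thesis using l p by blast
    next
      case False
      then have "X \<in> K'" "X' \<in> K'" "e \<notin> bet X X'" using l uniq unfolding K'_def by blast+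
      then show ?thesis using l p unfolding live_def A'_def by blast
    qed
  qed
  have "card (live A B K) \<le> card (live A' B K' \<union> ({W, W'} \<times> D2 \<union> D1 \<times> {W, W'}))"
    by (rule card_mono) (use live_sub finite_live finite_D in blast)+
  also have "\<dots> \<le> card (live A' B K') + (card ({W, W'} \<times> D2) + card (D1 \<times> {W, W'}))"
    by (meson add_left_mono card_Un_le order_trans)
  also have "\<dots> \<le> card (live A' B K') + 2 * n"
    using card_D neW by (simp add: card_cartesian_product)
  finally show "card (live A B K) \<le> card (live A' B K') + 2 * n" .
  let ?I = "{x \<in> edges (complete_graph n). x \<inter> (W \<union> W') \<noteq> {}}"
  have "spare A' B K' \<subseteq> spare A B K \<union> ?I"
  proof
    fix x assume x: "x \<in> spare A' B K'"
    show "x \<in> spare A B K \<union> ?I"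
    proof (rule ccontr)
      assume n: "x \<notin> spare A B K \<union> ?I"
      have xu: "x \<in> unclaimed n A B" "x \<in> edges (complete_graph n)" "x \<notin> prot A' B K'"
        using x by (auto simp: spare_def A'_def unclaimed_def)
      then have xp: "x \<in> prot A B K" and xW: "x \<inter> (W \<union> W') = {}" using n by (auto simp: spare_def)
      have nW: "X \<in> K' \<and> X' \<in> K'" if "x \<in> bet X X'" "X \<in> K" "X' \<in> K" for X X'
      proof -
        have "x \<inter> X \<noteq> {}" "x \<inter> X' \<noteq> {}" using that(1) unfolding bet_def by auto
        then show ?thesis using that(2,3) xW unfolding K'_def by blast
      qed
      from xp consider X where "X \<in> K" "x \<in> bet X X"
        | X X' where "X \<in> K" "X' \<in> K" "lab ` X \<inter> lab ` X' = {}" "\<not> hot X X'" "x \<in> bet X X'"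
        | X X' where "(X, X') \<in> live A B K" "x \<in> bet X X'"
        unfolding prot_def by blast
      then show False
      proof cases
        case 1 then show False using xu(3) nW[of X X] unfolding prot_def by blast
      next
        case 2 then show False using xu(3) nW[of X X'] unfolding prot_def by blast
      next
        case 3
        note l = live_D[OF 3(1)]
        have "X \<in> K'" "X' \<in> K'" using nW[OF 3(2) l(3,4)] by blast+
        moreover have "X \<noteq> W" "X \<noteq> W'" using 3(2) xW unfolding bet_def by auto
        then have "e \<notin> bet X X'" using uniq[OF l(3,4)] by blast
        ultimately have "(X, X') \<in> live A' B K'" using l unfolding live_def A'_def by blast
        then show False using xu(3) 3(2) unfolding prot_def by blast
      qed
    qed
  qed
  then have "card (spare A' B K') \<le> card (spare A B K \<union> ?I)"
    by (rule card_mono[rotated]) (auto simp: spare_def finite_unclaimed complete_graph_def)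
  also have "\<dots> \<le> card (spare A B K) + card ?I" by (rule card_Un_le)
  also have "card ?I \<le> card (W \<union> W') * n" by (rule card_incident) (use pD(4) W in blast)
  also have "card (W \<union> W') \<le> card V"
    using card_lab[OF dW(2)] card_mono[OF finite_V, of "lab ` (W \<union> W')"] pD(7) W by (simp add: image_Un)
  finally show "card (spare A' B K') \<le> card (spare A B K) + card V * n" by simp
qed


lemma card_touched_le:
  assumes "\<And>X. X \<in> K \<Longrightarrow> X \<notin> S \<Longrightarrow> X \<in> K' \<and> cl A' X = cl A X" "finite S" "card {X \<in> S. lab ` X = C} \<le> 1"
  shows "card (touched A' K' C) \<le> card (touched A K C) + 1"
proof -
  have "touched A' K' C \<subseteq> touched A K C \<union> {X \<in> S. lab ` X = C}"
    using assms(1) unfolding touched_def by auto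
  moreover have "finite (touched A K C)" using piecesD(2)[OF pieces0] by (simp add: touched_def)
  ultimately have "card (touched A' K' C) \<le> card (touched A K C \<union> {X \<in> S. lab ` X = C})"
    using assms(2) by (intro card_mono) auto
  also have "\<dots> \<le> card (touched A K C) + card {X \<in> S. lab ` X = C}" by (rule card_Un_le)
  finally show ?thesis using assms(3) by simp
qed

text \<open>Condenses the three kinds of moves into the dichotomy needed for the potential argument:
  a wasted spare edge, or one unit of progress in \<open>total\<close> at bounded cost.\<close>

lemma avoider_move:
  assumes inv: "inv A B K" and e: "e \<in> unclaimed n A B"
  obtains K' where "inv (insert e A) B K'"
    "total (insert e A) K' = total A K \<and> spare (insert e A) B K' = spare A B K - {e} \<and> e \<in> spare A B K \<and>
       live (insert e A) B K' = live A B K \<or>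
     total (insert e A) K' = total A K + 1 \<and> card (spare (insert e A) B K') \<le> card (spare A B K) + card V * n \<and>
       card (live A B K) \<le> card (live (insert e A) B K') + 2 * n"
    "\<And>C. C \<in> P \<Longrightarrow> card (touched (insert e A) K' C) \<le> card (touched A K C) + 1"
proof (cases "e \<in> prot A B K")
  case False
  then have s: "e \<in> spare A B K" using e by (simp add: spare_def)
  note w = inv_waste[OF inv s]
  have "total (insert e A) K = total A K" unfolding total_def using w(4) by (rule sum.cong[OF refl])
  moreover have "card (touched (insert e A) K C) \<le> card (touched A K C) + 1" for C
    by (rule card_touched_le[of K "{}"]) (use w(4) in auto)
  ultimately show ?thesis by (intro that[OF w(1)]) (use w(2,3) s in simp_all)
next
 case True
  note goalI = that
  have fK: "finite K" using invD(1)[OF inv] piecesD(2) by blast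
  have merge: ?thesis if W: "W \<in> K" "W' \<in> K" "lab ` W \<inter> lab ` W' = {}" "e \<in> bet W W'" "bet W W' \<inter> (A \<union> B) = {}"
    for W W'
  proof -
    note m = inv_merge[OF inv e W]
    have ne: "lab ` W \<noteq> lab ` W'" using W(3) piecesD(3)[OF invD(1)[OF inv] W(1)] by auto
    have tch: "card (touched (insert e A) (insert (W \<union> W') (K - {W, W'})) C) \<le> card (touched A K C) + 1" for C
    \<comment> \<open>Merged pieces have disjoint nonempty label sets, hence different types, so at
      most one old piece of each type is newly touched.\<close>
    proof (rule card_touched_le[of K "{W, W'}"])
      have "{X \<in> {W, W'}. lab ` X = C} \<subseteq> {if lab ` W = C then W else W'}" using ne by auto
      then have "card {X \<in> {W, W'}. lab ` X = C} \<le> card {if lab ` W = C then W else W'}"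
        by (rule card_mono[rotated]) simp
      then show "card {X \<in> {W, W'}. lab ` X = C} \<le> 1" by simp
    qed (use m(5) in auto)
    show ?thesis by (rule goalI[OF m(1)]) (use m(2-4) tch in simp_all)
  qed
  from True consider W where "W \<in> K" "e \<in> bet W W"
    | W W' where "W \<in> K" "W' \<in> K" "lab ` W \<inter> lab ` W' = {}" "\<not> hot W W'" "e \<in> bet W W'"
    | W W' where "(W, W') \<in> live A B K" "e \<in> bet W W'"
    unfolding prot_def by blast
  then show ?thesis
  proof cases
    case 1
    note c = inv_close[OF inv e 1]
    have "total (insert e A) K = total A K + 1"
    proof -
      have "K = insert W (K - {W})" using 1 by blast
      then have "total X K = cl X W + (\<Sum>Y\<in>K - {W}. cl X Y)" for X
        unfolding total_def using fK by (metis finite_Diff sum.remove 1(1))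
      moreover have "(\<Sum>Y\<in>K - {W}. cl (insert e A) Y) = (\<Sum>Y\<in>K - {W}. cl A Y)"
        by (rule sum.cong) (use c(5) in auto)
      ultimately show ?thesis using c(4) by simp
    qed
    moreover have "card (touched (insert e A) K C) \<le> card (touched A K C) + 1" for C
    proof (rule card_touched_le[of K "{W}"])
      have "card {X \<in> {W}. lab ` X = C} \<le> card {W}" by (rule card_mono) auto
      then show "card {X \<in> {W}. lab ` X = C} \<le> 1" by simp
    qed (use c(5) in auto)
    ultimately show ?thesis by (intro that[OF c(1)]) (use c(2,3) in simp_all)
  next
    case 2 then show ?thesis using merge[OF 2(1-3,5) invD(6)[OF inv 2(1-4)]] by blast
  next
    case 3 then show ?thesis using merge[OF live_D(3,4,9)[OF 3(1)] 3(2) live_D(8)[OF 3(1)]] by blast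
  qed
qed

section \<open>Enforcer's replies and the length of a stage\<close>

lemma card_cross_le: "card (cross C1 C2) \<le> card R + 1"
proof -
  have dj: "C1 \<inter> C2 = {}" using P_disjoint C12 by simp
  have fin: "finite C1" "finite C2" using P_D(2) C12 finite_V finite_subset by blast+
  have "card (inner (C1 \<union> C2)) < card (C1 \<union> C2) + card R"
    using P_D C12 by (intro card_inner_le) auto
  then show ?thesis using card_inner_Un[OF dj] card_Un_disjoint[OF fin dj] card_le_f[OF C12(1)]
      card_le_f[OF C12(2)] f_le_inner[OF C12(1)] f_le_inner[OF C12(2)] by linarith
qed

text \<open>Parts \<open>C\<close> of a layout span at least \<open>card C - 1\<close> edges, so a
  second edge between two parts closes a cycle. It occurs only for unicyclic patterns, and this is
  where the parity of \<open>b\<close> enters.\<close>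

lemma b_dvd: "card (cross C1 C2) dvd b" "card (cross C1 C2) \<in> {1, 2}"
proof -
  have "0 < card (cross C1 C2)" using C12(4) by (simp add: card_gt_0_iff)
  then have c: "card (cross C1 C2) = 1 \<or> card (cross C1 C2) = 2 \<and> R \<noteq> {}"
    using card_cross_le card_R by (cases "R = {}") auto
  then show "card (cross C1 C2) \<in> {1, 2}" by blast
  show "card (cross C1 C2) dvd b" using c
  proof
    assume "card (cross C1 C2) = 2 \<and> R \<noteq> {}"
    then show ?thesis using b_even by presburger
  qed simp
qed

lemma live_bet:
  assumes "inv A B K" "(W, W') \<in> live A B K"
  shows "card (bet W W') = card (cross C1 C2)" "finite (bet W W')" "bet W W' \<subseteq> unclaimed n A B"
proof -
  note l = live_D[OF assms(2)] and pD = piecesD[OF invD(1)[OF assms(1)]]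
  show "card (bet W W') = card (cross C1 C2)"
    using card_bet pieces_inj2(1)[OF invD(1)[OF assms(1)] l(3,4,9)] l(5,6) by metis
  show "finite (bet W W')" using finite_bet pD(5) l(3,4) by blast
  show "bet W W' \<subseteq> unclaimed n A B"
    using bet_edges[OF pD(4)[OF l(3)] pD(4)[OF l(4)]] l(8) unfolding unclaimed_def by blast
qed

text \<open>By uniqueness of bundles such edges lie neither inside a piece nor between pieces that
  form no hot pair with disjoint labels, and \<open>inv\<close> restricts Enforcer's edges only
  there.\<close>

lemma inv_B:
  assumes inv: "inv A B K" and Y: "Y \<subseteq> spare A B K \<union> (\<Union>(W, W')\<in>live A B K. bet W W')"
  shows "inv A (B \<union> Y) K"
proof -
  note pD = piecesD[OF invD(1)[OF inv]]
  have uniq: "(X = W \<and> X' = W') \<or> (X = W' \<and> X' = W)"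
    if "(W, W') \<in> live A B K" "x \<in> bet W W'" "X \<in> K" "X' \<in> K" "x \<in> bet X X'" for W W' X X' x
    using bet_unique[OF pD(1) live_D(3,4)[OF that(1)] that(3,4,2,5)] .
  have 1: "bet X X \<inter> Y = {}" if "X \<in> K" for X
  proof -
    have "x \<notin> spare A B K" if "x \<in> bet X X" for x
      using that \<open>X \<in> K\<close> unfolding spare_def prot_def by blast
    moreover have "x \<notin> bet W W'" if "x \<in> bet X X" "(W, W') \<in> live A B K" for x W W'
      using uniq[OF that(2) _ \<open>X \<in> K\<close> \<open>X \<in> K\<close> that(1)] live_D(7)[OF that(2)] by blast
    ultimately show ?thesis using Y by blast
  qed
  have 2: "bet X X' \<inter> Y = {}"
    if X: "X \<in> K" "X' \<in> K" "lab ` X \<inter> lab ` X' = {}" "\<not> hot X X'" for X X'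
  proof -
    have "x \<notin> spare A B K" if "x \<in> bet X X'" for x
      using that X unfolding spare_def prot_def by blast
    moreover have "x \<notin> bet W W'" if "x \<in> bet X X'" "(W, W') \<in> live A B K" for x W W'
      using uniq[OF that(2) _ X(1,2) that(1)] live_hot[OF inv that(2)] X(4) unfolding hot_def by blast
    ultimately show ?thesis using Y by blast
  qed
  have "pieces A (B \<union> Y) K" using invD(1)[OF inv] 1 unfolding pieces_def by (simp add: Int_Un_distrib)
  moreover have "bet X X' \<inter> (A \<union> (B \<union> Y)) = {}"
    if X: "X \<in> K" "X' \<in> K" "lab ` X \<inter> lab ` X' = {}" "\<not> hot X X'" for X X'
    using invD(6)[OF inv X] 2[OF X] by blast
  ultimately show ?thesis using inv unfolding inv_def by simp
qed

text \<open>If no spare edges are left then Enforcer claims whole bundles \<open>bet W W'\<close> of hot pairs. As their size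
  divides \<open>b\<close>, he leaves no spare edges again.\<close>

lemma reply:
  assumes inv: "inv A B K" and enough: "b \<le> card (spare A B K) \<or> b \<le> card (live A B K)"
  obtains Y where "Y \<subseteq> unclaimed n A B" "card Y = b" "inv A (B \<union> Y) K"
    "b \<le> card (spare A B K) \<and> live A (B \<union> Y) K = live A B K \<or>
     card (spare A B K) < b \<and> card (live A B K) \<le> card (live A (B \<union> Y) K) + b \<and>
     card (spare A (B \<union> Y) K) \<le> 1 \<and> (spare A B K = {} \<longrightarrow> spare A (B \<union> Y) K = {})"
proof (cases "b \<le> card (spare A B K)")
  case True
  then obtain Y where Y: "Y \<subseteq> spare A B K" "card Y = b" by (rule obtain_subset_with_card_n)
  then have "inv A (B \<union> Y) K" using inv_B[OF inv] by blast
  moreover have "x \<notin> bet W W'" if "x \<in> Y" "(W, W') \<in> live A B K" for x W W'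
    using that Y(1) unfolding spare_def prot_def by blast
  then have "live A (B \<union> Y) K = live A B K" unfolding live_def by auto
  moreover have "Y \<subseteq> unclaimed n A B" using Y(1) by (auto simp: spare_def)
  ultimately show ?thesis using that[of Y] Y(2) True by blast
next
  case False
  define d where "d = card (cross C1 C2)"
  define r where "r = b - card (spare A B K)"
  \<comment> \<open>The number of bundles: \<open>r / d\<close> rounded up. At most
    \<open>d - 1 \<le> 1\<close> of their edges stay unclaimed, and none if all \<open>b\<close>
    edges come from bundles.\<close>
  define m where "m = (r + d - 1) div d"
  have d: "d = 1 \<or> d = 2" "d dvd b" using b_dvd by (auto simp: d_def)
  have m: "r \<le> m * d" "m * d < r + d" "m \<le> b"
  proof -
    show "r \<le> m * d" "m * d < r + d" using d(1) unfolding m_def by auto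
    then show "m \<le> b" using d(1) unfolding r_def m_def by auto
  qed
  obtain L where L: "L \<subseteq> live A B K" "card L = m"
    using enough False m(3) obtain_subset_with_card_n[of m "live A B K"] by auto
  have finL: "finite L" using L(1) finite_live finite_subset by blast
  define Z where "Z = (\<Union>(W, W')\<in>L. bet W W')"
  note pD = piecesD[OF invD(1)[OF inv]]
  have uniq: "(X = W \<and> X' = W')"
    if "(W, W') \<in> live A B K" "x \<in> bet W W'" "X \<in> D1 \<inter> K" "X' \<in> D2 \<inter> K" "x \<in> bet X X'" for W W' X X' x
    using bet_unique[OF pD(1) live_D(3,4)[OF that(1)], of X X' x] live_D(1,2)[OF that(1)] that D12_disjoint by blast
  have cardZ: "card Z = m * d"
  proof -
    have "card Z = (\<Sum>p\<in>L. card (case p of (W, W') \<Rightarrow> bet W W'))"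
      unfolding Z_def
    proof (rule card_UN_disjoint[OF finL])
      show "\<forall>i\<in>L. finite (case i of (W, W') \<Rightarrow> bet W W')" using live_bet(2)[OF inv] L(1) by auto
      show "\<forall>i\<in>L. \<forall>j\<in>L. i \<noteq> j \<longrightarrow> (case i of (W, W') \<Rightarrow> bet W W') \<inter> (case j of (W, W') \<Rightarrow> bet W W') = {}"
      proof (intro ballI impI)
        fix i j assume ij: "i \<in> L" "j \<in> L" "i \<noteq> j"
        obtain W W' X X' where e: "i = (W, W')" "j = (X, X')" by (cases i, cases j)
        have "x \<notin> bet X X'" if "x \<in> bet W W'" for x
          using uniq[of W W' x X X'] that ij e L(1) live_D[of X X'] by blast
        then show "(case i of (W, W') \<Rightarrow> bet W W') \<inter> (case j of (W, W') \<Rightarrow> bet W W') = {}" using e by auto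
      qed
    qed
    also have "\<dots> = (\<Sum>p\<in>L. d)"
      by (rule sum.cong) (use live_bet(1)[OF inv] L(1) in \<open>auto simp: d_def\<close>)
    finally show ?thesis using L(2) by simp
  qed
  have finZ: "finite Z" unfolding Z_def using finL live_bet(2)[OF inv] L(1) by auto
  obtain Y2 where Y2: "Y2 \<subseteq> Z" "card Y2 = r"
    using obtain_subset_with_card_n[of r Z] m(1) cardZ by auto
  define Y where "Y = spare A B K \<union> Y2"
  have ZU: "Z \<subseteq> unclaimed n A B" unfolding Z_def using live_bet(3)[OF inv] L(1) by blast
  have Zprot: "Z \<subseteq> prot A B K" unfolding Z_def prot_def using L(1) by blast
  have finY2: "finite Y2" using Y2(1) finZ finite_subset by blast
  have fs: "finite (spare A B K)" using finite_unclaimed by (simp add: spare_def)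
  have YU: "Y \<subseteq> unclaimed n A B" using ZU Y2(1) by (auto simp: Y_def spare_def)
  have "spare A B K \<inter> Y2 = {}" using Zprot Y2(1) by (auto simp: spare_def)
  then have cardY: "card Y = b" unfolding Y_def using Y2(2) False fs finY2 by (simp add: card_Un_disjoint r_def)
  have invY: "inv A (B \<union> Y) K"
    by (rule inv_B[OF inv]) (use Y2(1) L(1) in \<open>unfold Y_def Z_def, blast\<close>)
  have keep: "p \<in> live A (B \<union> Y) K" if "p \<in> live A B K - L" for p
  proof -
    obtain X X' where p: "p = (X, X')" by (cases p)
    have l: "(X, X') \<in> live A B K" "(X, X') \<notin> L" using that p by auto
    have "x \<notin> Y2" if "x \<in> bet X X'" for x
    proof
      assume "x \<in> Y2"
      then obtain W W' where "(W, W') \<in> L" "x \<in> bet W W'" using Y2(1) unfolding Z_def by blast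
      then show False using uniq[of W W' x X X'] that l L(1) live_D[OF l(1)] by blast
    qed
    moreover have "x \<notin> spare A B K" if "x \<in> bet X X'" for x
      using that l(1) unfolding spare_def prot_def by blast
    ultimately have "bet X X' \<inter> Y = {}" unfolding Y_def by blast
    then show ?thesis using l(1) unfolding p live_def by blast
  qed
  have "card (live A B K) \<le> card (live A (B \<union> Y) K) + b"
  proof -
    have "card (live A B K - L) \<le> card (live A (B \<union> Y) K)"
      using keep by (intro card_mono finite_live) auto
    then show ?thesis using L(2) m(3) card_Diff_subset[OF finL L(1)] by linarith
  qed
  \<comment> \<open>The other live pairs stay live and protected, so only leftovers of the chosen
    bundles can become spare.\<close>
  moreover have sub: "spare A (B \<union> Y) K \<subseteq> Z - Y2"
  proof
    fix x assume x: "x \<in> spare A (B \<union> Y) K"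
    then have xu: "x \<in> unclaimed n A B" "x \<notin> Y" "x \<notin> prot A (B \<union> Y) K" by (auto simp: spare_def unclaimed_def)
    then have "x \<in> prot A B K" unfolding Y_def spare_def by blast
    moreover have "x \<notin> bet W W'" if "(W, W') \<in> live A B K - L" for W W'
      using xu(3) keep[OF that] unfolding prot_def by blast
    ultimately have "x \<in> Z" using xu(3) unfolding prot_def Z_def by blast
    then show "x \<in> Z - Y2" using xu(2) by (simp add: Y_def)
  qed
  have c: "card (Z - Y2) = m * d - r" using card_Diff_subset[OF finY2 Y2(1)] cardZ Y2(2) by simp
  then have "card (spare A (B \<union> Y) K) \<le> m * d - r"
    using card_mono[OF finite_Diff[OF finZ] sub] by simp
  then have "card (spare A (B \<union> Y) K) \<le> 1" using m(2) d(1) by linarith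
  moreover have "spare A (B \<union> Y) K = {}" if "spare A B K = {}"
  proof -
    have "r = b" using that by (simp add: r_def)
    then have "d dvd r" using d(2) by simp
    then obtain q where q: "r = d * q" by blast
    then have "m * d = r" using m(1,2) d(1) by auto
    then have "Z - Y2 = {}" using c finZ by simp
    then show ?thesis using sub by blast
  qed
  ultimately show ?thesis using that[of Y] YU cardY invY False by auto
qed

text \<open>Unaltered pieces contribute as at the start of the stage. Since
  \<open>card K \<le> card K0\<close>, there are no more altered current pieces than altered old
  ones, and each contributes at most \<open>card E\<close>.\<close>

lemma total_le: 
  assumes inv: "inv A B K"
  shows "total A K \<le> total A0 K0 + card E * (\<Sum>C\<in>P. card (touched A K C))"
proof -
  define U where "U = {W \<in> K0 \<inter> K. cl A W = f (lab ` W)}"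
  have fK: "finite K" "finite K0" using piecesD(2) invD(1)[OF inv] pieces0 by blast+
  have U: "U \<subseteq> K" "U \<subseteq> K0" "finite U" using fK by (auto simp: U_def)
  have "total A K = (\<Sum>W\<in>U. cl A W) + (\<Sum>W\<in>K - U. cl A W)"
    unfolding total_def using sum.subset_diff[OF U(1) fK(1), of "cl A"] by linarith
  also have "(\<Sum>W\<in>U. cl A W) = (\<Sum>W\<in>U. cl A0 W)"
    by (rule sum.cong) (auto simp: U_def lab_K0(2))
  also have "(\<Sum>W\<in>U. cl A0 W) \<le> total A0 K0"
    unfolding total_def by (rule sum_mono2) (use fK U in auto)
  also have "(\<Sum>W\<in>K - U. cl A W) \<le> (\<Sum>W\<in>K - U. card E)"
  proof (rule sum_mono)
    fix W assume "W \<in> K - U"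
    then have W: "W \<in> K" by simp
    have "cl A W \<le> card (inner (lab ` W))"
      using cl_le piecesD(6,5)[OF invD(1)[OF inv] W] .
    then show "cl A W \<le> card E" using card_inner_le_E order_trans by blast
  qed
  also have "(\<Sum>W\<in>K - U. card E) = card E * card (K - U)" by simp
  also have "card (K - U) \<le> card (K0 - U)"
    using card_Diff_subset[OF U(3,1)] card_Diff_subset[OF U(3,2)] invD(5)[OF inv] by linarith
  also have "card (K0 - U) \<le> card (\<Union>C\<in>P. touched A K C)"
  proof (rule card_mono)
    show "finite (\<Union>C\<in>P. touched A K C)" using finite_P fK by (auto simp: touched_def)
    show "K0 - U \<subseteq> (\<Union>C\<in>P. touched A K C)" using lab_K0(1) by (auto simp: touched_def U_def)
  qed
  also have "\<dots> \<le> (\<Sum>C\<in>P. card (touched A K C))" by (rule card_UN_le[OF finite_P])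
  finally show ?thesis by simp
qed

lemma card_P: "card P \<le> card V"
proof -
  have "card V = (\<Sum>C\<in>P. card C)"
  proof -
    have "card (\<Union>P) = (\<Sum>C\<in>P. card C)"
      by (rule card_Union_disjoint)
        (use P_D(2) finite_V P_disjoint in \<open>auto simp: pairwise_def disjnt_def intro: finite_subset\<close>)
    then show ?thesis using part by (simp add: partition_on_def)
  qed
  also have "(\<Sum>C\<in>P. card C) \<ge> (\<Sum>C\<in>P. 1)"
  proof (rule sum_mono)
    fix C assume "C \<in> P"
    then show "1 \<le> card C" using P_D finite_V finite_subset by (metis One_nat_def Suc_leI card_gt_0_iff)
  qed
  finally show ?thesis by simp
qed

text \<open>The second bound is a fixed fraction of the number of rounds that the hot pairs can
  feed; the first one keeps most pieces of every type untouched.\<close>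

definition stop :: "real \<Rightarrow> edge set \<Rightarrow> nat set set \<Rightarrow> bool" where
  "stop \<delta> A K \<longleftrightarrow> (\<exists>C\<in>P. min (\<delta> * cnt K0 C) (\<delta> * (real (cnt K0 C1) * cnt K0 C2) / (b + 1)) <
     card (touched A K C))"

lemma card_live_0:
  "live A0 B0 K0 = D1 \<times> D2"
proof -
  have "bet W W' \<inter> (A0 \<union> B0) = {}" if "W \<in> D1" "W' \<in> D2" for W W'
  proof -
    have W: "W \<in> K0" "W' \<in> K0" "lab ` W = C1" "lab ` W' = C2" using that D1_sub D2_sub by auto
    then have "lab ` W \<noteq> lab ` W'" using C12(3) by simp
    then show ?thesis using layout0 W(1,2) unfolding layout_def by blast
  qed
  then show ?thesis using D1_sub D2_sub unfolding live_def by auto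
qed


text \<open>The number \<open>k\<close> of rounds in which Enforcer had to claim hot pairs is controlled by the number
  \<open>total A K - total A0 K0\<close> of useful moves of Avoider: she makes at most one other move between two of them.\<close>

lemma stage_win_aux:
  fixes \<delta> :: real
  assumes \<delta>: "0 < \<delta>" "96 * (card E * card V * \<delta>) \<le> 1"
    and D: "real (cnt K0 C1) * cnt K0 C2 \<le> 16 * (card D1 * card D2)"
    and Z: "128 * (real b + 1) \<le> real (cnt K0 C1) * cnt K0 C2"
    and stop: "\<And>A B K. inv A B K \<Longrightarrow> stop \<delta> A K \<Longrightarrow>
      (\<And>C. C \<in> P \<Longrightarrow> card (touched A K C) \<le> \<delta> * cnt K0 C + 1) \<Longrightarrow> win n b Q A B"
  shows "inv A B K \<Longrightarrow> (\<And>C. C \<in> P \<Longrightarrow> card (touched A K C) \<le> \<delta> * cnt K0 C + 1) \<Longrightarrow>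
    total A K = total A0 K0 + t \<Longrightarrow>
    card D1 * card D2 \<le> card (live A B K) + 2 * n * t + b * k \<Longrightarrow>
    k = 0 \<or> card (spare A B K) \<le> 1 \<and> k + card (spare A B K) \<le> 2 * t + 2 \<Longrightarrow> win n b Q A B"
\<comment> \<open>The finite supply of edges ends the stage; the live pairs guarantee that unclaimed
  edges remain until \<open>stop\<close> holds.\<close>
proof (induction "card (unclaimed n A B)" arbitrary: A B K t k rule: less_induct)
  case less
  note inv = less.prems(1) and live = less.prems(4) and k = less.prems(5)
  show ?case
  proof (cases "stop \<delta> A K")
    case True
    then show ?thesis using stop[OF inv] less.prems(2) by blast
  next
    case ns: False
    define z where "z = real (cnt K0 C1) * cnt K0 C2"
    have tch: "card (touched A K C) \<le> \<delta> * cnt K0 C" "card (touched A K C) \<le> \<delta> * z / (b + 1)" if "C \<in> P" for C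
    proof -
      have "\<not> min (\<delta> * cnt K0 C) (\<delta> * z / (b + 1)) < card (touched A K C)"
        using ns that unfolding stop_def z_def by blast
      then show "card (touched A K C) \<le> \<delta> * cnt K0 C" "card (touched A K C) \<le> \<delta> * z / (b + 1)"
        by (simp_all add: min_less_iff_disj not_less)
    qed
    have vn: "2 * n \<le> b" "card V * n + 1 < b" 
    proof -
      have "2 * n \<le> card V * n" "1 \<le> n" using card_E_V(2) n_pos by simp_all
      then show "2 * n \<le> b" "card V * n + 1 < b" using b_large by linarith+
    qed
    have z0: "0 \<le> z" by (simp add: z_def)
    have t: "96 * real t * (b + 1) \<le> z"
    proof -
      have "t \<le> card E * (\<Sum>C\<in>P. card (touched A K C))"
        using total_le[OF inv] less.prems(3) by simp
      then have "real t \<le> real (card E) * (\<Sum>C\<in>P. real (card (touched A K C)))"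
        by (metis of_nat_le_iff of_nat_mult of_nat_sum)
      also have "(\<Sum>C\<in>P. real (card (touched A K C))) \<le> (\<Sum>C\<in>P. \<delta> * z / (b + 1))"
        by (rule sum_mono) (rule tch(2))
      also have "\<dots> = card P * (\<delta> * z / (b + 1))" by simp
      also have "\<dots> \<le> card V * (\<delta> * z / (b + 1))"
        using card_P \<delta>(1) z0 by (intro mult_right_mono) auto
      finally have "real t \<le> card E * (card V * (\<delta> * z / (b + 1)))" by (simp add: mult_left_mono)
      then have "real t * (b + 1) \<le> (card E * card V * \<delta>) * z" by (simp add: field_simps)
      moreover have "96 * (card E * card V * \<delta>) * z \<le> 1 * z"
        using \<delta>(2) z0 by (rule mult_right_mono)
      ultimately show ?thesis by linarith
    qed
    \<comment> \<open>Up to the factor 16, \<open>z\<close> is bounded by the initial number of hot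
      pairs. One half of \<open>z\<close> pays for \<open>3 * b * t\<close>, as 96 = 2 * 16 * 3, and
      the other half for \<open>4 * b\<close>, as 128 = 2 * 16 * 4.\<close>
    have res: "3 * b * t + 4 * b \<le> card D1 * card D2"
    proof -
      have "16 * (3 * (real b * t) + 4 * b) \<le> z"
        using t Z unfolding z_def[symmetric] by (simp add: algebra_simps)
      also have "z \<le> 16 * (card D1 * card D2)" using D by (simp add: z_def)
      finally have "3 * (real b * t) + 4 * b \<le> card D1 * card D2" by simp
      then have "real (3 * b * t + 4 * b) \<le> real (card D1 * card D2)" by (simp add: algebra_simps)
      then show ?thesis by (simp only: of_nat_le_iff)
    qed
    have kt: "k \<le> 2 * t + 2" using k by auto
    have "b * k \<le> b * (2 * t + 2)" using kt by (rule mult_le_mono2)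
    then have "b * k \<le> 2 * (b * t) + 2 * b" by (simp add: algebra_simps)
    moreover have nt: "2 * n * t \<le> b * t" using vn(1) by (rule mult_le_mono1)
    moreover have "3 * (b * t) + 4 * b \<le> card D1 * card D2" using res by (simp add: algebra_simps)
    \<comment> \<open>Up to \<open>2 * n\<close> pairs may fall to Avoider's next merge, and
      \<open>b\<close> must be left for the reply.\<close>
    ultimately have lv: "b + 2 * n \<le> card (live A B K)"
      using live vn(1) by linarith
    show ?thesis
    proof (rule win.step)
      have "live A B K \<noteq> {}" using lv b_pos by auto
      then obtain W W' where "(W, W') \<in> live A B K" by auto
      then show "unclaimed n A B \<noteq> {}" using live_bet[OF inv] C12(4)
        by (metis card_gt_0_iff finite_cross card.empty less_irrefl subset_empty)
    next
      fix e assume e: "e \<in> unclaimed n A B"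
      let ?A = "insert e A"
      from avoider_move[OF inv e] obtain K' where inv': "inv ?A B K'"
        and mv: "total ?A K' = total A K \<and> spare ?A B K' = spare A B K - {e} \<and> e \<in> spare A B K \<and>
            live ?A B K' = live A B K \<or>
          total ?A K' = total A K + 1 \<and> card (spare ?A B K') \<le> card (spare A B K) + card V * n \<and>
            card (live A B K) \<le> card (live ?A B K') + 2 * n"
        and tch': "\<And>C. C \<in> P \<Longrightarrow> card (touched ?A K' C) \<le> card (touched A K C) + 1"
        by metis
      define t' where "t' = (if total ?A K' = total A K then t else t + 1)"
      have t': "total ?A K' = total A0 K0 + t'" using mv less.prems(3) by (auto simp: t'_def)
      have live': "card (live A B K) + 2 * n * t \<le> card (live ?A B K') + 2 * n * t'"
        using mv by (auto simp: t'_def)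
      have "b \<le> card (live ?A B K')" using mv lv by auto
      from reply[OF inv' disjI2[OF this]] obtain Y where Y: "Y \<subseteq> unclaimed n ?A B" "card Y = b"
        "inv ?A (B \<union> Y) K'"
        "b \<le> card (spare ?A B K') \<and> live ?A (B \<union> Y) K' = live ?A B K' \<or>
         card (spare ?A B K') < b \<and> card (live ?A B K') \<le> card (live ?A (B \<union> Y) K') + b \<and>
         card (spare ?A (B \<union> Y) K') \<le> 1 \<and> (spare ?A B K' = {} \<longrightarrow> spare ?A (B \<union> Y) K' = {})" by metis
      have fs: "finite (spare A B K)" using finite_unclaimed by (simp add: spare_def)
      have "\<exists>k'. card D1 * card D2 \<le> card (live ?A (B \<union> Y) K') + 2 * n * t' + b * k' \<and>
        (k' = 0 \<or> card (spare ?A (B \<union> Y) K') \<le> 1 \<and> k' + card (spare ?A (B \<union> Y) K') \<le> 2 * t' + 2)"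
        using Y(4)
      proof (rule disjE, goal_cases)
        case big: 1
        \<comment> \<open>Once hot pairs have been used there is at most one spare edge, and a
          single merge creates too few new ones to fill a move.\<close>
        have "k = 0"
        proof (rule ccontr)
          assume "k \<noteq> 0"
          then have "card (spare A B K) \<le> 1" using k by simp
          then have "card (spare ?A B K') \<le> 1 + card V * n"
            using mv card_Diff1_le[of "spare A B K" e] by auto
          then show False using big vn by simp
        qed
        then show ?thesis using big live live' by (intro exI[of _ 0]) auto
      next
        case small: 2
        \<comment> \<open>Wasting the last spare edge trades it for one round, as the reply then
          uses whole bundles and leaves none. A useful move raises the right side by two, which pays
          for the round and for at most one new spare edge.\<close>
        have "k + 1 + card (spare ?A (B \<union> Y) K') \<le> 2 * t' + 2"
        proof (cases "k = 0")
          case True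
          then show ?thesis using small by simp
        next
          case False
          then have kk: "card (spare A B K) \<le> 1" "k + card (spare A B K) \<le> 2 * t + 2" using k by auto
          from mv show ?thesis
          proof (rule disjE, goal_cases)
            case w: 1
            then have "card (spare A B K) = 1" using kk(1) fs by (metis One_nat_def Suc_leI card_gt_0_iff empty_iff le_antisym)
            then have "spare ?A B K' = {}" using w by (metis card_1_singletonE Diff_cancel singletonD)
            then have "card (spare ?A (B \<union> Y) K') = 0" using small by simp
            moreover have "t' = t" using w by (simp add: t'_def)
            ultimately show ?thesis using kk(2) \<open>card (spare A B K) = 1\<close> by simp
          next
            case 2
            then have "t' = t + 1" by (simp add: t'_def)
            then show ?thesis using small kk by simp
          qed
        qed
        moreover have "card D1 * card D2 \<le> card (live ?A (B \<union> Y) K') + 2 * n * t' + b * (k + 1)"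
          using live live' small by simp
        ultimately show ?thesis using small by (intro exI[of _ "k + 1"]) simp
      qed
      then obtain k' where k': "card D1 * card D2 \<le> card (live ?A (B \<union> Y) K') + 2 * n * t' + b * k'"
        "k' = 0 \<or> card (spare ?A (B \<union> Y) K') \<le> 1 \<and> k' + card (spare ?A (B \<union> Y) K') \<le> 2 * t' + 2" by blast
      have "card (unclaimed n ?A (B \<union> Y)) < card (unclaimed n A B)"
        by (rule psubset_card_mono[OF finite_unclaimed]) (use e in \<open>auto simp: unclaimed_def\<close>)
      moreover have "real (card (touched ?A K' C)) \<le> \<delta> * cnt K0 C + 1" if "C \<in> P" for C
        using tch'[OF that] tch(1)[OF that] by linarith
      ultimately have "win n b Q ?A (B \<union> Y)"
        using less.hyps[OF _ Y(3) _ t' k'] by blast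
      moreover have "card Y = min b (card (unclaimed n ?A B))"
        using Y(1,2) card_mono[OF finite_unclaimed Y(1)] by simp
      ultimately show "\<exists>Y. Y \<subseteq> unclaimed n ?A B \<and> card Y = min b (card (unclaimed n ?A B)) \<and>
          win n b Q ?A (B \<union> Y)" using Y(1) by blast
    qed
  qed
qed

end

section \<open>From a finished stage to the next layout\<close>

lemma pigeonhole_fibre:
  assumes "finite S" "S \<noteq> {}" "finite T" "g ` S \<subseteq> T"
  obtains y where "y \<in> T" "card S \<le> card T * card {x \<in> S. g x = y}"
proof (rule ccontr)
  assume "\<not> thesis"
  then have small: "card T * card {x \<in> S. g x = y} < card S" if "y \<in> T" for y
    using that \<open>\<And>y. y \<in> T \<Longrightarrow> card S \<le> card T * card {x \<in> S. g x = y} \<Longrightarrow> thesis\<close> not_le by blast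
  have T: "T \<noteq> {}" using assms by auto
  have "S = (\<Union>y\<in>T. {x \<in> S. g x = y})" using assms(4) by auto
  then have "card S \<le> (\<Sum>y\<in>T. card {x \<in> S. g x = y})"
    using card_UN_le[OF assms(3), of "\<lambda>y. {x \<in> S. g x = y}"] by simp
  then have "card T * card S \<le> (\<Sum>y\<in>T. card T * card {x \<in> S. g x = y})"
    by (simp add: sum_distrib_left[symmetric])
  also have "\<dots> < (\<Sum>y\<in>T. card S)" by (rule sum_strict_mono) (use assms T small in auto)
  finally show False by simp
qed

context labelled
begin

lemma pieces_subset:
  assumes "pieces A B K" "K' \<subseteq> K"
  shows "pieces A B K'"
proof -
  have "disjoint K'"
    by (rule disjointI) (use disjointD piecesD(1)[OF assms(1)] assms(2) in blast)
  moreover have "\<And>W. W \<in> K' \<Longrightarrow> W \<in> K" using assms(2) by (rule subsetD)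
  ultimately show ?thesis using assms(1) unfolding pieces_def by simp
qed

end

context stage
begin

text \<open>Many touched pieces of type \<open>X\<close> lie in many altered current pieces; a
  frequent combination of type and claimed count among these becomes the new type. Untouched pieces
  of types disjoint from it are kept, except those in \<open>D1\<close> and \<open>D2\<close>,
  between which edges may be lost.\<close>

lemma next_layout:
  fixes \<delta> :: real
  assumes inv: "inv A B K" and stop: "stop \<delta> A K"
    and tch: "\<And>C. C \<in> P \<Longrightarrow> card (touched A K C) \<le> \<delta> * cnt K0 C + 1"
    and \<delta>: "0 < \<delta>" "\<delta> \<le> 1 / 8" and D: "2 * card D1 \<le> cnt K0 C1" "2 * card D2 \<le> cnt K0 C2"
    and big: "\<And>C. C \<in> P \<Longrightarrow> 8 \<le> cnt K0 C"
  obtains \<tau> k K' X where "X \<in> P" "X \<subseteq> \<tau>" "conn \<tau>" "\<tau> \<subseteq> V" "\<forall>C\<in>P. C \<subseteq> \<tau> \<or> C \<inter> \<tau> = {}"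
    "layout A B (insert \<tau> {C \<in> P. C \<inter> \<tau> = {}}) (f(\<tau> := k)) K'"
    "min (\<delta> * cnt K0 X) (\<delta> * (real (cnt K0 C1) * cnt K0 C2) / (b + 1)) < 2 ^ card V * (card E + 1) * real (cnt K' \<tau>)"
    "\<forall>C\<in>P. C \<inter> \<tau> = {} \<longrightarrow> cnt K0 C \<le> 4 * cnt K' C"
    "(\<Sum>C | C \<in> P \<and> C \<subseteq> \<tau>. f C + 1) \<le> k + 1" "\<tau> \<in> P \<longrightarrow> f \<tau> < k" "k \<le> card (inner \<tau>)"
proof -
  note pD = piecesD[OF invD(1)[OF inv]] and p0 = piecesD[OF pieces0]
  obtain X where X: "X \<in> P" and mX: "min (\<delta> * cnt K0 X) (\<delta> * (real (cnt K0 C1) * cnt K0 C2) / (b + 1)) < card (touched A K X)"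
    using stop unfolding stop_def by blast
  define S where "S = {W \<in> K. \<exists>W0\<in>K0. lab ` W0 = X \<and> W0 \<subseteq> W \<and> \<not> (W \<in> K0 \<and> cl A W = f X)}"
  have same: "W0 = W" if "W0 \<in> K0" "W \<in> K0" "W0 \<subseteq> W" for W0 W
    using disjointD[OF p0(1) that(1,2)] that(3) p0(3)[OF that(1)] by blast
  have "\<exists>g. \<forall>W0\<in>touched A K X. g W0 \<in> K \<and> W0 \<subseteq> g W0"
    using invD(4)[OF inv] unfolding touched_def by (intro bchoice) auto
  then obtain g where g: "\<And>W0. W0 \<in> touched A K X \<Longrightarrow> g W0 \<in> K" "\<And>W0. W0 \<in> touched A K X \<Longrightarrow> W0 \<subseteq> g W0"
    by blast
  have "g ` touched A K X \<subseteq> S"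
  proof
    fix W assume "W \<in> g ` touched A K X"
    then obtain W0 where W0: "W0 \<in> touched A K X" "W = g W0" by blast
    have w: "W0 \<in> K0" "lab ` W0 = X" "\<not> (W0 \<in> K \<and> cl A W0 = f X)" using W0(1) by (auto simp: touched_def)
    have "\<not> (W \<in> K0 \<and> cl A W = f X)" using same[of W0 W] w g[OF W0(1)] W0(2) by auto
    then show "W \<in> S" using g[OF W0(1)] W0(2) w unfolding S_def by blast
  qed
  \<comment> \<open>Labels are injective on a piece, so it cannot contain two old pieces of the same
    type.\<close>
  moreover have "inj_on g (touched A K X)"
  proof (rule inj_onI)
    fix W W' assume a: "W \<in> touched A K X" "W' \<in> touched A K X" "g W = g W'"
    have "lab ` W = lab ` W'" using a(1,2) by (simp add: touched_def)
    moreover have "W \<subseteq> g W" "W' \<subseteq> g W" using g(2)[OF a(1)] g(2)[OF a(2)] a(3) by simp_all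
    ultimately show "W = W'" using inj_on_image_eq_iff[OF pD(6)[OF g(1)[OF a(1)]]] by blast
  qed
  moreover have finS: "finite S" using pD(2) by (simp add: S_def)
  ultimately have cS: "card (touched A K X) \<le> card S" using card_inj_on_le by blast
  have "0 < card (touched A K X)"
    using mX \<delta>(1) by (cases "card (touched A K X) = 0") (auto simp: min_less_iff_disj not_less mult_less_0_iff zero_le_mult_iff divide_less_0_iff)
  then have Sne: "S \<noteq> {}" using cS by auto
  let ?T = "Pow V \<times> {..card E}"
  have "(\<lambda>W. (lab ` W, cl A W)) ` S \<subseteq> ?T"
  proof
    fix y assume "y \<in> (\<lambda>W. (lab ` W, cl A W)) ` S"
    then obtain W where W: "y = (lab ` W, cl A W)" "W \<in> K" unfolding S_def by blast
    have "cl A W \<le> card E" using cl_le[OF pD(6,5)[OF W(2)], of A] card_inner_le_E order_trans by blast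
    then show "y \<in> ?T" using W(1) pD(7)[OF W(2)] by simp
  qed
  then obtain y where y: "y \<in> ?T" "card S \<le> card ?T * card {W \<in> S. (lab ` W, cl A W) = y}"
    using pigeonhole_fibre[OF finS Sne, of ?T] finite_V by blast
  obtain \<tau> k where \<tau>k: "y = (\<tau>, k)" by (cases y)
  define F where "F = {W \<in> S. lab ` W = \<tau> \<and> cl A W = k}"
  define G where "G = {W \<in> K \<inter> K0. lab ` W \<inter> \<tau> = {} \<and> cl A W = f (lab ` W) \<and> W \<notin> D1 \<union> D2}"
  have cardT: "card ?T = 2 ^ card V * (card E + 1)" using finite_V by (simp add: card_cartesian_product card_Pow)
  have SF: "card S \<le> 2 ^ card V * (card E + 1) * card F"
    using y(2) unfolding \<tau>k cardT F_def by simp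
  then have "F \<noteq> {}" using Sne finS by auto
  then obtain W1 W0 where W1: "W1 \<in> K" "lab ` W1 = \<tau>" "cl A W1 = k" and W0: "W0 \<in> K0" "lab ` W0 = X" "W0 \<subseteq> W1"
    "\<not> (W1 \<in> K0 \<and> cl A W1 = f X)"
    unfolding F_def S_def by blast
  have X\<tau>: "X \<subseteq> \<tau>" using W0 W1 by blast
  have \<tau>V: "conn \<tau>" "\<tau> \<subseteq> V" using pD(7,8)[OF W1(1)] W1(2) by simp_all
  have sat: "C \<subseteq> \<tau> \<or> C \<inter> \<tau> = {}" if "C \<in> P" for C using invD(2)[OF inv W1(1) that] W1(2) by simp
  have sums: "(\<Sum>C | C \<in> P \<and> C \<subseteq> \<tau>. f C + 1) \<le> k + 1"
    using invD(3)[OF inv W1(1)] W1(2,3) by (simp add: parts_def)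
  have kin: "k \<le> card (inner \<tau>)" using cl_le[OF pD(6,5)[OF W1(1)], of A] W1 by simp
  \<comment> \<open>If the new type is an old one then nothing was merged, and the altered pieces
    must have gained an edge inside.\<close>
  have \<tau>P: "f \<tau> < k" if "\<tau> \<in> P"
  proof -
    have "X = \<tau>" using P_disjoint[OF X that] P_D(1)[OF X] X\<tau> by auto
    then have "W0 = W1" using inj_on_image_eq_iff[OF pD(6)[OF W1(1)], of W0 W1] W0 W1 by auto
    then have ne: "k \<noteq> f \<tau>" using W0 W1 \<open>X = \<tau>\<close> by auto
    have "C = \<tau>" if C: "C \<in> P" "C \<subseteq> \<tau>" for C
      using P_disjoint[OF C(1) \<open>\<tau> \<in> P\<close>] P_D(1)[OF C(1)] C(2) by auto
    then have "{C. C \<in> P \<and> C \<subseteq> \<tau>} = {\<tau>}" using that by auto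
    then show ?thesis using sums ne by simp
  qed
  define K' where "K' = F \<union> G"
  define P' where "P' = insert \<tau> {C \<in> P. C \<inter> \<tau> = {}}"
  have K'K: "K' \<subseteq> K" by (auto simp: K'_def F_def G_def S_def)
  have \<tau>ne: "\<tau> \<noteq> {}" using X\<tau> P_D(1)[OF X] by blast
  have un\<tau>: "\<Union>{C \<in> P. C \<subseteq> \<tau>} = \<tau>"
  proof (intro equalityI subsetI)
    fix x assume x: "x \<in> \<tau>"
    then obtain C where "C \<in> P" "x \<in> C" using \<tau>V(2) part by (auto simp: partition_on_def)
    then show "x \<in> \<Union>{C \<in> P. C \<subseteq> \<tau>}" using sat[of C] x by blast
  qed auto
  have labG: "lab ` W \<in> P" "lab ` W \<inter> \<tau> = {}" "W \<in> K0" "cl A W = f (lab ` W)" "W \<notin> D1 \<union> D2" if "W \<in> G" for W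
    using that lab_K0(1) by (simp_all add: G_def)
  have labF: "lab ` W = \<tau>" "cl A W = k" if "W \<in> F" for W using that by (simp_all add: F_def)
  have cntF: "cnt K' \<tau> = card F"
  proof -
    have "W \<notin> G" if "lab ` W = \<tau>" for W using labG(2)[of W] that \<tau>ne by auto
    then have "{W \<in> K'. lab ` W = \<tau>} = F" using labF(1) unfolding K'_def by blast
    then show ?thesis by (simp add: cnt_def)
  qed
  have cntG: "cnt K0 C \<le> 4 * cnt K' C" if C: "C \<in> P" "C \<inter> \<tau> = {}" for C
  proof -
    let ?DC = "{W \<in> D1 \<union> D2. lab ` W = C}"
    have "{W \<in> K0. lab ` W = C} \<subseteq> {W \<in> K'. lab ` W = C} \<union> (touched A K C \<union> ?DC)"
    proof
      fix W assume W: "W \<in> {W \<in> K0. lab ` W = C}"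
      show "W \<in> {W \<in> K'. lab ` W = C} \<union> (touched A K C \<union> ?DC)"
        using W C(2) unfolding K'_def G_def touched_def by auto
    qed
    moreover have fin: "finite K'" "finite K0" "finite (touched A K C)" "finite ?DC"
      using pD(2) K'K p0(2) finite_D finite_subset by (auto simp: touched_def)
    ultimately have "cnt K0 C \<le> card ({W \<in> K'. lab ` W = C} \<union> (touched A K C \<union> ?DC))"
      unfolding cnt_def by (intro card_mono) auto
    also have "\<dots> \<le> cnt K' C + (card (touched A K C) + card ?DC)"
      unfolding cnt_def by (meson add_left_mono card_Un_le order_trans)
    finally have 1: "cnt K0 C \<le> cnt K' C + card (touched A K C) + card ?DC" by simp
    have "2 * card ?DC \<le> cnt K0 C"
    proof -
      have "?DC \<subseteq> (if C = C1 then D1 else if C = C2 then D2 else {})"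
        using D1_sub D2_sub C12(3) by auto
      then have "card ?DC \<le> card (if C = C1 then D1 else if C = C2 then D2 else {})"
        using finite_D by (intro card_mono) auto
      then show ?thesis using D by (auto split: if_splits)
    qed
    \<comment> \<open>At least a quarter survives: one half may lie in \<open>D1\<close> or
      \<open>D2\<close>, one eighth may be touched, and the extra 1 is at most another eighth
      because of \<open>big\<close>.\<close>
    then have "real (cnt K0 C) \<le> cnt K' C + (\<delta> * cnt K0 C + 1) + cnt K0 C / 2"
      using 1 tch[OF C(1)] by linarith
    moreover have "\<delta> * cnt K0 C \<le> 1 / 8 * cnt K0 C" using \<delta>(2) by (rule mult_right_mono) simp
    ultimately have "real (cnt K0 C) \<le> 4 * cnt K' C" using big[OF C(1)] by linarith
    then show ?thesis by linarith
  qed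
  have lay: "layout A B P' (f(\<tau> := k)) K'"
    unfolding layout_def
  proof (intro conjI ballI impI)
    show "pieces A B K'" by (rule pieces_subset[OF invD(1)[OF inv] K'K])
    show "partition_on V P'"
    proof (rule partition_onI)
      show "\<Union>P' = V"
      proof (intro equalityI subsetI)
        fix x assume x: "x \<in> V"
        then obtain C where "C \<in> P" "x \<in> C" using part by (auto simp: partition_on_def)
        then show "x \<in> \<Union>P'" using sat[of C] unfolding P'_def by blast
      qed (use \<tau>V P_D(2) in \<open>auto simp: P'_def\<close>)
      show "disjnt p q" if "p \<in> P'" "q \<in> P'" "p \<noteq> q" for p q
        using that P_disjoint unfolding P'_def disjnt_def by blast
      show "{} \<notin> P'" using \<tau>ne P_D(1) unfolding P'_def by auto
    qed
    fix C assume C: "C \<in> P'"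
    show "0 < cnt K' C"
    proof (cases "C = \<tau>")
      case True
      have "finite F" using finS by (simp add: F_def)
      then show ?thesis using True cntF \<open>F \<noteq> {}\<close> by (simp add: card_gt_0_iff)
    next
      case False
      then have "C \<in> P" "C \<inter> \<tau> = {}" using C by (auto simp: P'_def)
      then show ?thesis using cntG[of C] big[of C] by simp
    qed
    show "card C \<le> (f(\<tau> := k)) C + 1"
    proof (cases "C = \<tau>")
      case True
      have "card \<tau> \<le> (\<Sum>C | C \<in> P \<and> C \<subseteq> \<tau>. card C)"
        using card_UN_le[of "{C \<in> P. C \<subseteq> \<tau>}" "\<lambda>C. C"] un\<tau> finite_P by simp
      also have "\<dots> \<le> (\<Sum>C | C \<in> P \<and> C \<subseteq> \<tau>. f C + 1)" by (rule sum_mono) (use card_le_f in auto)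
      finally show ?thesis using sums True by simp
    next
      case False
      then have "C \<in> P" using C by (auto simp: P'_def)
      then show ?thesis using card_le_f False by simp
    qed
  next
    fix W assume W: "W \<in> K'"
    then show "lab ` W \<in> P'" using labF(1) labG(1,2) unfolding K'_def P'_def by blast
    show "cl A W = (f(\<tau> := k)) (lab ` W)"
    proof (cases "W \<in> F")
      case True then show ?thesis using labF by simp
    next
      case False
      then have "W \<in> G" using W by (simp add: K'_def)
      then have "lab ` W \<noteq> \<tau>" using labG(2)[of W] \<tau>ne by auto
      then show ?thesis using labG(4)[OF \<open>W \<in> G\<close>] by simp
    qed
  next
    fix W W' assume W: "W \<in> K'" "W' \<in> K'" "lab ` W \<noteq> lab ` W'"
    have cold: "W \<inter> \<Union>D1 = {} \<and> W \<inter> \<Union>D2 = {}" if "W \<in> G" for W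
    proof -
      have "W \<inter> Y = {}" if "Y \<in> D1 \<union> D2" for Y
      proof (rule disjointD[OF p0(1) labG(3)[OF \<open>W \<in> G\<close>]])
        show "Y \<in> K0" using that D1_sub D2_sub by auto
        show "W \<noteq> Y" using that labG(5)[OF \<open>W \<in> G\<close>] by auto
      qed
      then show ?thesis by auto
    qed
    \<comment> \<open>All pieces in \<open>F\<close> have the same type, and pieces in
      \<open>G\<close> avoid all vertices of \<open>D1\<close> and \<open>D2\<close>, so no pair of
      different types is hot.\<close>
    have "W \<in> G \<or> W' \<in> G" using W labF(1)[of W] labF(1)[of W'] unfolding K'_def by auto
    then have "\<not> hot W W'" using cold[of W] cold[of W'] unfolding hot_def by auto
    moreover have "lab ` W \<inter> lab ` W' = {}"
    proof -
      consider "W \<in> F" "W' \<in> G" | "W \<in> G" "W' \<in> F" | "W \<in> G" "W' \<in> G"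
        using W labF(1)[of W] labF(1)[of W'] unfolding K'_def by auto
      then show ?thesis
      proof cases
        case 1 then show ?thesis using labF(1)[of W] labG(2)[of W'] by (simp add: Int_commute)
      next
        case 2 then show ?thesis using labF(1)[of W'] labG(2)[of W] by simp
      next
        case 3 then show ?thesis using P_disjoint[OF labG(1)[of W] labG(1)[of W']] W(3) by simp
      qed
    qed
    moreover have "W \<in> K" "W' \<in> K" using W K'K by auto
    ultimately show "bet W W' \<inter> (A \<union> B) = {}" using invD(6)[OF inv] by simp
  qed
  have mn: "min (\<delta> * cnt K0 X) (\<delta> * (real (cnt K0 C1) * cnt K0 C2) / (b + 1)) < 2 ^ card V * (card E + 1) * real (cnt K' \<tau>)"
  proof -
    have "real (card (touched A K X)) \<le> real (2 ^ card V * (card E + 1) * card F)"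
      using cS SF by (simp only: of_nat_le_iff)
    also have "\<dots> = 2 ^ card V * (card E + 1) * real (cnt K' \<tau>)" using cntF by simp
    finally show ?thesis using mX by simp
  qed
  have "\<forall>C\<in>P. C \<subseteq> \<tau> \<or> C \<inter> \<tau> = {}" "\<forall>C\<in>P. C \<inter> \<tau> = {} \<longrightarrow> cnt K0 C \<le> 4 * cnt K' C" "\<tau> \<in> P \<longrightarrow> f \<tau> < k"
    using sat cntG \<tau>P by simp_all
  then show thesis
    by (intro that[OF X X\<tau> \<tau>V _ lay[unfolded P'_def] mn _ sums _ kin])
qed

end

section \<open>Expected frequencies of types and their behaviour under merging\<close>

context labelled
begin

definition q :: real where "q = real n / real (b + 1)"

text \<open>Indexed by the number of edges of a tree type, one less than its number of vertices:
  \<open>n\<close> choices for one vertex and a factor \<open>q\<close> for each further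
  one.\<close>

definition g :: "nat \<Rightarrow> real" where "g j = real n * q ^ j"

text \<open>For \<open>f C < card C\<close> the bound is the expected number of copies of a tree on \<open>card C\<close> vertices. A part
  with \<open>card C \<le> f C\<close> contains the completed cycle. Avoider may complete it in fewer pieces than that, but the
  loss is bounded by the size of any adjacent part, since completing the cycle costs her as much as any other move.\<close>

definition rich :: "real \<Rightarrow> 'v set set \<Rightarrow> ('v set \<Rightarrow> nat) \<Rightarrow> nat set set \<Rightarrow> bool" where
  "rich a P f K \<longleftrightarrow> (\<forall>C\<in>P. (f C < card C \<longrightarrow> a * g (card C - 1) \<le> cnt K C) \<and>
     (card C \<le> f C \<longrightarrow> (\<forall>D\<in>P. D \<noteq> C \<longrightarrow> cross C D \<noteq> {} \<longrightarrow> a * g (card C + card D - 1) \<le> cnt K C)))"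

lemma richD:
  assumes "rich a P f K" "C \<in> P"
  shows "f C < card C \<Longrightarrow> a * g (card C - 1) \<le> cnt K C"
    "card C \<le> f C \<Longrightarrow> D \<in> P \<Longrightarrow> D \<noteq> C \<Longrightarrow> cross C D \<noteq> {} \<Longrightarrow> a * g (card C + card D - 1) \<le> cnt K C"
  using assms unfolding rich_def by auto

lemma q_bounds: "0 < q" "q \<le> 1"
proof -
  have "1 * n \<le> card V * n" using card_E_V(2) by (intro mult_le_mono1) simp
  then have "n \<le> b + 1" using b_large by linarith
  then show "0 < q" "q \<le> 1" using n_pos by (simp_all add: q_def)
qed

lemma g_pos: "0 < g j"
  using n_pos q_bounds by (simp add: g_def)

lemma g_antimono: "i \<le> j \<Longrightarrow> g j \<le> g i"
  unfolding g_def using q_bounds by (intro mult_left_mono power_decreasing) auto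

text \<open>Merging trees with \<open>i\<close> and \<open>j\<close> edges yields
  \<open>i + j + 1\<close> edges, and about one in \<open>b + 1\<close> pairs gets merged. Thus the
  order of magnitude \<open>g\<close> reproduces itself.\<close>

lemma g_mult: "g i * g j = g (i + j + 1) * real (b + 1)"
proof -
  have "g i * g j = real n * q ^ i * q ^ j * real n" by (simp add: g_def)
  also have "real n = q * real (b + 1)" unfolding q_def by (simp del: of_nat_Suc of_nat_add)
  finally have "g i * g j = q * real (b + 1) * q ^ i * q ^ j * (q * real (b + 1))" .
  moreover have "g (i + j + 1) = q * real (b + 1) * q ^ (i + j + 1)"
    unfolding g_def q_def by (simp del: of_nat_Suc of_nat_add)
  ultimately show ?thesis by (simp add: power_add del: of_nat_Suc of_nat_add)
qed

lemma square_le: "0 < a \<Longrightarrow> a \<le> 1 \<Longrightarrow> a\<^sup>2 * g j \<le> a * g j"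
  using g_pos[of j] by (simp add: power2_eq_square)

lemma product_bound:
  assumes "a * g i \<le> s" "a * g j \<le> t" "0 \<le> a" "i + j + 1 \<le> m"
  shows "a\<^sup>2 * g m \<le> s * t / real (b + 1)"
proof -
  have "a\<^sup>2 * g m * real (b + 1) \<le> a\<^sup>2 * g (i + j + 1) * real (b + 1)"
    using g_antimono[OF assms(4)] by (intro mult_right_mono mult_left_mono) auto
  also have "\<dots> = (a * g i) * (a * g j)" using g_mult[of i j] by (simp add: power2_eq_square)
  also have "\<dots> \<le> s * t"
  proof (rule mult_mono)
    have "0 \<le> a * g i" "0 \<le> a * g j" using assms(3) g_pos by (simp_all add: less_imp_le)
    then show "0 \<le> s" "0 \<le> a * g j" using assms(1) by linarith+
  qed (use assms in auto)
  finally show ?thesis by (simp add: pos_le_divide_eq)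
qed

text \<open>Two disjoint parts cannot both have an edge surplus, since there is only one
  cycle.\<close>

lemma one_closed:
  assumes "layout A B P f K" "C \<in> P" "D \<in> P" "card C \<le> f C" "card D \<le> f D"
  shows "C = D"
proof (rule ccontr)
  assume "C \<noteq> D"
  note l = layoutD[OF assms(1)]
  show False using not_both_dense[of C D] l(3)[OF assms(2)] l(3)[OF assms(3)] l(2)[OF assms(2)] l(2)[OF assms(3)]
      l(5)[OF assms(2,3) \<open>C \<noteq> D\<close>] l(9)[OF assms(2)] l(9)[OF assms(3)] assms(4,5) by linarith
qed

lemma card_parts_le:
  assumes "layout A B P f K" "C \<in> P" "D \<in> P" "C \<noteq> D" "C \<subseteq> S" "D \<subseteq> S" "finite S"
  shows "card C + card D \<le> card S"
proof -
  note l = layoutD[OF assms(1)]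
  have "card C + card D = card (C \<union> D)"
    using l(5)[OF assms(2-4)] l(4)[OF assms(2)] l(4)[OF assms(3)] by (simp add: card_Un_disjoint)
  also have "\<dots> \<le> card S" using assms(5-7) by (intro card_mono) auto
  finally show ?thesis .
qed

text \<open>\<open>X\<close> is dictated by Avoider. Since \<open>Z\<close> is at least the product
  for any adjacent pair, it suffices to find, in or at the border of \<open>\<tau>\<close>, one pair
  whose vertices fit into the required index of \<open>g\<close>.\<close>

lemma next_rich:
  fixes \<delta> a Z M :: real
  assumes lay: "layout A0 B0 P f K0" and rich: "rich a P f K0" and a: "0 < a" "a \<le> 1"
    and Z: "\<And>C D. C \<in> P \<Longrightarrow> D \<in> P \<Longrightarrow> C \<noteq> D \<Longrightarrow> cross C D \<noteq> {} \<Longrightarrow> real (cnt K0 C) * cnt K0 D \<le> Z"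
    and \<tau>: "X \<in> P" "X \<subseteq> \<tau>" "conn \<tau>" "\<tau> \<subseteq> V" and sat: "\<And>C. C \<in> P \<Longrightarrow> C \<subseteq> \<tau> \<or> C \<inter> \<tau> = {}"
    and lay': "layout A B (insert \<tau> {C \<in> P. C \<inter> \<tau> = {}}) (f(\<tau> := k)) K'"
    and mn: "min (\<delta> * cnt K0 X) (\<delta> * Z / (b + 1)) < M * cnt K' \<tau>"
    and other: "\<And>C. C \<in> P \<Longrightarrow> C \<inter> \<tau> = {} \<Longrightarrow> cnt K0 C \<le> 4 * cnt K' C"
    and sums: "(\<Sum>C | C \<in> P \<and> C \<subseteq> \<tau>. f C + 1) \<le> k + 1"
    and \<tau>P: "\<tau> \<in> P \<Longrightarrow> f \<tau> < k" and kin: "k \<le> card (inner \<tau>)"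
    and \<delta>: "0 < \<delta>" "4 * \<delta> \<le> M"
  shows "rich (\<delta> / M * a\<^sup>2) (insert \<tau> {C \<in> P. C \<inter> \<tau> = {}}) (f(\<tau> := k)) K'"
proof -
  note l = layoutD[OF lay] and r = richD[OF rich]
  have M: "0 < M" using \<delta> by linarith
  have fin\<tau>: "finite \<tau>" using \<tau>(4) finite_V finite_subset by blast
  have \<tau>ne: "\<tau> \<noteq> {}" using \<tau>(2) l(2)[OF \<tau>(1)] by auto
  have ag: "a * g j \<le> a * g i" if "i \<le> j" for i j
    using g_antimono[OF that] a(1) by simp
  have fin: "\<delta> / M * a\<^sup>2 * g j \<le> cnt K' \<tau>"
    if "a * g j \<le> cnt K0 X" "a\<^sup>2 * g j \<le> Z / (b + 1)" for j
  proof -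
    have "a\<^sup>2 * g j \<le> a * g j"
      using square_le[OF a] .
    then have "a\<^sup>2 * g j \<le> cnt K0 X" using that(1) by simp
    from mult_left_mono[OF this, of \<delta>] mult_left_mono[OF that(2), of \<delta>]
    have "\<delta> * (a\<^sup>2 * g j) \<le> \<delta> * cnt K0 X" "\<delta> * (a\<^sup>2 * g j) \<le> \<delta> * Z / (b + 1)"
      using \<delta>(1) by simp_all
    then have "\<delta> * (a\<^sup>2 * g j) \<le> M * cnt K' \<tau>" using mn by simp
    then show ?thesis using M by (simp add: field_simps)
  qed
  have other_bd: "\<delta> / M * a\<^sup>2 * g j \<le> cnt K' C" if "C \<in> P" "C \<inter> \<tau> = {}" "a * g j \<le> cnt K0 C" for C j
  proof -
    have "\<delta> / M \<le> 1 / 4" using \<delta> M by (simp add: field_simps)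
    moreover have "a\<^sup>2 * g j \<le> a * g j" using square_le[OF a] .
    ultimately have "\<delta> / M * (a\<^sup>2 * g j) \<le> 1 / 4 * (a * g j)"
      using \<delta>(1) M a g_pos[of j] by (intro mult_mono) auto
    also have "\<dots> \<le> 1 / 4 * cnt K0 C" using that(3) by simp
    also have "\<dots> \<le> cnt K' C" using other[OF that(1,2)] by simp
    finally show ?thesis by (simp add: mult.assoc)
  qed
  have inside: "\<exists>D\<in>P. D \<subseteq> \<tau> \<and> D \<noteq> C \<and> cross C D \<noteq> {} \<and> card C + card D \<le> card \<tau>"
    if "C \<in> P" "C \<subseteq> \<tau>" "C \<noteq> \<tau>" for C
  proof -
    have "C \<noteq> {}" "C \<subset> \<tau>" using that l(2) by auto
    then obtain x y where xy: "x \<in> C" "y \<in> \<tau> - C" "{x, y} \<in> E" using \<tau>(3) unfolding conn_def by meson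
    then have "y \<in> V" using \<tau>(4) by auto
    then obtain D where D: "D \<in> P" "y \<in> D" using l(6) by auto
    then have "D \<subseteq> \<tau>" "D \<noteq> C" using sat[OF D(1)] xy by auto
    moreover have "cross C D \<noteq> {}" using xy D unfolding cross_def by blast
    ultimately show ?thesis using D(1) card_parts_le[OF lay that(1) D(1) _ that(2) _ fin\<tau>] by blast
  qed
  \<comment> \<open>A closed part makes the comparison of \<open>card \<tau>\<close> with the sum
    strict, so the surplus passes to \<open>\<tau>\<close>.\<close>
  have closed_sub: "card \<tau> \<le> k" if C: "C \<in> P" "C \<subseteq> \<tau>" "card C \<le> f C" for C
  proof -
    let ?T = "{C. C \<in> P \<and> C \<subseteq> \<tau>}"
    have "\<Union>?T = \<tau>"
    proof (intro equalityI subsetI)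
      fix x assume x: "x \<in> \<tau>"
      then have "x \<in> V" using \<tau>(4) by auto
      then obtain C where "C \<in> P" "x \<in> C" using l(6) by auto
      then show "x \<in> \<Union>?T" using sat[of C] x by blast
    qed auto
    then have "card \<tau> \<le> (\<Sum>C\<in>?T. card C)"
      using card_UN_le[of ?T "\<lambda>C. C"] l(1) by simp
    also have "\<dots> < (\<Sum>C\<in>?T. f C + 1)"
    proof (rule sum_strict_mono_ex1)
      show "\<forall>C\<in>?T. card C \<le> f C + 1" using l(7) by auto
      show "\<exists>C\<in>?T. card C < f C + 1" using C by (intro bexI[of _ C]) auto
    qed (use l(1) in auto)
    finally show ?thesis using sums by simp
  qed
  \<comment> \<open>A closed part already holds as many edges as it can span, so it cannot reappear
    with a larger count.\<close>
  have closed_ne: "C \<noteq> \<tau>" if "C \<in> P" "card C \<le> f C" for C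
  proof
    assume "C = \<tau>"
    then have "f \<tau> < k" "card \<tau> \<le> f \<tau>" using \<tau>P that by auto
    then show False using kin card_inner_le[OF \<tau>(4) \<tau>ne] card_R by linarith
  qed
  have Zb: "a\<^sup>2 * g m \<le> Z / (b + 1)"
    if "C \<in> P" "D \<in> P" "C \<noteq> D" "cross C D \<noteq> {}" "a * g i \<le> cnt K0 C" "a * g j \<le> cnt K0 D" "i + j + 1 \<le> m"
    for C D i j m
  proof -
    have "a\<^sup>2 * g m \<le> real (cnt K0 C) * cnt K0 D / (b + 1)"
      using product_bound[OF that(5,6) _ that(7)] a(1) by simp
    also have "\<dots> \<le> Z / (b + 1)" using Z[OF that(1-4)] by (rule divide_right_mono) simp
    finally show ?thesis .
  qed
  have cpos: "1 \<le> card C" if "C \<in> P" for C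
    using l(2)[OF that] l(4)[OF that] by (simp add: Suc_le_eq card_gt_0_iff)
  have \<tau>main: "(k < card \<tau> \<longrightarrow> \<delta> / M * a\<^sup>2 * g (card \<tau> - 1) \<le> cnt K' \<tau>) \<and>
    (card \<tau> \<le> k \<longrightarrow> (\<forall>D\<in>P. D \<inter> \<tau> = {} \<longrightarrow> cross \<tau> D \<noteq> {} \<longrightarrow>
      \<delta> / M * a\<^sup>2 * g (card \<tau> + card D - 1) \<le> cnt K' \<tau>))"
  proof (intro conjI impI ballI)
    assume k: "k < card \<tau>"
    have open_: "f C < card C" if "C \<in> P" "C \<subseteq> \<tau>" for C
      using closed_sub[OF that] k by linarith
    have "X \<noteq> \<tau>" using \<tau>P \<tau>(1) l(7)[OF \<tau>(1)] k by auto
    then obtain D where D: "D \<in> P" "D \<subseteq> \<tau>" "D \<noteq> X" "cross X D \<noteq> {}" "card X + card D \<le> card \<tau>"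
      using inside[OF \<tau>(1,2)] by blast
    have rX: "a * g (card X - 1) \<le> cnt K0 X" using r(1)[OF \<tau>(1) open_[OF \<tau>(1,2)]] .
    have rD: "a * g (card D - 1) \<le> cnt K0 D" using r(1)[OF D(1) open_[OF D(1,2)]] .
    show "\<delta> / M * a\<^sup>2 * g (card \<tau> - 1) \<le> cnt K' \<tau>"
    proof (rule fin)
      show "a * g (card \<tau> - 1) \<le> cnt K0 X" using ag[of "card X - 1" "card \<tau> - 1"] rX D(5) by linarith
      show "a\<^sup>2 * g (card \<tau> - 1) \<le> Z / (b + 1)"
        by (rule Zb[OF \<tau>(1) D(1) D(3)[symmetric] D(4) rX rD]) (use D(5) cpos[OF \<tau>(1)] cpos[OF D(1)] in linarith)
    qed
  next
    fix D assume k: "card \<tau> \<le> k" and D: "D \<in> P" "D \<inter> \<tau> = {}" "cross \<tau> D \<noteq> {}"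
    obtain x y where xy: "x \<in> \<tau>" "y \<in> D" "{x, y} \<in> E" using D(3) unfolding cross_def by blast
    then obtain F where F: "F \<in> P" "x \<in> F" using l(6) \<tau>(4) by blast
    then have F\<tau>: "F \<subseteq> \<tau>" using sat[OF F(1)] xy by auto
    have crF: "cross F D \<noteq> {}" using xy F unfolding cross_def by blast
    have FD: "F \<noteq> D" using F xy D(2) by auto
    have D\<tau>: "D \<noteq> \<tau>" using D(2) \<tau>ne by auto
    have Dopen: "f D < card D"
    proof (rule ccontr)
      assume "\<not> f D < card D"
      then show False using one_closed[OF lay', of \<tau> D] k D D\<tau> by auto
    qed
    have rD: "a * g (card D - 1) \<le> cnt K0 D" using r(1)[OF D(1) Dopen] .
    have fc: "card F \<le> card \<tau>" "card X \<le> card \<tau>" using F\<tau> \<tau>(2) fin\<tau> by (auto intro: card_mono)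
    show "\<delta> / M * a\<^sup>2 * g (card \<tau> + card D - 1) \<le> cnt K' \<tau>"
    proof (rule fin)
      show "a * g (card \<tau> + card D - 1) \<le> cnt K0 X"
      proof (cases "f X < card X")
        case True
        then show ?thesis using r(1)[OF \<tau>(1)] ag[of "card X - 1" "card \<tau> + card D - 1"] fc by linarith
      next
        case False
        then have cX: "card X \<le> f X" by simp
        obtain D' where D': "D' \<in> P" "D' \<noteq> X" "cross X D' \<noteq> {}" "card X + card D' \<le> card \<tau>"
          using inside[OF \<tau>(1,2) closed_ne[OF \<tau>(1) cX]] by blast
        show ?thesis using r(2)[OF \<tau>(1) cX D'(1-3)] ag[of "card X + card D' - 1" "card \<tau> + card D - 1"] D'(4)
          by linarith
      qed
      show "a\<^sup>2 * g (card \<tau> + card D - 1) \<le> Z / (b + 1)"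
      \<comment> \<open>If \<open>F\<close> is itself closed, its bound involves a neighbour
        \<open>D'\<close> inside \<open>\<tau>\<close>; both together still fit into
        \<open>card \<tau>\<close>.\<close>
      proof (cases "f F < card F")
        case True
        show ?thesis
          by (rule Zb[OF F(1) D(1) FD crF r(1)[OF F(1) True] rD])
            (use fc cpos[OF F(1)] cpos[OF D(1)] in linarith)
      next
        case False
        then have cF: "card F \<le> f F" by simp
        obtain D' where D': "D' \<in> P" "D' \<noteq> F" "cross F D' \<noteq> {}" "card F + card D' \<le> card \<tau>"
          using inside[OF F(1) F\<tau> closed_ne[OF F(1) cF]] by blast
        show ?thesis
          by (rule Zb[OF F(1) D(1) FD crF r(2)[OF F(1) cF D'(1-3)] rD])
            (use D'(4) cpos[OF F(1)] cpos[OF D(1)] in linarith)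
      qed
    qed
  qed
  have omain: "(f C < card C \<longrightarrow> \<delta> / M * a\<^sup>2 * g (card C - 1) \<le> cnt K' C) \<and>
    (card C \<le> f C \<longrightarrow> (\<forall>D\<in>insert \<tau> {C \<in> P. C \<inter> \<tau> = {}}. D \<noteq> C \<longrightarrow> cross C D \<noteq> {} \<longrightarrow>
      \<delta> / M * a\<^sup>2 * g (card C + card D - 1) \<le> cnt K' C))" if C: "C \<in> P" "C \<inter> \<tau> = {}" for C
  proof (intro conjI impI ballI)
    assume "f C < card C"
    then show "\<delta> / M * a\<^sup>2 * g (card C - 1) \<le> cnt K' C" using other_bd[OF C r(1)[OF C(1)]] by simp
  next
    fix D assume cC: "card C \<le> f C" and D: "D \<in> insert \<tau> {C \<in> P. C \<inter> \<tau> = {}}" "D \<noteq> C" "cross C D \<noteq> {}"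
    show "\<delta> / M * a\<^sup>2 * g (card C + card D - 1) \<le> cnt K' C"
    proof (cases "D = \<tau>")
      case False
      then have "D \<in> P" using D by simp
      then show ?thesis using other_bd[OF C r(2)[OF C(1) cC _ D(2,3)]] by simp
    next
      case True
      obtain x y where xy: "x \<in> C" "y \<in> \<tau>" "{x, y} \<in> E" using D(3) True unfolding cross_def by blast
      then obtain F where F: "F \<in> P" "y \<in> F" using l(6) \<tau>(4) by blast
      then have F\<tau>: "F \<subseteq> \<tau>" using sat[OF F(1)] xy by auto
      have "cross C F \<noteq> {}" "F \<noteq> C" using xy F C(2) unfolding cross_def by blast+
      moreover have "card F \<le> card \<tau>" using F\<tau> fin\<tau> by (rule card_mono[rotated])
      ultimately have "a * g (card C + card D - 1) \<le> cnt K0 C"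
        using r(2)[OF C(1) cC F(1)] ag[of "card C + card F - 1" "card C + card D - 1"] True by force
      then show ?thesis by (rule other_bd[OF C])
    qed
  qed
  show ?thesis unfolding rich_def
  proof (intro ballI)
    fix C assume C: "C \<in> insert \<tau> {C \<in> P. C \<inter> \<tau> = {}}"
    show "((f(\<tau> := k)) C < card C \<longrightarrow> \<delta> / M * a\<^sup>2 * g (card C - 1) \<le> cnt K' C) \<and>
     (card C \<le> (f(\<tau> := k)) C \<longrightarrow> (\<forall>D\<in>insert \<tau> {C \<in> P. C \<inter> \<tau> = {}}. D \<noteq> C \<longrightarrow> cross C D \<noteq> {} \<longrightarrow>
        \<delta> / M * a\<^sup>2 * g (card C + card D - 1) \<le> cnt K' C))"
    proof (cases "C = \<tau>")
      case True
      then show ?thesis using \<tau>main by auto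
    next
      case False
      then have "C \<in> P" "C \<inter> \<tau> = {}" using C by auto
      then show ?thesis using omain[of C] False by simp
    qed
  qed
qed


section \<open>Copies, threats and the end of the last stage\<close>

lemma copy_iff:
  assumes W: "W \<subseteq> {..<n}" "inj_on lab W" "lab ` W = V"
  shows "(W, bet W W) \<in> copies (V, E) ({..<n}, A) \<longleftrightarrow> bet W W \<subseteq> A"
proof
  assume "bet W W \<subseteq> A"
  define h where "h = inv_into W lab"
  have h: "h x \<in> W" "lab (h x) = x" if "x \<in> V" for x
    using that W(3) unfolding h_def by (auto intro: inv_into_into f_inv_into_f)
  have hl: "h (lab u) = u" if "u \<in> W" for u using that W(2) by (simp add: h_def)
  have "h ` V = W"
  proof (intro equalityI subsetI)
    fix u assume "u \<in> W"
    then show "u \<in> h ` V" using hl[of u] W(3) by (metis imageI)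
  qed (use h in auto)
  moreover have "(`) h ` E = bet W W"
  proof (intro equalityI subsetI)
    fix e assume "e \<in> (`) h ` E"
    then obtain d where d: "d \<in> E" "e = h ` d" by blast
    obtain x y where xy: "d = {x, y}" using edgeD[OF d(1)] by (auto simp: card_2_iff)
    then have V: "x \<in> V" "y \<in> V" using edgeD[OF d(1)] by auto
    have "{lab (h x), lab (h y)} \<in> E" using h(2) V d(1) xy by simp
    moreover have "e = {h x, h y}" using d(2) xy by simp
    ultimately show "e \<in> bet W W" unfolding bet_def using h(1) V by blast
  next
    fix e assume "e \<in> bet W W"
    then obtain u w where uw: "u \<in> W" "w \<in> W" "e = {u, w}" "{lab u, lab w} \<in> E" unfolding bet_def by blast
    then have "e = h ` {lab u, lab w}" using hl by simp
    then show "e \<in> (`) h ` E" using uw(4) by blast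
  qed
  moreover have "inj_on h V" using W(3) unfolding h_def by (intro inj_on_inv_into) auto
  ultimately show "(W, bet W W) \<in> copies (V, E) ({..<n}, A)"
    using W(1) \<open>bet W W \<subseteq> A\<close> unfolding copies_def by (auto intro!: exI[of _ h])
qed (auto simp: copies_def)

lemma threatI:
  assumes W: "W \<subseteq> {..<n}" "inj_on lab W" "lab ` W = V" and e: "e \<in> unclaimed n A B" "e \<in> bet W W"
    "bet W W \<subseteq> insert e A"
  shows "e \<in> threats n (V, E) A B"
proof -
  have "e \<notin> A" using e(1) by (auto simp: unclaimed_def)
  then have "(W, bet W W) \<in> copies (V, E) ({..<n}, insert e A) - copies (V, E) ({..<n}, A)"
    using copy_iff[OF W] e(2,3) by auto
  then show ?thesis using e(1) unfolding threats_def by blast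
qed

lemma finite_threats: "finite (threats n H A B)"
  by (rule finite_subset[OF _ finite_unclaimed[of n A B]]) (auto simp: threats_def)

lemma parts_adjacent:
  assumes lay: "layout A B P f K" and C: "C \<in> P" "C \<noteq> V"
  obtains D where "D \<in> P" "D \<noteq> C" "cross C D \<noteq> {}"
proof -
  note l = layoutD[OF lay]
  have "C \<subset> V" using l(3) C by auto
  then obtain x y where xy: "x \<in> C" "y \<in> V - C" "{x, y} \<in> E" using crossing[OF l(2)[OF C(1)]] by blast
  then obtain D where D: "D \<in> P" "y \<in> D" using l(6) by blast
  have "cross C D \<noteq> {}" using xy D unfolding cross_def by blast
  then show ?thesis using that[OF D(1)] xy D by blast
qed

lemma claimed_all:
  assumes "pieces A B K" "W \<in> K" "card (inner (lab ` W)) \<le> cl A W"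
  shows "bet W W \<subseteq> A"
proof -
  have "finite (bet W W)" using finite_bet piecesD(5)[OF assms(1,2)] by blast
  moreover have "card (bet W W) \<le> card (bet W W \<inter> A)"
    using assms(3) card_bet_self[OF piecesD(6)[OF assms(1,2)]] by (simp add: cl_def)
  ultimately have "bet W W \<inter> A = bet W W" by (intro card_seteq) auto
  then show ?thesis by blast
qed

lemma whole_part: "layout A B P f K \<Longrightarrow> V \<in> P \<Longrightarrow> P = {V}"
proof -
  assume lay: "layout A B P f K" and V: "V \<in> P"
  note l = layoutD[OF lay]
  have "C = V" if "C \<in> P" for C using l(5)[OF that V] l(2,3)[OF that] by auto
  with V show "P = {V}" by blast
qed

text \<open>Since \<open>Suc (card E) = card V + card R\<close>, the bound is
  \<open>a\<^sup>2\<close> times \<open>n ^ card V / (b + 1) ^ (card E - 1)\<close> for trees and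
  unicyclic patterns alike.\<close>

definition reached :: "real \<Rightarrow> edge set \<Rightarrow> edge set \<Rightarrow> bool" where
  "reached a A B \<longleftrightarrow> enforcer_has_won n (V, E) A \<or>
     a\<^sup>2 * g (card E - 1) * (if R = {} then real n else 1) \<le> card (threats n (V, E) A B)"

lemma reached_mono: "0 < c \<Longrightarrow> c \<le> a \<Longrightarrow> reached a A B \<Longrightarrow> reached c A B"
proof -
  assume c: "0 < c" "c \<le> a" and r: "reached a A B"
  have "c\<^sup>2 * g (card E - 1) * (if R = {} then real n else 1) \<le> a\<^sup>2 * g (card E - 1) * (if R = {} then real n else 1)"
    using c g_pos[of "card E - 1"] by (intro mult_right_mono power_mono) auto
  then show "reached c A B" using r unfolding reached_def by linarith
qed

text \<open>With at most one edge missing there is either one part, whose pieces are copies or lack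
  one edge each, or two parts with one edge between them, and then each pair of pieces gives a
  threat. Disjointness keeps these threats distinct.\<close>

lemma terminal:
  assumes lay: "layout A B P f K" and rich: "rich a P f K" and a: "0 < a" "a \<le> 1"
    and full: "card E \<le> (\<Sum>C\<in>P. f C) + 1"
  shows "reached a A B"
proof (cases "V \<in> P")
  case True
  note l = layoutD[OF lay] and pD = piecesD[OF layoutD(10)[OF lay]]
  have P: "P = {V}" using whole_part[OF lay True] .
  have labW: "lab ` W = V" if "W \<in> K" for W using lay that P unfolding layout_def by blast
  have cntV: "cnt K V = card K" using labW unfolding cnt_def by (metis (mono_tags, lifting) Collect_cong Collect_mem_eq)
  show ?thesis
  proof (cases "card E \<le> f V")
    case True
    have "K \<noteq> {}" using l(8)[of V] P cntV by auto
    then obtain W where W: "W \<in> K" by blast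
    have "bet W W \<subseteq> A"
      by (rule claimed_all[OF l(10) W]) (use l(11)[OF W] labW[OF W] True inner_V in simp)
    then have "(W, bet W W) \<in> copies (V, E) ({..<n}, A)"
      using copy_iff[OF pD(4)[OF W] pD(6)[OF W] labW[OF W]] by simp
    then show ?thesis unfolding reached_def enforcer_has_won_def by blast
  next
    case False
    then have f: "f V = card E - 1" "f V < card E" using full P by simp_all
    \<comment> \<open>The single part already has \<open>card V - 1\<close> edges, so a further edge
      can only be missing from a cycle.\<close>
    have "card V \<le> card E" using l(7)[of V] P f by simp
    then have R: "R \<noteq> {}" and cV: "card V = card E" using card_E card_R by (cases "R = {}", auto)
    have "\<exists>e. e \<in> bet W W \<and> e \<in> threats n (V, E) A B" if W: "W \<in> K" for W
    proof -
      have fin: "finite (bet W W)" using finite_bet pD(5)[OF W] by blast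
      have "card (bet W W) = card E" using card_bet_self[OF pD(6)[OF W]] labW[OF W] inner_V by simp
      moreover have "card (bet W W \<inter> A) = card E - 1" using l(11)[OF W] labW[OF W] f by (simp add: cl_def)
      ultimately have "card (bet W W - A) = 1" using card_Diff_subset_Int[of "bet W W" A] fin f by simp
      then obtain e where e: "bet W W - A = {e}" using card_1_singletonE by blast
      have "e \<in> unclaimed n A B"
        using e bet_edges[OF pD(4)[OF W] pD(4)[OF W]] pD(9)[OF W] unfolding unclaimed_def by blast
      then have "e \<in> threats n (V, E) A B"
        by (rule threatI[OF pD(4)[OF W] pD(6)[OF W] labW[OF W]]) (use e in blast)+
      then show ?thesis using e by blast
    qed
    then obtain t where t: "\<And>W. W \<in> K \<Longrightarrow> t W \<in> bet W W" "\<And>W. W \<in> K \<Longrightarrow> t W \<in> threats n (V, E) A B" by metis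
    have "inj_on t K"
    proof (rule inj_onI)
      fix W W' assume W: "W \<in> K" "W' \<in> K" "t W = t W'"
      have "t W \<in> bet W' W'" unfolding W(3) by (rule t(1)[OF W(2)])
      from bet_unique[OF pD(1) W(1) W(1) W(2) W(2) t(1)[OF W(1)] this] show "W = W'" by metis
    qed
    then have "card K \<le> card (threats n (V, E) A B)"
      by (rule card_inj_on_le) (use t finite_threats in auto)
    moreover have "a * g (card E - 1) \<le> card K"
      using richD(1)[OF rich True] f cV cntV by simp
    moreover have "a\<^sup>2 * g (card E - 1) \<le> a * g (card E - 1)" using square_le[OF a] .
    ultimately show ?thesis using R by (simp add: reached_def)
  qed
next
  case False
  note l = layoutD[OF lay] and pD = piecesD[OF layoutD(10)[OF lay]]
  obtain C where C: "C \<in> P" using l(6) V_ne by blast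
  have "C \<noteq> V" using C False by auto
  then obtain D where D: "D \<in> P" "D \<noteq> C" "cross C D \<noteq> {}" using parts_adjacent[OF lay C] by metis
  define X where "X = E - (\<Union>C\<in>P. inner C)"
  have "card (\<Union>C\<in>P. inner C) = (\<Sum>C\<in>P. card (inner C))"
  proof (rule card_UN_disjoint[OF l(1)])
    show "\<forall>i\<in>P. \<forall>j\<in>P. i \<noteq> j \<longrightarrow> inner i \<inter> inner j = {}"
    proof (intro ballI impI)
      fix i j assume "i \<in> P" "j \<in> P" "i \<noteq> j"
      then have ij: "i \<inter> j = {}" by (rule l(5))
      have False if "h \<in> E" "h \<subseteq> i" "h \<subseteq> j" for h
      proof -
        have "h = {}" using that(2,3) ij by blast
        then show False using edgeD[OF that(1)] by simp
      qed
      then show "inner i \<inter> inner j = {}" unfolding inner_def by blast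
    qed
  qed auto
  moreover have "(\<Union>C\<in>P. inner C) \<subseteq> E" by (auto simp: inner_def)
  ultimately have cX: "(\<Sum>C\<in>P. card (inner C)) + card X = card E"
    unfolding X_def using finite_E by (metis card_Diff_subset card_mono finite_subset le_add_diff_inverse)
  have finX: "finite X" using finite_E by (simp add: X_def)
  have crX: "cross i j \<subseteq> X" if ij: "i \<in> P" "j \<in> P" "i \<noteq> j" for i j
  proof
    fix h assume "h \<in> cross i j"
    then obtain x y where xy: "h \<in> E" "x \<in> i" "y \<in> j" "h = {x, y}" unfolding cross_def by blast
    have False if "m \<in> P" "x \<in> m" "y \<in> m" for m
    proof -
      have "m = i" "m = j" using l(5)[OF that(1) ij(1)] l(5)[OF that(1) ij(2)] that xy by blast+
      then show False using ij by simp
    qed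
    then show "h \<in> X" using xy unfolding X_def inner_def by auto
  qed
  have sf: "(\<Sum>C\<in>P. f C) \<le> (\<Sum>C\<in>P. card (inner C))" by (rule sum_mono) (rule l(9))
  \<comment> \<open>\<open>X\<close> consists of the pattern edges between parts. It is nonempty, so
    it accounts for the one missing edge and all parts are complete.\<close>
  have "X \<noteq> {}" using crX[OF C D(1)] D(2,3) by auto
  then have "card X = 1" using cX sf full finX card_gt_0_iff[of X] by linarith
  then obtain h where h: "X = {h}" using card_1_singletonE by blast
  have crCD: "cross C D = {h}" using crX[OF C D(1)] D(2,3) h by auto
  have finner: "f i = card (inner i)" if "i \<in> P" for i
  proof (rule ccontr)
    assume "f i \<noteq> card (inner i)"
    then have "(\<Sum>C\<in>P. f C) < (\<Sum>C\<in>P. card (inner C))"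
      using l(1,9) that by (intro sum_strict_mono_ex1) (auto intro!: bexI[of _ i] simp: le_neq_implies_less)
    then show False using cX \<open>card X = 1\<close> full by simp
  qed
  have P: "P = {C, D}"
  proof -
    have "i \<in> {C, D}" if i: "i \<in> P" for i
    proof -
      have "i \<noteq> V" using i False by auto
      then obtain j where j: "j \<in> P" "j \<noteq> i" "cross i j \<noteq> {}" using parts_adjacent[OF lay i] by metis
      then have "h \<in> cross i j" using crX[OF i j(1)] h by auto
      then obtain x where x: "x \<in> i" "x \<in> h" unfolding cross_def by blast
      have "h \<in> cross C D" using crCD by simp
      then obtain u w where "u \<in> C" "w \<in> D" "h = {u, w}" unfolding cross_def by blast
      then have "i \<inter> C \<noteq> {} \<or> i \<inter> D \<noteq> {}" using x by auto
      then show ?thesis using l(5)[OF i C] l(5)[OF i D(1)] by auto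
    qed
    then show ?thesis using C D(1) by auto
  qed
  have CDV: "C \<union> D = V" using l(6) P by simp
  have CDd: "C \<inter> D = {}" using l(5)[OF C D(1)] D(2) by simp
  have cCD: "card C + card D = card V"
    using card_Un_disjoint[OF l(4)[OF C] l(4)[OF D(1)] CDd] CDV by simp
  let ?KC = "{W \<in> K. lab ` W = C}" and ?KD = "{W \<in> K. lab ` W = D}"
  have "\<exists>e. e \<in> bet W W' \<and> e \<in> threats n (V, E) A B" if W: "W \<in> ?KC" "W' \<in> ?KD" for W W'
  proof -
    have K: "W \<in> K" "W' \<in> K" "lab ` W = C" "lab ` W' = D" using W by simp_all
    have inj: "inj_on lab (W \<union> W')" using pieces_inj2(1)[OF l(10) K(1,2)] K(3,4) CDd by simp
    have "card (bet W W') = 1" using card_bet[OF inj] K crCD by simp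
    then obtain e where e: "bet W W' = {e}" using card_1_singletonE by blast
    have A: "bet W W \<subseteq> A" "bet W' W' \<subseteq> A"
      using claimed_all[OF l(10) K(1)] claimed_all[OF l(10) K(2)] l(11)[OF K(1)] l(11)[OF K(2)] K finner C D(1)
      by simp_all
    have free: "bet W W' \<inter> (A \<union> B) = {}" using lay K D(2) unfolding layout_def by metis
    have sub: "W \<union> W' \<subseteq> {..<n}" using pD(4) K by blast
    have all: "bet (W \<union> W') (W \<union> W') = bet W W \<union> bet W' W' \<union> {e}"
      unfolding bet_Un bet_commute[of W' W] e by blast
    have eu: "e \<in> unclaimed n A B"
      using free e bet_edges[OF pD(4)[OF K(1)] pD(4)[OF K(2)]] unfolding unclaimed_def by blast
    have "lab ` (W \<union> W') = V" using K(3,4) CDV by (simp only: image_Un)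
    from threatI[OF sub inj this eu] have "e \<in> threats n (V, E) A B" using all A by blast
    then show ?thesis using e by blast
  qed
  then have "\<forall>p\<in>?KC \<times> ?KD. \<exists>e. e \<in> bet (fst p) (snd p) \<and> e \<in> threats n (V, E) A B" by auto
  from bchoice[OF this] obtain t where
    tt: "\<forall>p\<in>?KC \<times> ?KD. t p \<in> bet (fst p) (snd p) \<and> t p \<in> threats n (V, E) A B" ..
  have t: "t p \<in> bet (fst p) (snd p)" "t p \<in> threats n (V, E) A B" if "p \<in> ?KC \<times> ?KD" for p
    using bspec[OF tt that] by simp_all
  have "inj_on t (?KC \<times> ?KD)"
  proof (rule inj_onI)
    fix p p' assume p: "p \<in> ?KC \<times> ?KD" "p' \<in> ?KC \<times> ?KD" "t p = t p'"
    have pk: "fst p \<in> K" "snd p \<in> K" "fst p' \<in> K" "snd p' \<in> K" "lab ` fst p = C" "lab ` snd p' = D"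
      using p by auto
    have "fst p' = fst p \<and> snd p' = snd p \<or> fst p' = snd p \<and> snd p' = fst p"
      by (rule bet_unique[OF pD(1) pk(1-4) t(1)[OF p(1)]]) (unfold p(3), rule t(1)[OF p(2)])
    then show "p = p'" using pk D(2) by (metis prod.collapse)
  qed
  then have "card (?KC \<times> ?KD) \<le> card (threats n (V, E) A B)"
    by (rule card_inj_on_le) (use t finite_threats in auto)
  then have "cnt K C * cnt K D \<le> card (threats n (V, E) A B)" by (simp add: cnt_def card_cartesian_product)
  then have thr: "real (cnt K C) * real (cnt K D) \<le> card (threats n (V, E) A B)"
    by (metis of_nat_le_iff of_nat_mult)
  have cpos: "1 \<le> card i" if "i \<in> P" for i
    using l(2)[OF that] l(4)[OF that] by (simp add: Suc_le_eq card_gt_0_iff)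
  have "a\<^sup>2 * g (card E - 1) * (if R = {} then real n else 1) \<le> real (cnt K C) * real (cnt K D)"
  proof (cases "R = {}")
    case True
    have open_: "f i < card i" if "i \<in> P" for i
      using R_sub_dense[OF l(3)[OF that] l(2)[OF that]] l(9)[OF that] True by linarith
    have "card C - 1 + (card D - 1) = card E - 1" using card_E True cCD cpos[OF C] cpos[OF D(1)] by simp
    then have "g (card C - 1) * g (card D - 1) = real n * g (card E - 1)"
      by (metis (no_types, opaque_lifting) g_def mult.assoc mult.left_commute power_add)
    then have "a\<^sup>2 * g (card E - 1) * real n = (a * g (card C - 1)) * (a * g (card D - 1))"
      by (simp add: power2_eq_square)
    also have "\<dots> \<le> real (cnt K C) * real (cnt K D)"
      by (rule mult_mono) (use richD(1)[OF rich C open_[OF C]] richD(1)[OF rich D(1) open_[OF D(1)]] a g_pos in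
          \<open>auto intro: less_imp_le mult_nonneg_nonneg\<close>)
    finally show ?thesis using True by simp
  next
    case False
    then have cE: "card V = card E" by (rule card_V_unicyclic)
    have cnt1: "1 \<le> real (cnt K C)" "1 \<le> real (cnt K D)" using l(8)[OF C] l(8)[OF D(1)] by simp_all
    have bd: "a\<^sup>2 * g (card E - 1) \<le> cnt K i" if i: "i \<in> P" "f i < card i" for i
    proof -
      have "card i \<le> card V" by (rule card_mono[OF finite_V l(3)[OF i(1)]])
      then have "a * g (card E - 1) \<le> a * g (card i - 1)" using cE g_antimono a by simp
      moreover have "a\<^sup>2 * g (card E - 1) \<le> a * g (card E - 1)" using square_le[OF a] .
      ultimately show ?thesis using richD(1)[OF rich i] by linarith
    qed
    \<comment> \<open>The target has no factor \<open>n\<close> here, so the count of one open part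
      suffices and the other part contributes at least 1.\<close>
    have "f C < card C \<or> f D < card D"
      using one_closed[OF lay C D(1)] D(2) not_le by metis
    then have "a\<^sup>2 * g (card E - 1) \<le> real (cnt K C) * real (cnt K D)"
    proof
      assume "f C < card C"
      then have "a\<^sup>2 * g (card E - 1) * 1 \<le> real (cnt K C) * real (cnt K D)"
        using bd[OF C] cnt1 by (intro mult_mono) auto
      then show ?thesis by simp
    next
      assume "f D < card D"
      then have "1 * (a\<^sup>2 * g (card E - 1)) \<le> real (cnt K C) * real (cnt K D)"
        using bd[OF D(1)] cnt1 a g_pos[of "card E - 1"] by (intro mult_mono) (auto intro: less_imp_le)
      then show ?thesis by simp
    qed
    then show ?thesis using False by simp
  qed
  then show ?thesis using thr unfolding reached_def by linarith
qed

text \<open>All relevant indices of \<open>g\<close> can be kept at most \<open>card E - 1\<close>,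
  so \<open>large\<close> alone controls the counts. For the pair this relies on at least two edges
  being missing.\<close>

lemma stage_counts:
  assumes lay: "layout A B P f K" and rich: "rich a P f K" and a: "0 < a" "a \<le> 1"
    and notfull: "(\<Sum>C\<in>P. f C) + 2 \<le> card E" and large: "128 \<le> a\<^sup>2 * g (card E - 1)"
  shows "C \<in> P \<Longrightarrow> 8 \<le> cnt K C"
    "\<exists>C\<in>P. \<exists>D\<in>P. C \<noteq> D \<and> cross C D \<noteq> {} \<and> 128 * (real b + 1) \<le> real (cnt K C) * cnt K D"
proof -
  note l = layoutD[OF lay] and r = richD[OF rich]
  have VP: "V \<notin> P"
  proof
    assume V: "V \<in> P"
    then have "P = {V}" by (rule whole_part[OF lay])
    then show False using l(7)[OF V] notfull card_E card_R by simp
  qed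
  have cpos: "1 \<le> card i" if "i \<in> P" for i
    using l(2)[OF that] l(4)[OF that] by (simp add: Suc_le_eq card_gt_0_iff)
  have pair: "card i + card j \<le> card V" if "i \<in> P" "j \<in> P" "i \<noteq> j" for i j
    using card_parts_le[OF lay that l(3)[OF that(1)] l(3)[OF that(2)] finite_V] .
  have closedR: "card V = card E" if "i \<in> P" "card i \<le> f i" for i
  proof -
    have "R \<noteq> {}" using R_sub_dense[OF l(3)[OF that(1)] l(2)[OF that(1)]] l(9)[OF that(1)] that(2) by linarith
    then show ?thesis by (rule card_V_unicyclic)
  qed
  have adj: "\<exists>D\<in>P. D \<noteq> i \<and> cross i D \<noteq> {}" if "i \<in> P" for i
    using parts_adjacent[OF lay that] VP that by metis
  have sq: "a\<^sup>2 * g (card E - 1) \<le> a * g (card E - 1)" using square_le[OF a] .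
  have ag: "a * g j \<le> a * g i" if "i \<le> j" for i j
    using g_antimono[OF that] a(1) by simp
  show "8 \<le> cnt K C" if C: "C \<in> P" for C
  proof -
    obtain D where D: "D \<in> P" "D \<noteq> C" "cross C D \<noteq> {}" using adj[OF C] by blast
    have "a * g (card E - 1) \<le> cnt K C"
    proof (cases "f C < card C")
      case True
      have "card C - 1 \<le> card E - 1" using pair[OF C D(1)] D(2) cpos[OF D(1)] card_E card_R by simp
      then show ?thesis using r(1)[OF C True] ag order_trans by blast
    next
      case False
      then have cl: "card C \<le> f C" by simp
      have "card C + card D - 1 \<le> card E - 1" using pair[OF C D(1)] D(2) closedR[OF C cl] by simp
      then show ?thesis using r(2)[OF C cl D] ag order_trans by blast
    qed
    then show ?thesis using sq large by linarith
  qed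
  have Zb: "128 * (real b + 1) \<le> real (cnt K C) * cnt K D"
    if "a * g i \<le> cnt K C" "a * g j \<le> cnt K D" "i + j + 1 \<le> card E - 1" for C D i j
  proof -
    have "128 \<le> real (cnt K C) * cnt K D / real (b + 1)"
      using product_bound[OF that(1,2) _ that(3)] a(1) large by linarith
    then have "128 * real (b + 1) \<le> real (cnt K C) * cnt K D" by (simp add: pos_le_divide_eq)
    then show ?thesis by (simp add: algebra_simps)
  qed
  obtain C where C: "C \<in> P" "(\<exists>i\<in>P. card i \<le> f i) \<longrightarrow> card C \<le> f C"
    using l(6) V_ne by blast
  obtain D where D: "D \<in> P" "D \<noteq> C" "cross C D \<noteq> {}" using adj[OF C(1)] by blast
  have sumCD: "(\<Sum>i\<in>P. f i) = f C + f D" if "C \<union> D = V"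
  proof -
    have "i \<in> {C, D}" if i: "i \<in> P" for i
    proof -
      have "i \<inter> C \<noteq> {} \<or> i \<inter> D \<noteq> {}" using l(2,3)[OF i] \<open>C \<union> D = V\<close> by blast
      then show ?thesis using l(5)[OF i C(1)] l(5)[OF i D(1)] by auto
    qed
    then have "P = {C, D}" using C(1) D(1) by auto
    then show ?thesis using D(2) by simp
  qed
  have cCD: "card C + card D = card (C \<union> D)"
    using card_Un_disjoint[OF l(4)[OF C(1)] l(4)[OF D(1)]] l(5)[OF C(1) D(1)] D(2) by simp
  show "\<exists>C\<in>P. \<exists>D\<in>P. C \<noteq> D \<and> cross C D \<noteq> {} \<and> 128 * (real b + 1) \<le> real (cnt K C) * cnt K D"
  proof (cases "card C \<le> f C")
    case cl: True
    have VE: "card V = card E" by (rule closedR[OF C(1) cl])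
    have open_: "f i < card i" if "i \<in> P" "i \<noteq> C" for i
      using one_closed[OF lay C(1) that(1) cl] that(2) not_le by metis
    \<comment> \<open>Two parts forming all of \<open>V\<close>, one of them closed, would already
      hold \<open>card E - 1\<close> edges.\<close>
    have ne: "C \<union> D \<noteq> V"
    proof
      assume "C \<union> D = V"
      then show False using sumCD notfull cl l(7)[OF D(1)] cCD VE by simp
    qed
    then have "C \<union> D \<subset> V" using l(3) C(1) D(1) by blast
    then obtain x y where xy: "x \<in> C \<union> D" "y \<in> V - (C \<union> D)" "{x, y} \<in> E"
      using crossing[of "C \<union> D"] l(2)[OF C(1)] by blast
    then obtain F where F: "F \<in> P" "y \<in> F" using l(6) by blast
    have FCD: "F \<noteq> C" "F \<noteq> D" using F xy by auto
    have "card C + card D + card F \<le> card V"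
    proof -
      have "(C \<union> D) \<inter> F = {}" using l(5)[OF C(1) F(1)] l(5)[OF D(1) F(1)] FCD by blast
      then have "card (C \<union> D) + card F = card (C \<union> D \<union> F)"
        using card_Un_disjoint[of "C \<union> D" F] l(4) C(1) D(1) F(1) by simp
      also have "\<dots> \<le> card V" by (rule card_mono[OF finite_V]) (use l(3) C(1) D(1) F(1) in blast)
      finally show ?thesis using cCD by simp
    qed
    note three = this cpos[OF C(1)] cpos[OF D(1)] cpos[OF F(1)] VE
    note rD = r(1)[OF D(1) open_[OF D(1,2)]] and rF = r(1)[OF F(1) open_[OF F(1) FCD(1)]]
    show ?thesis
    \<comment> \<open>If the third part \<open>F\<close> is adjacent to \<open>C\<close>, then the
      bound for the closed part \<open>C\<close> is taken with respect to \<open>F\<close>, while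
      the product is formed with \<open>D\<close>. Otherwise \<open>D\<close> and \<open>F\<close>
      are open and adjacent.\<close>
    proof (cases "x \<in> C")
      case True
      then have crF: "cross C F \<noteq> {}" using xy F unfolding cross_def by blast
      have "128 * (real b + 1) \<le> real (cnt K C) * cnt K D"
        by (rule Zb[OF r(2)[OF C(1) cl F(1) FCD(1) crF] rD]) (use three in linarith)
      then show ?thesis using C(1) D by blast
    next
      case False
      then have "cross D F \<noteq> {}" using xy F unfolding cross_def by blast
      moreover have "128 * (real b + 1) \<le> real (cnt K D) * cnt K F"
        by (rule Zb[OF rD rF]) (use three in linarith)
      ultimately show ?thesis using D(1) F(1) FCD(2) by blast
    qed
  next
    case False
    then have open_: "f i < card i" if "i \<in> P" for i using C(2) that by (meson not_le)
    have "card C + card D \<le> card E"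
    proof (cases "R = {}")
      case True
      then have VE: "card V = card E + 1" using card_E by simp
      have "C \<union> D \<noteq> V"
      proof
        assume "C \<union> D = V"
        then show False using sumCD notfull l(7)[OF C(1)] l(7)[OF D(1)] cCD VE by simp
      qed
      then have "C \<union> D \<subset> V" using l(3) C(1) D(1) by blast
      then have "card (C \<union> D) < card V" by (rule psubset_card_mono[OF finite_V])
      then show ?thesis using cCD VE by simp
    next
      case False
      then show ?thesis using pair[OF C(1) D(1)] D(2) card_V_unicyclic by simp
    qed
    then have "128 * (real b + 1) \<le> real (cnt K C) * cnt K D"
      using Zb[OF r(1)[OF C(1) open_[OF C(1)]] r(1)[OF D(1) open_[OF D(1)]]] cpos[OF C(1)] cpos[OF D(1)] by linarith
    then show ?thesis using C(1) D by blast
  qed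
qed

end

section \<open>Loss per stage and iteration of the stages\<close>

context pattern
begin

definition loss :: real where
  "loss = 1 / (96 * (card E * card V)) / (2 ^ card V * (card E + 1))"

lemma loss_bounds: "0 < loss" "loss \<le> 1"
proof -
  let ?N = "(96 * (card E * card V)) * (2 ^ card V * (card E + 1))"
  have "0 < card E * card V" using card_E_V by simp
  then have "1 * 1 \<le> ?N" by (intro mult_le_mono) (simp_all add: Suc_le_eq)
  then have "1 \<le> real ?N" by (simp only: one_of_nat_le_iff mult_1)
  moreover have "0 < 1 / x" "1 / x \<le> 1" if "1 \<le> x" for x :: real using that by simp_all
  ultimately have "0 < 1 / real ?N" "1 / real ?N \<le> 1" by blast+
  moreover have "loss = 1 / real ?N" by (simp add: loss_def)
  ultimately show "0 < loss" "loss \<le> 1" by simp_all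
qed

definition shrink :: "real \<Rightarrow> real" where "shrink a = loss * a\<^sup>2"

lemma shrink_bounds: "0 < a \<Longrightarrow> a \<le> 1 \<Longrightarrow> 0 < shrink a \<and> shrink a \<le> a"
proof -
  assume a: "0 < a" "a \<le> 1"
  have "loss * a\<^sup>2 \<le> 1 * a\<^sup>2" using loss_bounds(2) by (rule mult_right_mono) simp
  also have "\<dots> \<le> a" using a by (simp add: power2_eq_square)
  finally show ?thesis using a loss_bounds by (simp add: shrink_def)
qed

lemma funpow_shrink: "0 < a \<Longrightarrow> a \<le> 1 \<Longrightarrow> 0 < (shrink ^^ m) a \<and> (shrink ^^ m) a \<le> a"
proof (induction m)
  case (Suc m)
  then show ?case using shrink_bounds[of "(shrink ^^ m) a"] by auto
qed simp

end

context labelled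
begin

text \<open>\<open>m\<close> bounds the number of missing edges apart from the last one. Each stage
  replaces \<open>a\<close> by \<open>shrink a\<close>; comparison with a fixed \<open>c\<close>
  keeps the size requirement independent of the stage.\<close>

lemma rich_win:
  assumes Q: "\<And>A B. reached c A B \<Longrightarrow> Q A B"
    and c: "0 < c" "128 \<le> c\<^sup>2 * g (card E - 1)"
  shows "layout A B P f K \<Longrightarrow> rich a P f K \<Longrightarrow> 0 < a \<Longrightarrow> a \<le> 1 \<Longrightarrow>
    card E \<le> (\<Sum>C\<in>P. f C) + 1 + m \<Longrightarrow> c \<le> (shrink ^^ m) a \<Longrightarrow> win n b Q A B"
proof (induction m arbitrary: A B P f K a)
  case (0 A B P f K a)
  have "reached a A B" using terminal[OF 0(1-4)] 0(5) by simp
  with c(1) 0(6) have "reached c A B" by (intro reached_mono[of c a]) auto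
  then show ?case by (intro win.now Q)
next
  case (Suc m A B P f K a)
  note lay = Suc.prems(1) and rich = Suc.prems(2) and a = Suc.prems(3,4)
  have ca: "c \<le> a" using Suc.prems(6) funpow_shrink[OF a, of "Suc m"] by linarith
  have ca2: "c\<^sup>2 \<le> a\<^sup>2" using ca c by (intro power_mono) auto
  show ?case
  proof (cases "card E \<le> (\<Sum>C\<in>P. f C) + 1")
    case True
    then show ?thesis by (intro win.now Q reached_mono[OF c(1) ca] terminal[OF lay rich a])
  next
    case False
    then have nf: "(\<Sum>C\<in>P. f C) + 2 \<le> card E" by simp
    have "c\<^sup>2 * g (card E - 1) \<le> a\<^sup>2 * g (card E - 1)"
      using ca2 g_pos[of "card E - 1"] by (intro mult_right_mono) auto
    then have large: "128 \<le> a\<^sup>2 * g (card E - 1)" using c(2) by linarith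
    note big = stage_counts[OF lay rich a nf large]
    \<comment> \<open>The adjacent pairs; one with maximal \<open>w\<close> is sacrificed, as
      assumption \<open>Z\<close> of \<open>next_rich\<close> demands.\<close>
    define T where "T = {p \<in> P \<times> P. fst p \<noteq> snd p \<and> cross (fst p) (snd p) \<noteq> {}}"
    define w where "w p = real (cnt K (fst p)) * cnt K (snd p)" for p
    have finT: "finite T" using layoutD(1)[OF lay] by (simp add: T_def)
    obtain C0 D0 where "(C0, D0) \<in> T" "128 * (real b + 1) \<le> w (C0, D0)"
      using big(2) unfolding T_def w_def mem_Collect_eq mem_Times_iff fst_conv snd_conv by blast
    then obtain p0 where p0: "p0 \<in> T" "128 * (real b + 1) \<le> w p0" by blast
    have "Max (w ` T) \<in> w ` T" using finT p0 by (intro Max_in) auto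
    then obtain p where p: "p \<in> T" "w p = Max (w ` T)" by auto
    have pmax: "w p' \<le> w p" if "p' \<in> T" for p' unfolding p(2) using finT that by (intro Max_ge) auto
    obtain C1 C2 where C: "p = (C1, C2)" by (cases p)
    have C12: "C1 \<in> P" "C2 \<in> P" "C1 \<noteq> C2" "cross C1 C2 \<noteq> {}" using p(1) unfolding T_def C by auto
    have "\<forall>S :: nat set set. \<exists>T. T \<subseteq> S \<and> card T = card S div 2"
      by (meson div_le_dividend obtain_subset_with_card_n)
    then obtain hf where hf: "\<And>S :: nat set set. hf S \<subseteq> S" "\<And>S. card (hf S) = card S div 2" by metis
    define D1 D2 where "D1 = hf {W \<in> K. lab ` W = C1}" and "D2 = hf {W \<in> K. lab ` W = C2}"
    have D1: "D1 \<subseteq> {W \<in> K. lab ` W = C1}" "card D1 = cnt K C1 div 2"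
      and D2: "D2 \<subseteq> {W \<in> K. lab ` W = C2}" "card D2 = cnt K C2 div 2"
      unfolding D1_def D2_def cnt_def by (rule hf)+
    interpret st: stage V E R lab n b A B P f K C1 C2 D1 D2
      by unfold_locales (fact lay C12 D1(1) D2(1))+
    define \<delta> where "\<delta> = 1 / (96 * (real (card E * card V)))"
    have ev: "0 < card E * card V" using card_E_V by simp
    have \<delta>: "0 < \<delta>" "96 * (card E * card V * \<delta>) \<le> 1" "\<delta> \<le> 1 / 8"
    proof -
      show "0 < \<delta>" "96 * (card E * card V * \<delta>) \<le> 1" using ev by (auto simp: \<delta>_def)
      have "1 \<le> real (card E * card V)" using ev by (simp only: one_of_nat_le_iff Suc_le_eq)
      then show "\<delta> \<le> 1 / 8" by (simp add: \<delta>_def field_simps)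
    qed
    \<comment> \<open>Halving with rounding loses at most a factor 4 for each of the two types,
      whence the 16 in \<open>DD\<close>.\<close>
    have half: "m \<le> 4 * (m div 2)" if "8 \<le> m" for m :: nat using that by linarith
    have DD: "real (cnt K C1) * cnt K C2 \<le> 16 * (card D1 * card D2)"
    proof -
      have "cnt K C1 * cnt K C2 \<le> (4 * card D1) * (4 * card D2)"
        using half[OF big(1)[OF C12(1)]] half[OF big(1)[OF C12(2)]] D1(2) D2(2) by (intro mult_le_mono) auto
      then have "real (cnt K C1 * cnt K C2) \<le> real ((4 * card D1) * (4 * card D2))" by (simp only: of_nat_le_iff)
      then show ?thesis by simp
    qed
    have Z: "128 * (real b + 1) \<le> real (cnt K C1) * cnt K C2"
      using pmax[OF p0(1)] p0(2) by (simp add: w_def C)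
    show ?thesis
    proof (rule st.stage_win_aux[OF \<delta>(1,2) DD Z, of Q A B K 0 0])
      show "st.inv A B K" by (rule st.inv_0)
      show "real (card (st.touched A K C)) \<le> \<delta> * real (cnt K C) + 1" if "C \<in> P" for C
      proof -
        have "st.touched A K C = {}" using layoutD(11)[OF lay] unfolding st.touched_def by auto
        then show ?thesis using \<delta>(1) by simp
      qed
      show "card D1 * card D2 \<le> card (st.live A B K) + 2 * n * 0 + b * 0"
        using st.card_live_0 by (simp add: card_cartesian_product)
    next
      fix A' B' K'
      assume inv: "st.inv A' B' K'" and stop: "st.stop \<delta> A' K'"
        and tch: "\<And>C. C \<in> P \<Longrightarrow> real (card (st.touched A' K' C)) \<le> \<delta> * real (cnt K C) + 1"
      have D: "2 * card D1 \<le> cnt K C1" "2 * card D2 \<le> cnt K C2" using D1(2) D2(2) by simp_all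
      obtain \<tau> k K2 X where N: "X \<in> P" "X \<subseteq> \<tau>" "conn \<tau>" "\<tau> \<subseteq> V" "\<forall>C\<in>P. C \<subseteq> \<tau> \<or> C \<inter> \<tau> = {}"
        "layout A' B' (insert \<tau> {C \<in> P. C \<inter> \<tau> = {}}) (f(\<tau> := k)) K2"
        "min (\<delta> * cnt K X) (\<delta> * (real (cnt K C1) * cnt K C2) / (b + 1)) < 2 ^ card V * (card E + 1) * real (cnt K2 \<tau>)"
        "\<forall>C\<in>P. C \<inter> \<tau> = {} \<longrightarrow> cnt K C \<le> 4 * cnt K2 C"
        "(\<Sum>C | C \<in> P \<and> C \<subseteq> \<tau>. f C + 1) \<le> k + 1" "\<tau> \<in> P \<longrightarrow> f \<tau> < k" "k \<le> card (inner \<tau>)"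
        by (rule st.next_layout[OF inv stop tch \<delta>(1,3) D big(1)]) (assumption, assumption, rule that)
      have sat: "C \<subseteq> \<tau> \<or> C \<inter> \<tau> = {}" if "C \<in> P" for C using N(5) that by (rule bspec)
      have others: "cnt K C \<le> 4 * cnt K2 C" if "C \<in> P" "C \<inter> \<tau> = {}" for C using N(8) that by simp
      have Zm: "real (cnt K C) * cnt K D \<le> real (cnt K C1) * cnt K C2"
        if "C \<in> P" "D \<in> P" "C \<noteq> D" "cross C D \<noteq> {}" for C D
        using pmax[of "(C, D)"] that by (simp add: w_def C T_def)
      have M: "4 * \<delta> \<le> real (2 ^ card V * (card E + 1))"
      proof -
        have "1 * 1 \<le> 2 ^ card V * (card E + 1)" by (intro mult_le_mono) auto
        then have "1 \<le> real (2 ^ card V * (card E + 1))" by (simp only: one_of_nat_le_iff mult_1)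
        then show ?thesis using \<delta>(3) by linarith
      qed
      have rich': "rich (shrink a) (insert \<tau> {C \<in> P. C \<inter> \<tau> = {}}) (f(\<tau> := k)) K2"
      proof -
        have "shrink a = \<delta> / real (2 ^ card V * (card E + 1)) * a\<^sup>2"
          unfolding shrink_def loss_def \<delta>_def by (simp only: of_nat_mult of_nat_power of_nat_add of_nat_numeral of_nat_1)
        moreover have "rich (\<delta> / real (2 ^ card V * (card E + 1)) * a\<^sup>2) (insert \<tau> {C \<in> P. C \<inter> \<tau> = {}}) (f(\<tau> := k)) K2"
        proof (rule next_rich[OF lay rich a Zm N(1-4) sat N(6,7) others N(9) _ N(11) \<delta>(1) M])
          show "\<tau> \<in> P \<Longrightarrow> f \<tau> < k" using N(10) by (rule mp)
        qed
        ultimately show ?thesis by (simp only:)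
      qed
      \<comment> \<open>Either at least two old parts were joined, and a connecting edge is gained,
        or the type is old and gained an edge inside.\<close>
      have prog: "(\<Sum>C\<in>P. f C) + 1 \<le> (\<Sum>C\<in>insert \<tau> {C \<in> P. C \<inter> \<tau> = {}}. (f(\<tau> := k)) C)"
      proof -
        note l = layoutD[OF lay]
        have \<tau>ne: "\<tau> \<noteq> {}" using N(1,2) l(2) by auto
        let ?I = "{C. C \<in> P \<and> C \<subseteq> \<tau>}" and ?O = "{C \<in> P. C \<inter> \<tau> = {}}"
        have fin: "finite ?I" "finite ?O" using l(1) by simp_all
        have "P = ?I \<union> ?O" using sat by blast
        moreover have "?I \<inter> ?O = {}" using l(2) by blast
        ultimately have "(\<Sum>C\<in>P. f C) = (\<Sum>C\<in>?I. f C) + (\<Sum>C\<in>?O. f C)"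
          using sum.union_disjoint[OF fin, of f] by simp
        moreover have "(\<Sum>C\<in>insert \<tau> ?O. (f(\<tau> := k)) C) = k + (\<Sum>C\<in>?O. f C)"
        proof -
          have "\<tau> \<notin> ?O" using \<tau>ne by auto
          moreover from this have "(\<Sum>C\<in>?O. (f(\<tau> := k)) C) = (\<Sum>C\<in>?O. f C)" by (intro sum.cong) auto
          ultimately show ?thesis using fin by simp
        qed
        moreover have "(\<Sum>C\<in>?I. f C) + 1 \<le> k"
        proof -
          have s: "(\<Sum>C\<in>?I. f C) + card ?I \<le> k + 1" using N(9) by (simp add: sum.distrib sum_Suc)
          show ?thesis
          proof (cases "X = \<tau>")
            case True
            have "C = \<tau>" if C: "C \<in> P" "C \<subseteq> \<tau>" for C
              using l(5)[OF C(1) N(1)] l(2)[OF C(1)] C(2) True by auto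
            then have "?I = {\<tau>}" using N(1) True by auto
            then show ?thesis using N(10) N(1) True by simp
          next
            case False
            then obtain y where y: "y \<in> \<tau>" "y \<notin> X" using N(2) by auto
            then have "y \<in> V" using N(4) by auto
            then obtain Y where Y: "Y \<in> P" "y \<in> Y" using l(6) by blast
            have "{X, Y} \<subseteq> ?I" using N(1,2) Y sat[OF Y(1)] y by auto
            moreover have "X \<noteq> Y" using y Y by auto
            ultimately have "2 \<le> card ?I" using card_mono[OF fin(1), of "{X, Y}"] by simp
            then show ?thesis using s by simp
          qed
        qed
        ultimately show ?thesis by simp
      qed
      have sh: "0 < shrink a" "shrink a \<le> 1" using shrink_bounds[OF a] a by auto
      show "win n b Q A' B'"
      proof (rule Suc.IH[OF N(6) rich' sh])
        show "card E \<le> (\<Sum>C\<in>insert \<tau> {C \<in> P. C \<inter> \<tau> = {}}. (f(\<tau> := k)) C) + 1 + m"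
          using prog Suc.prems(5) by simp
        show "c \<le> (shrink ^^ m) (shrink a)" using Suc.prems(6) by (simp add: funpow_swap1)
      qed
    qed simp_all
  qed
qed

end

section \<open>Trees and unicyclic graphs\<close>

text \<open>On a longest path all neighbours of the first vertex lie on the path itself, and one
  that is not the second vertex closes a cycle.\<close>

lemma cycle_exists:
  assumes S: "finite S" "S \<noteq> {}" and card2: "\<And>h. h \<in> E \<Longrightarrow> card h = 2"
    and deg: "\<And>x. x \<in> S \<Longrightarrow> 2 \<le> card {h \<in> E. h \<subseteq> S \<and> x \<in> h}"
  shows "cycles (V, E) \<noteq> {}"
proof -
  define path where "path vs \<longleftrightarrow> vs \<noteq> [] \<and> distinct vs \<and> set vs \<subseteq> S \<and>
    (\<forall>i. Suc i < length vs \<longrightarrow> {vs ! i, vs ! Suc i} \<in> E)" for vs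
  have nbr: "\<exists>y z. y \<in> S \<and> z \<in> S \<and> y \<noteq> z \<and> y \<noteq> x \<and> z \<noteq> x \<and> {x, y} \<in> E \<and> {x, z} \<in> E" if "x \<in> S" for x
  proof -
    obtain h k where hk: "h \<in> E" "k \<in> E" "h \<subseteq> S" "k \<subseteq> S" "x \<in> h" "x \<in> k" "h \<noteq> k"
    proof -
      have "\<not> card {h \<in> E. h \<subseteq> S \<and> x \<in> h} \<le> Suc 0" using deg[OF \<open>x \<in> S\<close>] by simp
      moreover have "finite {h \<in> E. h \<subseteq> S \<and> x \<in> h}"
        by (rule finite_subset[of _ "Pow S"]) (use S in auto)
      ultimately show thesis using that card_le_Suc0_iff_eq[of "{h \<in> E. h \<subseteq> S \<and> x \<in> h}"] \<open>x \<in> S\<close> by blast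
    qed
    have "\<exists>y. h = {x, y} \<and> y \<noteq> x" "\<exists>z. k = {x, z} \<and> z \<noteq> x"
      using card2[OF hk(1)] card2[OF hk(2)] hk(5,6) by (auto simp: card_2_iff)
    then obtain y z where "h = {x, y}" "y \<noteq> x" "k = {x, z}" "z \<noteq> x" by blast
    then show ?thesis using hk by (intro exI[of _ y] exI[of _ z]) auto
  qed
  obtain x0 where x0: "x0 \<in> S" using S by blast
  have p0: "path [x0]" using x0 by (simp add: path_def)
  have bound: "length vs \<le> card S" if "path vs" for vs
    using that S card_mono[of S "set vs"] distinct_card[of vs] by (simp add: path_def)
  obtain vs where vs: "path vs" and max: "\<And>ws. path ws \<Longrightarrow> length ws \<le> length vs"
    using ex_has_greatest_nat[of path "[x0]" length "Suc (card S)"] p0 le_imp_less_Suc[OF bound] by blast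
  have vne: "vs \<noteq> []" "distinct vs" "set vs \<subseteq> S" using vs by (simp_all add: path_def)
  have h0: "vs ! 0 \<in> S" using vne by (metis length_greater_0_conv nth_mem subsetD)
  obtain y z where yz: "y \<in> S" "z \<in> S" "y \<noteq> z" "y \<noteq> vs ! 0" "z \<noteq> vs ! 0" "{vs ! 0, y} \<in> E" "{vs ! 0, z} \<in> E"
    using nbr[OF h0] by blast
  have inset: "w \<in> set vs" if "w \<in> S" "{vs ! 0, w} \<in> E" for w
  proof (rule ccontr)
    assume "w \<notin> set vs"
    moreover have "{(w # vs) ! i, (w # vs) ! Suc i} \<in> E" if "Suc i < length (w # vs)" for i
      using that vs \<open>{vs ! 0, w} \<in> E\<close> by (cases i) (auto simp: path_def insert_commute)
    ultimately have "path (w # vs)" using vne \<open>w \<in> S\<close> unfolding path_def by simp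
    then show False using max[of "w # vs"] by simp
  qed
  \<comment> \<open>On a path with one vertex \<open>vs ! 1\<close> is unspecified; of the distinct
    \<open>y\<close> and \<open>z\<close> one differs from it in any case.\<close>
  obtain w where w: "w \<in> set vs" "w \<noteq> vs ! 0" "w \<noteq> vs ! 1" "{vs ! 0, w} \<in> E"
    using inset[OF yz(1,6)] inset[OF yz(2,7)] yz by metis
  then obtain j where j: "j < length vs" "w = vs ! j" by (metis in_set_conv_nth)
  have j2: "2 \<le> j"
  proof (rule ccontr)
    assume "\<not> 2 \<le> j"
    then have "j = 0 \<or> j = 1" by auto
    then show False using w j by auto
  qed
  let ?c = "take (Suc j) vs"
  have len: "length ?c = Suc j" using j by simp
  have "{{?c ! i, ?c ! (Suc i mod length ?c)} | i. i < length ?c} \<subseteq> E"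
  proof
    fix e assume "e \<in> {{?c ! i, ?c ! (Suc i mod length ?c)} | i. i < length ?c}"
    then obtain i where i: "i < Suc j" "e = {?c ! i, ?c ! (Suc i mod Suc j)}" using len by auto
    show "e \<in> E"
    proof (cases "i = j")
      case True
      then have "e = {vs ! 0, w}" using i j by (simp add: insert_commute)
      then show ?thesis using w by simp
    next
      case False
      then have "e = {vs ! i, vs ! Suc i}" "Suc i < length vs" using i j by simp_all
      then show ?thesis using vs by (simp add: path_def)
    qed
  qed
  then have "{{?c ! i, ?c ! (Suc i mod length ?c)} | i. i < length ?c} \<in> cycles (V, E)"
    unfolding cycles_def mem_Collect_eq snd_conv
  proof (intro conjI exI[of _ ?c])
    show "distinct ?c" "3 \<le> length ?c" using vne(2) len j2 by simp_all
  qed simp_all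
  then show ?thesis by blast
qed

text \<open>Without cycles some vertex of \<open>S\<close> lies on at most one edge inside
  \<open>S\<close>; removing it costs at most that edge.\<close>

lemma forest_card:
  assumes "finite S" "S \<noteq> {}" "\<And>h. h \<in> E \<Longrightarrow> card h = 2" "cycles (V, E) = {}"
  shows "card {h \<in> E. h \<subseteq> S} < card S"
  using assms(1,2)
proof (induction "card S" arbitrary: S rule: less_induct)
  case less
  have fin: "finite {h \<in> E. h \<subseteq> S}" by (rule finite_subset[of _ "Pow S"]) (use less.prems in auto)
  have "\<exists>x\<in>S. card {h \<in> E. h \<subseteq> S \<and> x \<in> h} \<le> 1"
  proof (rule ccontr)
    assume a: "\<not> ?thesis"
    have "2 \<le> card {h \<in> E. h \<subseteq> S \<and> x \<in> h}" if "x \<in> S" for x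
    proof -
      have "\<not> card {h \<in> E. h \<subseteq> S \<and> x \<in> h} \<le> 1" using a that by blast
      then show ?thesis by simp
    qed
    from cycle_exists[OF less.prems assms(3) this] assms(4) show False by blast
  qed
  then obtain x where x: "x \<in> S" "card {h \<in> E. h \<subseteq> S \<and> x \<in> h} \<le> 1" by blast
  have split: "{h \<in> E. h \<subseteq> S} = {h \<in> E. h \<subseteq> S - {x}} \<union> {h \<in> E. h \<subseteq> S \<and> x \<in> h}" by blast
  have c: "card {h \<in> E. h \<subseteq> S} \<le> card {h \<in> E. h \<subseteq> S - {x}} + 1"
    using x(2) card_Un_le[of "{h \<in> E. h \<subseteq> S - {x}}" "{h \<in> E. h \<subseteq> S \<and> x \<in> h}"] unfolding split by linarith
  show ?case
  proof (cases "S - {x} = {}")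
    case True
    then have "S = {x}" using x by auto
    have "h \<notin> E" if "h \<subseteq> S" for h
    proof
      assume "h \<in> E"
      then have "card h = 2" by (rule assms(3))
      moreover have "card h \<le> card {x}" using that \<open>S = {x}\<close> by (intro card_mono) auto
      ultimately show False by simp
    qed
    then have "{h \<in> E. h \<subseteq> S} = {}" by blast
    then show ?thesis using \<open>S = {x}\<close> by simp
  next
    case False
    have "card (S - {x}) < card S" using card_Diff1_less[OF less.prems(1) x(1)] .
    then have "card {h \<in> E. h \<subseteq> S - {x}} < card (S - {x})" using less.hyps[of "S - {x}"] less.prems False by simp
    then show ?thesis using c x less.prems by (simp add: card_Diff_singleton)
  qed
qed

lemma connected_crossing:
  assumes "connected_graph (V, E)" "\<Union>E \<subseteq> V" "X \<noteq> {}" "X \<subset> V"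
  shows "\<exists>x\<in>X. \<exists>y\<in>V - X. {x, y} \<in> E"
proof (rule ccontr)
  assume none: "\<not> ?thesis"
  obtain u w where uw: "u \<in> X" "w \<in> V" "w \<notin> X" using assms(3,4) by blast
  then have "(u, w) \<in> {(x, y). {x, y} \<in> E}\<^sup>*" using assms(1,4) unfolding connected_graph_def by auto
  then have "\<exists>x y. x \<in> X \<and> y \<notin> X \<and> {x, y} \<in> E"
    using uw(1,3) by (induction rule: rtrancl_induct) auto
  then show False using none assms(2) by blast
qed

section \<open>Greedy embedding of the spanning tree\<close>

context pattern
begin

definition nbrs :: "edge set \<Rightarrow> nat set \<Rightarrow> nat \<Rightarrow> nat set" where
  "nbrs A S u = {w \<in> S. {u, w} \<in> A}"

text \<open>Given \<open>forest\<close>, this edge count says that \<open>W\<close> induces a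
  subtree of \<open>E - R\<close>; counting replaces connectedness.\<close>

definition treeset :: "'v set \<Rightarrow> bool" where
  "treeset W \<longleftrightarrow> W \<subseteq> V \<and> card {h \<in> E - R. h \<subseteq> W} + 1 = card W"

definition emb :: "edge set \<Rightarrow> nat set \<Rightarrow> 'v set \<Rightarrow> ('v \<Rightarrow> nat) \<Rightarrow> bool" where
  "emb A S W \<phi> \<longleftrightarrow> inj_on \<phi> W \<and> \<phi> ` W \<subseteq> S \<and> (\<forall>h\<in>E - R. h \<subseteq> W \<longrightarrow> \<phi> ` h \<in> A)"

lemma treeset_singleton: "x \<in> V \<Longrightarrow> treeset {x}"
proof -
  assume x: "x \<in> V"
  have "h \<notin> E" if "h \<subseteq> {x}" for h
  proof
    assume "h \<in> E"
    then have "card h = 2" using edgeD by simp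
    moreover have "card h \<le> card {x}" using that by (intro card_mono) auto
    ultimately show False by simp
  qed
  then have "{h \<in> E - R. h \<subseteq> {x}} = {}" by blast
  then show "treeset {x}" using x by (simp add: treeset_def)
qed

text \<open>The forest bound has room for one new edge only, so the attached vertex has no second
  neighbour in \<open>W\<close> and can be embedded greedily.\<close>

lemma treeset_insert:
  assumes W: "treeset W" and x: "x \<in> V" "x \<notin> W" "x' \<in> W" "{x', x} \<in> E - R"
  shows "{h \<in> E - R. h \<subseteq> insert x W} = insert {x', x} {h \<in> E - R. h \<subseteq> W}" "treeset (insert x W)"
proof -
  have WV: "W \<subseteq> V" "finite W" using W finite_V finite_subset by (auto simp: treeset_def)
  have fin: "finite {h \<in> E - R. h \<subseteq> Y}" for Y using finite_E by simp
  have sub: "insert {x', x} {h \<in> E - R. h \<subseteq> W} \<subseteq> {h \<in> E - R. h \<subseteq> insert x W}" using x by auto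
  have c: "card (insert {x', x} {h \<in> E - R. h \<subseteq> W}) = card W"
    using W x fin[of W] by (subst card_insert_disjoint) (auto simp: treeset_def)
  have "card {h \<in> E - R. h \<subseteq> insert x W} < card (insert x W)"
    by (rule forest) (use WV x in auto)
  then have le: "card {h \<in> E - R. h \<subseteq> insert x W} \<le> card W" using WV x by simp
  show eq: "{h \<in> E - R. h \<subseteq> insert x W} = insert {x', x} {h \<in> E - R. h \<subseteq> W}"
    using card_seteq[OF fin sub] c le by simp
  show "treeset (insert x W)" unfolding treeset_def eq c using WV x by simp
qed

lemma emb_insert:
  assumes W: "treeset W" and x: "x \<in> V" "x \<notin> W" "x' \<in> W" "{x', x} \<in> E - R"
    and e: "emb A S W \<phi>" and w: "w \<in> nbrs A S (\<phi> x')" "w \<notin> \<phi> ` W"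
  shows "emb A S (insert x W) (\<phi>(x := w))"
proof -
  have "(\<phi>(x := w)) ` h \<in> A" if h: "h \<in> E - R" "h \<subseteq> insert x W" for h
  proof -
    have "h = {x', x} \<or> h \<in> {h \<in> E - R. h \<subseteq> W}" using treeset_insert(1)[OF W x] h by blast
    then show ?thesis
    proof
      assume "h = {x', x}"
      moreover have "x' \<noteq> x" using x by auto
      ultimately have "(\<phi>(x := w)) ` h = {\<phi> x', w}" by auto
      then show ?thesis using w by (simp add: nbrs_def)
    next
      assume hW: "h \<in> {h \<in> E - R. h \<subseteq> W}"
      then have "(\<phi>(x := w)) ` h = \<phi> ` h" using x(2) by (intro image_cong) auto
      then show ?thesis using e hW by (simp add: emb_def)
    qed
  qed
  moreover have "inj_on (\<phi>(x := w)) (insert x W)"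
    using e w(2) x(2) by (auto simp: emb_def inj_on_def)
  moreover have "(\<phi>(x := w)) ` insert x W \<subseteq> S" using e w(1) x(2) by (auto simp: emb_def nbrs_def)
  ultimately show ?thesis by (simp add: emb_def)
qed

lemma fresh_nbr:
  assumes "emb A S W \<phi>" "W \<subset> V" "x \<in> W" "finite S" "\<And>u. u \<in> S \<Longrightarrow> card V \<le> card (nbrs A S u)"
  obtains w where "w \<in> nbrs A S (\<phi> x)" "w \<notin> \<phi> ` W"
proof -
  have "card (\<phi> ` W) = card W" using assms(1) card_image by (auto simp: emb_def)
  also have "\<dots> < card V" using assms(2) finite_V by (rule psubset_card_mono[rotated])
  also have "\<dots> \<le> card (nbrs A S (\<phi> x))" using assms(1,3,5) by (auto simp: emb_def)
  finally have "\<not> nbrs A S (\<phi> x) \<subseteq> \<phi> ` W"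
    using card_mono[of "\<phi> ` W" "nbrs A S (\<phi> x)"] assms(2) finite_V finite_subset by (metis finite_imageI not_le psubset_imp_subset)
  then show ?thesis using that by blast
qed

text \<open>Fewer than \<open>card V\<close> images are in use at any time, so degree
  \<open>card V\<close> provides a fresh neighbour. That \<open>\<phi>\<close> is kept on
  \<open>W\<close> allows images to be prescribed.\<close>

lemma emb_extend:
  assumes S: "finite S" "\<And>u. u \<in> S \<Longrightarrow> card V \<le> card (nbrs A S u)"
  shows "treeset W \<Longrightarrow> W \<noteq> {} \<Longrightarrow> emb A S W \<phi> \<Longrightarrow> \<exists>\<psi>. emb A S V \<psi> \<and> (\<forall>x\<in>W. \<psi> x = \<phi> x)"
proof (induction "card V - card W" arbitrary: W \<phi> rule: less_induct)
  case less
  have WV: "W \<subseteq> V" using less.prems(1) by (simp add: treeset_def)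
  show ?case
  proof (cases "W = V")
    case True
    then show ?thesis using less.prems(3) by blast
  next
    case False
    then have WV': "W \<subset> V" using WV by blast
    from tree_crossing[OF less.prems(2) this] obtain x' x where x: "x' \<in> W" "x \<in> V" "x \<notin> W" "{x', x} \<in> E - R" by blast
    obtain w where w: "w \<in> nbrs A S (\<phi> x')" "w \<notin> \<phi> ` W"
      by (rule fresh_nbr[OF less.prems(3) WV' x(1) S]) (assumption, rule that)
    note e = emb_insert[OF less.prems(1) x(2,3,1,4) less.prems(3) w] and t = treeset_insert(2)[OF less.prems(1) x(2,3,1,4)]
    have "card (insert x W) \<le> card V" using t finite_V by (intro card_mono) (auto simp: treeset_def)
    moreover have "card (insert x W) = Suc (card W)" using x(3) WV finite_V finite_subset by (metis card_insert_disjoint)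
    ultimately have "card V - card (insert x W) < card V - card W" by simp
    from less.hyps[OF this t _ e] obtain \<psi> where "emb A S V \<psi>" "\<forall>y\<in>insert x W. \<psi> y = (\<phi>(x := w)) y" by blast
    then show ?thesis using x(3) by (intro exI[of _ \<psi>]) auto
  qed
qed

end

section \<open>Trees and unicyclic graphs as patterns\<close>

lemma pattern_tree:
  assumes "is_tree (V, E)" "2 \<le> card E"
  shows "pattern V E {}"
proof -
  have sg: "finite V" "\<And>h. h \<in> E \<Longrightarrow> h \<subseteq> V \<and> card h = 2" and co: "connected_graph (V, E)" and cy: "cycles (V, E) = {}"
    using assms(1) by (auto simp: is_tree_def simple_graph_def)
  have UE: "\<Union>E \<subseteq> V" using sg(2) by blast
  show ?thesis
  proof
    show "\<exists>x\<in>X. \<exists>y\<in>V - X. {x, y} \<in> E - {}" if "X \<noteq> {}" "X \<subset> V" for X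
      using connected_crossing[OF co UE that] by simp
    show "card {h \<in> E - {}. h \<subseteq> S} < card S" if "S \<subseteq> V" "S \<noteq> {}" for S
    proof -
      have "finite S" using that sg(1) finite_subset by blast
      from forest_card[OF this that(2) _ cy] sg(2) show ?thesis by simp
    qed
  qed (use sg assms(2) in auto)
qed

text \<open>\<open>r\<close> is the closing edge of the cycle. The rest of the cycle joins its ends,
  so any cut crossed by \<open>r\<close> is crossed by another edge, and a cycle avoiding
  \<open>r\<close> would be a second one.\<close>

lemma pattern_unicyclic:
  assumes "unicyclic (V, E)" "2 \<le> card E"
  obtains r where "pattern V E {r}"
proof -
  have sg: "finite V" "\<And>h. h \<in> E \<Longrightarrow> h \<subseteq> V \<and> card h = 2" and co: "connected_graph (V, E)"
    and ex: "\<exists>!C. C \<in> cycles (V, E)"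
    using assms(1) by (auto simp: unicyclic_def simple_graph_def)
  obtain C where C: "C \<in> cycles (V, E)" "\<And>C'. C' \<in> cycles (V, E) \<Longrightarrow> C' = C" using ex by blast
  obtain vs where vs: "distinct vs" "3 \<le> length vs" "C \<subseteq> E"
    "C = {{vs ! i, vs ! (Suc i mod length vs)} | i. i < length vs}"
    using C(1) unfolding cycles_def by auto
  define k where "k = length vs - 1"
  define r where "r = {vs ! k, vs ! 0}"
  have k: "2 \<le> k" "length vs = Suc k" using vs(2) by (simp_all add: k_def)
  have inC: "{vs ! i, vs ! (Suc i mod length vs)} \<in> C" if "i \<le> k" for i
    using vs(4) k(2) that by auto
  have rC: "r \<in> C" using inC[of k] k by (simp add: r_def)
  have edge: "{vs ! i, vs ! Suc i} \<in> E - {r}" if "i < k" for i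
  proof -
    have "{vs ! i, vs ! Suc i} \<in> C" using inC[of i] that k by simp
    moreover have "{vs ! i, vs ! Suc i} \<noteq> r"
    proof
      assume "{vs ! i, vs ! Suc i} = r"
      then have "vs ! i = vs ! k \<or> vs ! i = vs ! 0 \<and> vs ! Suc i = vs ! k"
        unfolding r_def by (auto simp: doubleton_eq_iff)
      then have "i = k \<or> i = 0 \<and> Suc i = k" using vs(1) that k by (auto simp: nth_eq_iff_index_eq)
      then show False using that k by auto
    qed
    ultimately show ?thesis using vs(3) by blast
  qed
  have UE: "\<Union>E \<subseteq> V" using sg(2) by blast
  have "pattern V E {r}"
  proof
    show "{r} \<subseteq> E" using rC vs(3) by blast
    show "\<exists>x\<in>X. \<exists>y\<in>V - X. {x, y} \<in> E - {r}" if X: "X \<noteq> {}" "X \<subset> V" for X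
    proof (rule ccontr)
      assume none: "\<not> ?thesis"
      have step: "vs ! i \<in> X \<longleftrightarrow> vs ! Suc i \<in> X" if "i < k" for i
      proof -
        have "{vs ! i, vs ! Suc i} \<subseteq> V" "{vs ! Suc i, vs ! i} \<in> E - {r}"
          using edge[OF that] UE by (auto simp: insert_commute)
        then show ?thesis using none edge[OF that] by blast
      qed
      have all: "i \<le> k \<Longrightarrow> vs ! i \<in> X \<longleftrightarrow> vs ! 0 \<in> X" for i
        by (induction i) (use step in auto)
      obtain x y where xy: "x \<in> X" "y \<in> V - X" "{x, y} \<in> E" using connected_crossing[OF co UE X] by blast
      then have "{x, y} = r" using none by blast
      then show False using xy all[of k] unfolding r_def by (auto simp: doubleton_eq_iff)
    qed
    have "cycles (V, E - {r}) = {}"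
    proof (rule ccontr)
      assume "cycles (V, E - {r}) \<noteq> {}"
      then obtain C' where C': "C' \<in> cycles (V, E - {r})" by blast
      then have "C' \<subseteq> E - {r}" "C' \<in> cycles (V, E)" unfolding cycles_def by auto
      then show False using C(2) rC by blast
    qed
    then show "card {h \<in> E - {r}. h \<subseteq> S} < card S" if "S \<subseteq> V" "S \<noteq> {}" for S
      using forest_card[of S "E - {r}" V] that sg finite_subset[OF that(1) sg(1)] by simp
  qed (use sg assms(2) in auto)
  then show thesis by (rule that)
qed

section \<open>A large first move of Avoider\<close>

context pattern
begin

lemma emb_copy:
  assumes "emb A S V \<phi>" "S \<subseteq> {..<n}" "\<And>h. h \<in> R \<Longrightarrow> \<phi> ` h \<in> A'" "A \<subseteq> A'"
  shows "(\<phi> ` V, (`) \<phi> ` E) \<in> copies (V, E) ({..<n}, A')"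
proof -
  have "\<phi> ` h \<in> A'" if "h \<in> E" for h
  proof (cases "h \<in> R")
    case False
    then show ?thesis using assms(1,4) edgeD[OF that] that by (auto simp: emb_def)
  qed (use assms(3) in auto)
  then show ?thesis using assms(1,2) unfolding copies_def emb_def by (auto intro!: exI[of _ \<phi>])
qed

text \<open>A maximal subtree containing \<open>z\<close> but not \<open>y\<close> can be extended
  only by \<open>y\<close>. Hence the images of \<open>z\<close> and of the neighbour
  \<open>y'\<close> can be fixed before that of \<open>y\<close> is chosen.\<close>

lemma tree_below_edge:
  assumes "z \<in> V" "y \<in> V" "y \<noteq> z"
  obtains W y' where "treeset W" "z \<in> W" "y \<notin> W" "y' \<in> W" "{y', y} \<in> E - R"
proof -
  let ?P = "\<lambda>W. treeset W \<and> z \<in> W \<and> y \<notin> W"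
  have "?P {z}" using assms treeset_singleton by simp
  moreover have "\<forall>W. ?P W \<longrightarrow> card W < Suc (card V)"
    using finite_V card_mono by (auto simp: treeset_def less_Suc_eq_le)
  ultimately obtain W where W: "?P W" and max: "\<forall>W'. ?P W' \<longrightarrow> card W' \<le> card W"
    using ex_has_greatest_nat[of ?P "{z}" card] by blast
  have WV: "W \<subset> V" "W \<noteq> {}" using W assms by (auto simp: treeset_def)
  obtain x' x where x: "x' \<in> W" "x \<in> V - W" "{x', x} \<in> E - R" using tree_crossing[OF WV(2,1)] by blast
  have "x = y"
  proof (rule ccontr)
    assume "x \<noteq> y"
    then have "?P (insert x W)" using W treeset_insert(2)[of W x x'] x by simp
    then have "card (insert x W) \<le> card W" using max by blast
    moreover have "finite W" using WV finite_V finite_subset by blast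
    ultimately show False using x by simp
  qed
  then show thesis using that[of W x'] W x by simp
qed

text \<open>A vertex of maximum degree \<open>u\<close> is made the neighbour of one end \<open>y\<close> of the missing edge of the
  spanning tree while the image of the other end \<open>z\<close> is kept fixed: every neighbour of \<open>u\<close> then gives a
  threat at this image, which is at least half as many edges as are lost by deleting the image of \<open>z\<close>.\<close>

lemma few_edges_or_many_threats:
  assumes A: "A \<subseteq> edges (complete_graph n)" and nocopy: "copies (V, E) ({..<n}, A) = {}"
  shows "S \<subseteq> {..<n} \<Longrightarrow> card {e \<in> A. e \<subseteq> S} \<le>
    2 * card V * card S + 2 * card {e \<in> threats n (V, E) A {}. e \<subseteq> S \<and> R \<noteq> {}}"
proof (induction "card S" arbitrary: S rule: less_induct)
  case less
  let ?Th = "\<lambda>S. {e \<in> threats n (V, E) A {}. e \<subseteq> S \<and> R \<noteq> {}}"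
  have finS: "finite S" using less.prems finite_subset by blast
  have finA: "finite A"
    by (rule finite_subset[OF A]) (rule finite_subset[of _ "Pow {..<n}"], auto simp: complete_graph_def)
  have pair: "\<exists>w. e = {x, w} \<and> w \<noteq> x" if "e \<in> A" "x \<in> e" for e x
  proof -
    have "card e = 2" using that(1) A by (auto simp: complete_graph_def)
    then show ?thesis using that(2) by (auto simp: card_2_iff)
  qed
  have finTh: "finite (?Th T)" for T
    by (rule finite_subset[of _ "Pow {..<n}"]) (auto simp: threats_def unclaimed_def complete_graph_def)
  have del: "card {e \<in> A. e \<subseteq> S} \<le> card {e \<in> A. e \<subseteq> S - {x}} + card (nbrs A S x)" if "x \<in> S" for x
  proof -
    have "{e \<in> A. e \<subseteq> S} \<subseteq> {e \<in> A. e \<subseteq> S - {x}} \<union> (\<lambda>w. {x, w}) ` nbrs A S x"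
    proof
      fix e assume e: "e \<in> {e \<in> A. e \<subseteq> S}"
      show "e \<in> {e \<in> A. e \<subseteq> S - {x}} \<union> (\<lambda>w. {x, w}) ` nbrs A S x"
      proof (cases "x \<in> e")
        case True
        then obtain w where "e = {x, w}" using pair e by blast
        then show ?thesis using e by (auto simp: nbrs_def)
      qed (use e in auto)
    qed
    moreover have fN: "finite (nbrs A S x)" using finS by (simp add: nbrs_def)
    ultimately have "card {e \<in> A. e \<subseteq> S} \<le> card ({e \<in> A. e \<subseteq> S - {x}} \<union> (\<lambda>w. {x, w}) ` nbrs A S x)"
      using finA by (intro card_mono) auto
    also have "\<dots> \<le> card {e \<in> A. e \<subseteq> S - {x}} + card ((\<lambda>w. {x, w}) ` nbrs A S x)" by (rule card_Un_le)
    also have "card ((\<lambda>w. {x, w}) ` nbrs A S x) \<le> card (nbrs A S x)" using fN by (rule card_image_le)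
    finally show ?thesis by simp
  qed
  have IH: "card {e \<in> A. e \<subseteq> S - {x}} \<le> 2 * card V * (card S - 1) + 2 * card (?Th (S - {x}))" if "x \<in> S" for x
    using less.hyps[of "S - {x}"] less.prems card_Diff1_less[OF finS that] that by auto
  have VS: "2 * card V * (card S - 1) + 2 * card V = 2 * card V * card S" if "x \<in> S" for x
  proof -
    have "0 < card S" using that finS by (auto simp: card_gt_0_iff)
    then show ?thesis by (cases "card S") simp_all
  qed
  show ?case
  \<comment> \<open>Deleting a vertex of small degree is covered by the linear term. Otherwise the
    degrees suffice for greedy embedding with a factor 2 to spare.\<close>
  proof (cases "\<exists>x\<in>S. card (nbrs A S x) \<le> 2 * card V")
    case True
    then obtain x where x: "x \<in> S" "card (nbrs A S x) \<le> 2 * card V" by blast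
    have "card (?Th (S - {x})) \<le> card (?Th S)" by (rule card_mono[OF finTh]) blast
    then show ?thesis using del[OF x(1)] IH[OF x(1)] VS[OF x(1)] x(2) by linarith
  next
    case False
    then have deg: "2 * card V < card (nbrs A S u)" if "u \<in> S" for u using that by (meson not_le)
    then have deg': "card V \<le> card (nbrs A S u)" if "u \<in> S" for u using that by fastforce
    show ?thesis
    proof (cases "S = {}")
      case True
      have "e \<notin> A" if "e \<subseteq> {}" for e
      proof
        assume "e \<in> A"
        then have "card e = 2" using A by (auto simp: complete_graph_def)
        then show False using that by simp
      qed
      then have "{e \<in> A. e \<subseteq> S} = {}" using True by blast
      then show ?thesis by (simp only: card.empty le0)
    next
      case Sne: False
      have emb1: "emb A S {x} (\<lambda>_. u)" if "x \<in> V" "u \<in> S" for x u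
      proof -
        have "\<not> h \<subseteq> {x}" if "h \<in> E" for h
        proof
          assume "h \<subseteq> {x}"
          then have "card h \<le> card {x}" by (intro card_mono) auto
          then show False using edgeD[OF that] by simp
        qed
        then show ?thesis using that by (simp add: emb_def)
      qed
      have full: "\<exists>\<psi>. emb A S V \<psi> \<and> \<psi> x = u" if "x \<in> V" "u \<in> S" for x u
        using emb_extend[OF finS deg' treeset_singleton[OF that(1)] _ emb1[OF that]] by auto
      \<comment> \<open>For a tree the embedding would already be a copy, so only unicyclic patterns
        reach this case.\<close>
      have R: "R \<noteq> {}"
      proof
        assume "R = {}"
        obtain x u where "x \<in> V" "u \<in> S" using V_ne Sne by blast
        from full[OF this] obtain \<psi> where "emb A S V \<psi>" by blast
        from emb_copy[OF this less.prems, of A] \<open>R = {}\<close> nocopy show False by auto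
      qed
      then obtain r where "r \<in> R" by blast
      then have Rr: "R = {r}" using card_R finite_R card_le_Suc0_iff_eq[of R] by auto
      have "r \<in> E" using Rr R_sub by auto
      then obtain y z where yz: "r = {y, z}" "y \<noteq> z" "y \<in> V" "z \<in> V" using edgeD[of r] by (auto simp: card_2_iff)
      obtain W y' where W: "treeset W" "z \<in> W" "y \<notin> W" "y' \<in> W" "{y', y} \<in> E - R"
        using tree_below_edge[OF yz(4,3,2)] .
      have WV: "W \<subseteq> V" using W(1) by (simp add: treeset_def)
      have "Max ((\<lambda>u. card (nbrs A S u)) ` S) \<in> (\<lambda>u. card (nbrs A S u)) ` S" using finS Sne by (intro Max_in) auto
      then obtain u where u: "u \<in> S" "card (nbrs A S u) = Max ((\<lambda>u. card (nbrs A S u)) ` S)" by auto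
      have umax: "card (nbrs A S x) \<le> card (nbrs A S u)" if "x \<in> S" for x
        unfolding u(2) using finS that by (intro Max_ge) auto
      obtain \<psi> where \<psi>: "emb A S V \<psi>" "\<psi> y' = u" using full[of y' u] W(4) WV u(1) by blast
      have eW: "emb A S W \<psi>" using \<psi>(1) WV unfolding emb_def by (meson image_mono inj_on_subset order_trans)
      define z0 where "z0 = \<psi> z"
      have z0: "z0 \<in> S" using \<psi>(1) yz(4) by (auto simp: z0_def emb_def)
      have thr: "{w, z0} \<in> ?Th S - ?Th (S - {z0})" if w: "w \<in> nbrs A S u - \<psi> ` W" for w
      proof -
        have e1: "emb A S (insert y W) (\<psi>(y := w))"
          by (rule emb_insert[OF W(1) yz(3) W(3,4,5) eW]) (use w \<psi>(2) in auto)
        have t1: "treeset (insert y W)" by (rule treeset_insert(2)[OF W(1) yz(3) W(3,4,5)])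
        obtain \<chi> where \<chi>: "emb A S V \<chi>" "\<forall>x\<in>insert y W. \<chi> x = (\<psi>(y := w)) x"
          using emb_extend[OF finS deg' t1 _ e1] by blast
        have img: "\<chi> y = w" "\<chi> z = z0" using \<chi>(2) W(2) yz(2) by (auto simp: z0_def)
        then have "\<chi> ` r = {w, z0}" using yz(1) by simp
        have wS: "w \<in> S" using w by (simp add: nbrs_def)
        have "w \<noteq> z0" using \<chi>(1) img yz by (auto simp: emb_def inj_on_def)
        have nA: "{w, z0} \<notin> A"
        proof
          assume "{w, z0} \<in> A"
          then have "(\<chi> ` V, (`) \<chi> ` E) \<in> copies (V, E) ({..<n}, A)"
            using emb_copy[OF \<chi>(1) less.prems, of A] Rr \<open>\<chi> ` r = {w, z0}\<close> by simp
          then show False using nocopy by simp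
        qed
        have "(\<chi> ` V, (`) \<chi> ` E) \<in> copies (V, E) ({..<n}, insert {w, z0} A)"
          using emb_copy[OF \<chi>(1) less.prems, of "insert {w, z0} A"] Rr \<open>\<chi> ` r = {w, z0}\<close> by auto
        moreover have "{w, z0} \<in> unclaimed n A {}"
          using nA wS z0 less.prems \<open>w \<noteq> z0\<close> by (auto simp: unclaimed_def complete_graph_def)
        ultimately have "{w, z0} \<in> threats n (V, E) A {}" using nocopy unfolding threats_def by blast
        then show ?thesis using wS z0 R by simp
      qed
      have "card (nbrs A S u) - card V \<le> card (nbrs A S u - \<psi> ` W)"
      proof -
        have "finite W" using WV finite_V finite_subset by blast
        then have "card (\<psi> ` W) \<le> card V"
          using card_image_le[of W \<psi>] card_mono[OF finite_V WV] by linarith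
        then show ?thesis using diff_card_le_card_Diff[of "\<psi> ` W" "nbrs A S u"] \<open>finite W\<close> by simp
      qed
      also have "\<dots> \<le> card (?Th S - ?Th (S - {z0}))"
      proof (rule card_inj_on_le[of "\<lambda>w. {w, z0}"])
        show "inj_on (\<lambda>w. {w, z0}) (nbrs A S u - \<psi> ` W)"
          by (rule inj_onI) (auto simp: doubleton_eq_iff)
        show "finite (?Th S - ?Th (S - {z0}))" using finTh by (rule finite_Diff)
      qed (use thr in blast)
      also have "\<dots> = card (?Th S) - card (?Th (S - {z0}))"
        by (rule card_Diff_subset[OF finTh]) blast
      finally have "card (nbrs A S u) - card V \<le> card (?Th S) - card (?Th (S - {z0}))" .
      moreover have "card (?Th (S - {z0})) \<le> card (?Th S)" by (rule card_mono[OF finTh]) blast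
      \<comment> \<open>Deleting \<open>z0\<close> loses at most as many edges as \<open>u\<close>
        has neighbours. As this number exceeds \<open>2 * card V\<close>, it is at most twice
        \<open>card (nbrs A S u) - card V\<close>, and at least that many threats disappear with
        \<open>z0\<close>.\<close>
      ultimately show ?thesis
        using del[OF z0] IH[OF z0] VS[OF z0] umax[OF z0] deg[OF u(1)] by linarith
    qed
  qed
qed

end

section \<open>The first round\<close>

text \<open>The degree sum is at most \<open>2 * k * n\<close>, so at least half of the vertices
  have degree at most \<open>4 * k\<close>. A maximal independent set among these dominates
  them.\<close>

lemma large_independent_set:
  assumes A: "A \<subseteq> edges (complete_graph n)" "card A \<le> k * n"
  obtains I where "I \<subseteq> {..<n}" "\<And>e. e \<in> A \<Longrightarrow> \<not> e \<subseteq> I" "n \<le> 2 * (4 * k + 1) * card I"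
proof -
  define N where "N u = {w \<in> {..<n}. {u, w} \<in> A}" for u
  have finA: "finite A"
    by (rule finite_subset[OF A(1)]) (rule finite_subset[of _ "Pow {..<n}"], auto simp: complete_graph_def)
  have ne: "u \<noteq> w" if "{u, w} \<in> A" for u w using that A(1) by (auto simp: complete_graph_def)
  have "(\<Sum>u\<in>{..<n}. card (N u)) = card (SIGMA u:{..<n}. N u)" by (simp add: N_def)
  also have "\<dots> \<le> card (A \<times> (UNIV :: bool set))"
  \<comment> \<open>Every edge is counted from both ends; the Boolean records which one.\<close>
  proof (rule card_inj_on_le[of "\<lambda>(u, w). ({u, w}, u < w)"])
    show "inj_on (\<lambda>(u, w). ({u, w}, u < w)) (SIGMA u:{..<n}. N u)"
      using ne by (auto simp: inj_on_def N_def doubleton_eq_iff)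
  qed (auto simp: N_def finA)
  also have "\<dots> \<le> 2 * (k * n)" using A(2) by (simp add: card_cartesian_product)
  finally have degsum: "(\<Sum>u\<in>{..<n}. card (N u)) \<le> 2 * (k * n)" .
  define L where "L = {u \<in> {..<n}. card (N u) \<le> 4 * k}"
  have half: "n \<le> 2 * card L"
  proof -
    have "(4 * k + 1) * card ({..<n} - L) = (\<Sum>u\<in>{..<n} - L. 4 * k + 1)" by simp
    also have "\<dots> \<le> (\<Sum>u\<in>{..<n} - L. card (N u))" by (rule sum_mono) (auto simp: L_def)
    also have "\<dots> \<le> (\<Sum>u\<in>{..<n}. card (N u))" by (rule sum_mono2) auto
    finally have "(4 * k + 1) * card ({..<n} - L) \<le> 2 * (k * n)" using degsum by simp
    moreover have "card ({..<n} - L) = n - card L" by (subst card_Diff_subset) (auto simp: L_def)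
    ultimately have *: "(4 * k + 1) * (n - card L) \<le> 2 * k * n" by simp
    show ?thesis
    proof (rule ccontr)
      assume "\<not> n \<le> 2 * card L"
      then have "n < 2 * (n - card L)" by simp
      then have "(4 * k + 1) * n < (4 * k + 1) * (2 * (n - card L))" by (intro mult_strict_left_mono) auto
      then show False using * by (simp add: algebra_simps)
    qed
  qed
  define P where "P I \<longleftrightarrow> I \<subseteq> L \<and> (\<forall>e\<in>A. \<not> e \<subseteq> I)" for I
  have finL: "finite L" by (simp add: L_def)
  have "{} \<notin> A" using A(1) by (auto simp: complete_graph_def)
  then have "P {}" by (auto simp: P_def)
  moreover have "\<forall>I. P I \<longrightarrow> card I < Suc (card L)" using finL card_mono by (auto simp: less_Suc_eq_le P_def)
  ultimately obtain I where PI: "P I" and max: "\<forall>J. P J \<longrightarrow> card J \<le> card I"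
    using ex_has_greatest_nat[of P "{}" card] by blast
  have I: "I \<subseteq> L" "\<forall>e\<in>A. \<not> e \<subseteq> I" using PI by (simp_all add: P_def)
  have finI: "finite I" using I finL finite_subset by blast
  have "L \<subseteq> I \<union> (\<Union>x\<in>I. N x)"
  proof
    fix u assume u: "u \<in> L"
    show "u \<in> I \<union> (\<Union>x\<in>I. N x)"
    proof (cases "u \<in> I")
      case False
      then have "card I < card (insert u I)" using finI by simp
      then have "\<not> P (insert u I)" using max not_le by blast
      then obtain e where e: "e \<in> A" "e \<subseteq> insert u I" using I(1) u by (auto simp: P_def)
      have "u \<in> e" using e I by blast
      moreover have "card e = 2" using e(1) A(1) by (auto simp: complete_graph_def)
      ultimately obtain w where w: "e = {w, u}" "w \<noteq> u" by (auto simp: card_2_iff)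
      then have "w \<in> I" using e(2) by auto
      moreover have "u \<in> N w" using w e(1) u by (simp add: N_def L_def)
      ultimately show ?thesis by blast
    qed simp
  qed
  then have "card L \<le> card (I \<union> (\<Union>x\<in>I. N x))" using finI by (intro card_mono) (auto simp: N_def)
  also have "\<dots> \<le> card I + card (\<Union>x\<in>I. N x)" by (rule card_Un_le)
  also have "card (\<Union>x\<in>I. N x) \<le> (\<Sum>x\<in>I. card (N x))" by (rule card_UN_le[OF finI])
  also have "\<dots> \<le> (\<Sum>x\<in>I. 4 * k)" by (rule sum_mono) (use I in \<open>auto simp: L_def\<close>)
  finally have "card L \<le> (4 * k + 1) * card I" by (simp add: algebra_simps)
  then have "n \<le> 2 * (4 * k + 1) * card I" using half by linarith
  moreover have "I \<subseteq> {..<n}" using I by (auto simp: L_def)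
  ultimately show thesis using that I by blast
qed

text \<open>Labels are dealt out cyclically along an enumeration of \<open>I\<close>.\<close>

lemma balanced_labelling:
  assumes "finite V" "V \<noteq> {}" "finite I"
  obtains lab :: "'a \<Rightarrow> 'v" where "lab ` I \<subseteq> V" "\<And>x. x \<in> V \<Longrightarrow> card I div card V \<le> card {u \<in> I. lab u = x}"
proof -
  obtain e where e: "bij_betw e {0..<card V} V" using ex_bij_betw_nat_finite[OF assms(1)] by blast
  obtain h where h: "bij_betw h {0..<card I} I" using ex_bij_betw_nat_finite[OF assms(3)] by blast
  define i where "i = inv_into {0..<card I} h"
  have ih: "i (h j) = j" if "j < card I" for j
    using bij_betw_inv_into_left[OF h] that by (simp add: i_def)
  have v: "0 < card V" using assms by (simp add: card_gt_0_iff)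
  define lab where "lab u = e (i u mod card V)" for u
  have "lab ` I \<subseteq> V" using e v by (auto simp: lab_def bij_betw_def)
  moreover have "card I div card V \<le> card {u \<in> I. lab u = x}" if "x \<in> V" for x
  proof -
    have "x \<in> e ` {0..<card V}" using e that unfolding bij_betw_def by simp
    then obtain j where j: "j < card V" "x = e j" by auto
    have lt: "j + card V * m < card I" if "m < card I div card V" for m
    proof -
      have "j + card V * m < card V * Suc m" using j by simp
      also have "\<dots> \<le> card V * (card I div card V)" using that by (intro mult_le_mono2) simp
      also have "\<dots> \<le> card I" by simp
      finally show ?thesis .
    qed
    have "card {..<card I div card V} \<le> card {u \<in> I. lab u = x}"
    proof (rule card_inj_on_le[of "\<lambda>m. h (j + card V * m)"])
      show "inj_on (\<lambda>m. h (j + card V * m)) {..<card I div card V}"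
      proof (rule inj_onI)
        fix m m' assume m: "m \<in> {..<card I div card V}" "m' \<in> {..<card I div card V}"
          "h (j + card V * m) = h (j + card V * m')"
        then have "j + card V * m = j + card V * m'" using ih lt by (metis lessThan_iff)
        then show "m = m'" using v by simp
      qed
      show "(\<lambda>m. h (j + card V * m)) ` {..<card I div card V} \<subseteq> {u \<in> I. lab u = x}"
      proof
        fix u assume "u \<in> (\<lambda>m. h (j + card V * m)) ` {..<card I div card V}"
        then obtain m where m: "m < card I div card V" "u = h (j + card V * m)" by auto
        have "u \<in> I" using h lt[OF m(1)] m(2) by (auto simp: bij_betw_def)
        moreover have "lab u = x" using ih[OF lt[OF m(1)]] m(2) j by (simp add: lab_def)
        ultimately show "u \<in> {u \<in> I. lab u = x}" by simp
      qed
    qed (use assms in simp)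
    then show ?thesis by simp
  qed
  ultimately show thesis by (rule that)
qed

context labelled
begin

text \<open>The prescribed first move must not damage the board. So \<open>s\<close> vertices are
  set aside from each of two fibres, all \<open>r\<close> edges are taken between these two sets,
  and the sets are discarded; every fibre keeps at least \<open>s\<close> vertices.\<close>

lemma start_win:
  fixes a c :: real
  assumes Q: "\<And>A B. reached c A B \<Longrightarrow> Q A B"
    and c: "0 < c" "128 \<le> c\<^sup>2 * g (card E - 1)" "c \<le> (shrink ^^ card E) a"
    and a: "0 < a" "a \<le> 1" "a * n \<le> s"
    and I: "I \<subseteq> {..<n}" "lab ` I \<subseteq> V" "\<And>e. e \<in> A \<Longrightarrow> \<not> e \<subseteq> I"
    and fibres: "\<And>x. x \<in> V \<Longrightarrow> 2 * s \<le> card {u \<in> I. lab u = x}" and r: "r \<le> s * s"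
  obtains Y where "Y \<subseteq> unclaimed n A {}" "card Y = r" "win n b Q A Y"
proof -
  have finI: "finite I" using I(1) finite_subset by blast
  have s: "0 < s" using a n_pos by (metis gr0I mult_pos_pos not_le of_nat_0 of_nat_0_less_iff)
  obtain d where "d \<in> E" using two_le by fastforce
  then obtain x y where xy: "{x, y} \<in> E" "x \<noteq> y" "x \<in> V" "y \<in> V" using edgeD[of d] by (auto simp: card_2_iff)
  obtain D1 where D1: "D1 \<subseteq> {u \<in> I. lab u = x}" "card D1 = s"
  proof (rule obtain_subset_with_card_n[of s "{u \<in> I. lab u = x}"])
    show "s \<le> card {u \<in> I. lab u = x}" using fibres[OF xy(3)] by linarith
  qed (rule that)
  obtain D2 where D2: "D2 \<subseteq> {u \<in> I. lab u = y}" "card D2 = s"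
  proof (rule obtain_subset_with_card_n[of s "{u \<in> I. lab u = y}"])
    show "s \<le> card {u \<in> I. lab u = y}" using fibres[OF xy(4)] by linarith
  qed (rule that)
  have Ddis: "u \<noteq> w" if "u \<in> D1" "w \<in> D2" for u w using that D1 D2 xy(2) by auto
  define Hs where "Hs = (\<lambda>(u, w). {u, w}) ` (D1 \<times> D2)"
  have "inj_on (\<lambda>(u, w). {u, w}) (D1 \<times> D2)"
    using Ddis by (auto simp: inj_on_def doubleton_eq_iff)
  then have "card Hs = s * s" unfolding Hs_def using D1 D2 by (simp add: card_image card_cartesian_product)
  then obtain Y where Y: "Y \<subseteq> Hs" "card Y = r" using r obtain_subset_with_card_n[of r Hs] by auto
  have HU: "Hs \<subseteq> unclaimed n A {}"
  proof
    fix e assume "e \<in> Hs"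
    then obtain u w where uw: "u \<in> D1" "w \<in> D2" "e = {u, w}" by (auto simp: Hs_def)
    then have "u \<in> I" "w \<in> I" "u \<noteq> w" using D1 D2 Ddis by auto
    moreover from this have "e \<notin> A" using I(3)[of e] uw by auto
    ultimately show "e \<in> unclaimed n A {}" using I(1) uw by (auto simp: unclaimed_def complete_graph_def)
  qed
  define J where "J = I - D1 - D2"
  define K where "K = (\<lambda>u. {u}) ` J"
  define P where "P = (\<lambda>x. {x}) ` V"
  have JI: "J \<subseteq> I" by (auto simp: J_def)
  have bet1: "bet {u} {u} = {}" for u using edge_ne[of "lab u" "lab u"] by (auto simp: bet_def)
  have cntK: "s \<le> cnt K {z}" if "z \<in> V" for z
  proof -
    have "{W \<in> K. lab ` W = {z}} = (\<lambda>u. {u}) ` {u \<in> J. lab u = z}" by (auto simp: K_def)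
    then have "cnt K {z} = card {u \<in> J. lab u = z}" unfolding cnt_def by (simp add: card_image)
    moreover have "{u \<in> I. lab u = z} \<subseteq> {u \<in> J. lab u = z} \<union> (if z = x then D1 else if z = y then D2 else {})"
      using D1 D2 xy(2) by (auto simp: J_def)
    then have "card {u \<in> I. lab u = z} \<le> card ({u \<in> J. lab u = z} \<union> (if z = x then D1 else if z = y then D2 else {}))"
    proof (rule card_mono[rotated])
      have "finite D1" "finite D2" using finite_subset[OF D1(1)] finite_subset[OF D2(1)] finI by simp_all
      then show "finite ({u \<in> J. lab u = z} \<union> (if z = x then D1 else if z = y then D2 else {}))"
        using finite_subset[OF JI finI] by simp
    qed
    moreover have "card ({u \<in> J. lab u = z} \<union> (if z = x then D1 else if z = y then D2 else {})) \<le>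
        card {u \<in> J. lab u = z} + s"
      using card_Un_le[of "{u \<in> J. lab u = z}" "if z = x then D1 else if z = y then D2 else {}"] D1(2) D2(2)
      by (auto split: if_splits intro: order_trans)
    ultimately show ?thesis using fibres[OF that] by linarith
  qed
  have lay: "layout A Y P (\<lambda>_. 0) K"
    unfolding layout_def
  proof (intro conjI ballI impI)
    show "pieces A Y K"
      using I(1,2) JI bet1 conn_singleton unfolding pieces_def K_def by (auto intro!: disjointI)
    show "partition_on V P" by (auto simp: P_def partition_on_def disjoint_def)
    fix C assume "C \<in> P"
    then obtain z where z: "z \<in> V" "C = {z}" by (auto simp: P_def)
    show "card C \<le> 0 + 1" using z by simp
    show "0 < cnt K C" using cntK[OF z(1)] z(2) s by simp
  next
    fix W assume "W \<in> K"
    then obtain u where u: "u \<in> J" "W = {u}" by (auto simp: K_def)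
    show "lab ` W \<in> P" using u I(2) JI by (auto simp: P_def)
    show "cl A W = 0" using u bet1 by (simp add: cl_def)
  next
    fix W W' assume "W \<in> K" "W' \<in> K"
    then obtain u w where uw: "u \<in> J" "W = {u}" "w \<in> J" "W' = {w}" by (auto simp: K_def)
    have "{u, w} \<notin> A" using I(3)[of "{u, w}"] uw JI by auto
    moreover have "{u, w} \<notin> Y" using Y(1) uw by (auto simp: Hs_def J_def doubleton_eq_iff)
    ultimately show "bet W W' \<inter> (A \<union> Y) = {}" using uw by (auto simp: bet_def)
  qed
  have ric: "rich a P (\<lambda>_. 0) K"
  proof -
    have "a * g 0 \<le> cnt K {z}" if "z \<in> V" for z
      using cntK[OF that] a(3) by (simp add: g_def)
    then show ?thesis by (auto simp: rich_def P_def)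
  qed
  have ce: "card E \<le> (\<Sum>C\<in>P. 0) + 1 + card E" by simp
  have "win n b Q A Y" by (rule rich_win[OF Q c(1,2) lay ric a(1,2) ce c(3)])
  then show thesis using that Y HU by blast
qed

end

section \<open>Choice of the constant and assembly\<close>

context pattern
begin

text \<open>With \<open>k = 2 * card V + 2\<close> the factor in
  \<open>large_independent_set\<close> is \<open>16 * card V + 18\<close>; distributing over
  \<open>card V\<close> labels, halving and rounding give \<open>4 * card V\<close>.\<close>

definition density :: real where "density = 1 / (4 * card V * (16 * card V + 18))"

definition gain :: real where "gain = (shrink ^^ card E) density"

text \<open>The 256 gives twice the 128 required by \<open>rich_win\<close> and makes
  \<open>gam\<close> strictly smaller than \<open>gain\<^sup>2\<close>, which yields the strict
  inequality in \<open>goal\<close>.\<close>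

definition gam :: real where "gam = gain\<^sup>2 / 256"

lemma density_bounds: "0 < density" "density \<le> 1"
proof -
  have "1 * 1 \<le> 4 * card V * (16 * card V + 18)" using card_E_V by (intro mult_le_mono) auto
  then have "1 \<le> real (4 * card V * (16 * card V + 18))" by (simp only: one_of_nat_le_iff mult_1)
  moreover have "0 < 1 / x" "1 / x \<le> 1" if "1 \<le> x" for x :: real using that by simp_all
  ultimately show "0 < density" "density \<le> 1" unfolding density_def by blast+
qed

lemma gain_bounds: "0 < gain" "gain \<le> density"
  using funpow_shrink[OF density_bounds] by (simp_all add: gain_def)

lemma gam_bounds: "0 < gam" "gam < 1" "gam < gain\<^sup>2" "gam \<le> density\<^sup>2" "gam \<le> density"
proof -
  have g: "0 < gain\<^sup>2" "gain\<^sup>2 \<le> density\<^sup>2" using gain_bounds by (auto intro: power_mono)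
  have "density\<^sup>2 \<le> density" using density_bounds by (simp add: power2_eq_square)
  then show "0 < gam" "gam < 1" "gam < gain\<^sup>2" "gam \<le> density\<^sup>2" "gam \<le> density"
    using g density_bounds unfolding gam_def by linarith+
qed

definition goal :: "nat \<Rightarrow> nat \<Rightarrow> edge set \<Rightarrow> edge set \<Rightarrow> bool" where
  "goal n b A B \<longleftrightarrow> enforcer_has_won n (V, E) A \<or>
     real (card (threats n (V, E) A B)) > gam ^ (card E - 1) * (real n ^ card V / real (b + 1) ^ (card E - 1))"

lemma first_round:
  assumes nb: "0 < n" "0 < b" "8 * card V * n \<le> b + 1" "R \<noteq> {} \<Longrightarrow> even b"
    and bnd: "real (b + 1) \<le> gam * real n powr (real (card E) / (real (card E) - 1))"
    and X: "X \<subseteq> edges (complete_graph n)" and r: "r \<le> b"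
  shows "2 \<le> n" "goal n b X {} \<or> (\<exists>Y. Y \<subseteq> unclaimed n X {} \<and> card Y = r \<and> win n b (goal n b) X Y)"
proof -
  define k where "k = card E - 1"
  have k: "card E = Suc k" "1 \<le> k" using card_E_V by (simp_all add: k_def)
  have L0: "0 < real (b + 1)" by simp
  have n0: "0 < real n" using nb by simp
  define G where "G = real n * (real n / real (b + 1)) ^ k"
  have pw: "real (b + 1) ^ k \<le> gam ^ k * real n ^ card E"
  proof -
    have "real (b + 1) ^ k \<le> (gam * real n powr (real (card E) / (real (card E) - 1))) ^ k"
      using bnd by (rule power_mono) simp
    also have "\<dots> = gam ^ k * (real n powr (real (card E) / real k)) ^ k" using k by (simp add: power_mult_distrib)
    also have "(real n powr (real (card E) / real k)) ^ k = real n powr (real (card E))"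
      using n0 k(2) by (simp add: powr_power)
    also have "\<dots> = real n ^ card E" using n0 by (rule powr_realpow)
    finally show ?thesis .
  qed
  have G: "G = real n ^ card E / real (b + 1) ^ k" unfolding G_def k(1) by (simp add: power_divide)
  have gk: "gam ^ k \<le> gam" using power_decreasing[of 1 k gam] k(2) gam_bounds by simp
  \<comment> \<open>The upper bound on \<open>b\<close> in usable form; \<open>gam ^ k\<close> may
    be weakened to \<open>gam\<close> since \<open>k\<close> is at least 1.\<close>
  have gG: "1 \<le> gam * G"
  proof -
    have "1 \<le> gam ^ k * G" unfolding G using pw L0 by (simp add: pos_le_divide_eq)
    moreover have "0 \<le> G" by (simp add: G_def)
    ultimately show ?thesis using mult_right_mono[OF gk, of G] by linarith
  qed
  have qle: "real n / real (b + 1) \<le> 1"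
  proof -
    have "1 * n \<le> card V * n" using card_E_V by (intro mult_le_mono1) simp
    then have "n \<le> b + 1" using nb(3) by linarith
    then show ?thesis by simp
  qed
  have Gn: "G \<le> real n" unfolding G_def using n0 qle by (intro mult_left_le power_le_one) auto
  have dn: "1 \<le> density * n"
  proof -
    have "gam * G \<le> density * real n" using gam_bounds Gn density_bounds by (intro mult_mono) (auto simp: G_def)
    then show ?thesis using gG by linarith
  qed
  define D where "D = 4 * card V * (16 * card V + 18)"
  have Dpos: "2 \<le> D" "0 < D"
  proof -
    have "2 * 1 \<le> 4 * card V * (16 * card V + 18)" using card_E_V by (intro mult_le_mono) auto
    then show "2 \<le> D" by (simp add: D_def)
    then show "0 < D" by simp
  qed
  have dD: "density = 1 / real D" by (simp add: density_def D_def)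
  \<comment> \<open>Excludes small \<open>n\<close>: this absorbs the rounding in \<open>s\<close>
    and ensures that the board has an edge.\<close>
  have Dn: "D \<le> n" using dn Dpos unfolding dD by (simp add: field_simps)
  then show "2 \<le> n" using Dpos by simp
  \<comment> \<open>The exponent is at most 2 as \<open>card E\<close> is at least 2. This makes the
    first move fit between the two sets of size \<open>s\<close> that \<open>start_win\<close> sets
    aside.\<close>
  have bG: "real b \<le> density\<^sup>2 * real n ^ 2"
  proof -
    have "real (card E) / (real (card E) - 1) \<le> 2" using k by (simp add: field_simps)
    then have "real n powr (real (card E) / (real (card E) - 1)) \<le> real n powr 2"
      using nb(1) by (intro powr_mono) auto
    also have "\<dots> = real n ^ 2" using n0 by (simp add: powr_numeral)
    finally have "gam * real n powr (real (card E) / (real (card E) - 1)) \<le> density\<^sup>2 * real n ^ 2"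
      using gam_bounds by (intro mult_mono) auto
    then show ?thesis using bnd by simp
  qed
  have bound: "real n ^ card V / real (b + 1) ^ (card E - 1) = G * (if R = {} then real n else 1)"
  proof (cases "R = {}")
    case True
    then have "card V = Suc (card E)" using card_E by simp
    then show ?thesis using True unfolding G k_def by simp
  next
    case False
    then have "card V = card E" by (rule card_V_unicyclic)
    then show ?thesis using False unfolding G k_def by simp
  qed
  have goalI: "goal n b A B" if "enforcer_has_won n (V, E) A \<or>
      gain\<^sup>2 * G * (if R = {} then real n else 1) \<le> card (threats n (V, E) A B)" for A B
  proof -
    have "0 < G" using n0 by (simp add: G_def)
    then have pos: "0 < G * (if R = {} then real n else 1)" using n0 by simp
    have "gam ^ k < gain\<^sup>2" using gk gam_bounds by linarith
    then have less: "gam ^ k * (G * (if R = {} then real n else 1)) < gain\<^sup>2 * (G * (if R = {} then real n else 1))"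
      using pos by (rule mult_strict_right_mono)
    from that show ?thesis
    proof
      assume "gain\<^sup>2 * G * (if R = {} then real n else 1) \<le> card (threats n (V, E) A B)"
      then have "gam ^ k * (G * (if R = {} then real n else 1)) < card (threats n (V, E) A B)"
        using less unfolding mult.assoc by (rule less_le_trans[rotated])
      then show ?thesis unfolding goal_def bound unfolding k_def[symmetric] by (rule disjI2)
    qed (simp add: goal_def)
  qed
  show "goal n b X {} \<or> (\<exists>Y. Y \<subseteq> unclaimed n X {} \<and> card Y = r \<and> win n b (goal n b) X Y)"
  proof (cases "goal n b X {}")
    case False
    have nocopy: "copies (V, E) ({..<n}, X) = {}"
      and few: "real (card (threats n (V, E) X {})) \<le> gam ^ k * (G * (if R = {} then real n else 1))"
      using False unfolding goal_def bound unfolding k_def[symmetric] enforcer_has_won_def by auto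
    \<comment> \<open>For a unicyclic pattern a missed goal leaves at most \<open>G \<le> n\<close>
      threats; for a tree the set is empty.\<close>
    have "card {e \<in> threats n (V, E) X {}. e \<subseteq> {..<n} \<and> R \<noteq> {}} \<le> n"
    proof (cases "R = {}")
      case False
      have "gam ^ k * G \<le> 1 * G" using gk gam_bounds n0 by (intro mult_right_mono) (auto simp: G_def)
      then have "real (card (threats n (V, E) X {})) \<le> real n" using few Gn False by simp
      moreover have "finite (threats n (V, E) X {})"
        by (rule finite_subset[OF _ finite_unclaimed[of n X "{}"]]) (auto simp: threats_def)
      then have "card {e \<in> threats n (V, E) X {}. e \<subseteq> {..<n} \<and> R \<noteq> {}} \<le> card (threats n (V, E) X {})"
        by (rule card_mono) auto
      ultimately show ?thesis by linarith
    qed simp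
    moreover have "{e \<in> X. e \<subseteq> {..<n}} = X" using X by (auto simp: complete_graph_def)
    ultimately have "card X \<le> 2 * card V * n + 2 * n"
      using few_edges_or_many_threats[OF X nocopy, of "{..<n}"] by simp
    then have "card X \<le> (2 * card V + 2) * n" by (simp add: algebra_simps)
    from large_independent_set[OF X this] obtain I where I: "I \<subseteq> {..<n}" "\<And>e. e \<in> X \<Longrightarrow> \<not> e \<subseteq> I"
      "n \<le> 2 * (4 * (2 * card V + 2) + 1) * card I" by metis
    have finI: "finite I" using I(1) finite_subset by blast
    obtain lab :: "nat \<Rightarrow> 'v" where lab: "lab ` I \<subseteq> V"
      "\<And>x. x \<in> V \<Longrightarrow> card I div card V \<le> card {u \<in> I. lab u = x}"
      using balanced_labelling[OF finite_V V_ne finI] by metis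
    define s where "s = card I div (2 * card V)"
    have fib: "2 * s \<le> card {u \<in> I. lab u = x}" if "x \<in> V" for x
    proof -
      have "2 * s \<le> card I div card V" unfolding s_def
        by (metis div_mult2_eq div_times_less_eq_dividend mult.commute)
      then show ?thesis using lab(2)[OF that] by linarith
    qed
    have "n \<le> D * s"
    proof -
      have "n \<le> (16 * card V + 18) * card I" using I(3) by (simp add: algebra_simps)
      moreover have "card I < 2 * card V * (s + 1)"
        unfolding s_def using card_E_V by (metis Suc_eq_plus1 dividend_less_times_div mult_Suc_right add.commute mult_pos_pos zero_less_numeral less_le_trans)
      ultimately have "n \<le> (16 * card V + 18) * (2 * card V * (s + 1))"
        by (meson less_imp_le mult_le_mono2 order_trans)
      then have "2 * n \<le> D * s + D" unfolding D_def by (simp add: algebra_simps)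
      then show ?thesis using Dn by linarith
    qed
    then have "real n \<le> real D * real s" by (metis of_nat_le_iff of_nat_mult)
    then have ds: "density * n \<le> s" unfolding dD using Dpos by (simp add: field_simps)
    have "r \<le> s * s"
    proof -
      have "(density * n) * (density * n) \<le> real s * real s"
        using ds density_bounds by (intro mult_mono) auto
      then have "real b \<le> real (s * s)" using bG by (simp add: power2_eq_square algebra_simps)
      then show ?thesis using r by linarith
    qed
    interpret labelled V E R lab n b by unfold_locales (use nb in auto)
    have gG': "g (card E - 1) = G" unfolding g_def q_def G_def k_def ..
    have "256 \<le> gain\<^sup>2 * G" using gG unfolding gam_def by simp
    then have big: "128 \<le> gain\<^sup>2 * g (card E - 1)" unfolding gG' by linarith
    have goalI': "goal n b A B" if "reached gain A B" for A B
      using that unfolding reached_def gG' by (rule goalI)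
    have gd: "gain \<le> (shrink ^^ card E) density" by (simp add: gain_def)
    obtain Y where "Y \<subseteq> unclaimed n X {}" "card Y = r" "win n b (goal n b) X Y"
      by (rule start_win[OF goalI' gain_bounds(1) big gd density_bounds ds I(1) lab(1) I(2) fib \<open>r \<le> s * s\<close>])
        (assumption | rule that)+
    then show ?thesis by blast
  qed simp
qed

lemma pattern_reach:
  assumes nb: "0 < n" "0 < b" "8 * card V * n \<le> b + 1" "R \<noteq> {} \<Longrightarrow> even b"
    and bnd: "real (b + 1) \<le> gam * real n powr (real (card E) / (real (card E) - 1))"
  shows "enforcer_can_reach n (strict_rules b) (goal n b)"
    and "r \<le> b \<Longrightarrow> enforcer_can_reach n (modified_rules b r) (goal n b)"
proof -
  have fr: "2 \<le> n" "goal n b X {} \<or> (\<exists>Y. Y \<subseteq> unclaimed n X {} \<and> card Y = m \<and> win n b (goal n b) X Y)"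
    if "X \<subseteq> edges (complete_graph n)" "m \<le> b" for X m
    using first_round[OF nb(1-3) _ bnd that] nb(4) by blast+
  have "{0, 1} \<in> unclaimed n {} {}" using fr(1)[of "{}" 0] by (simp add: unclaimed_def complete_graph_def)
  then have ne: "unclaimed n {} {} \<noteq> {}" by blast
  \<comment> \<open>The strict game is treated as the case of \<open>b\<close> edges in the first
    round, since \<open>first_round\<close> admits any first move of Avoider.\<close>
  have first: "goal n b X {} \<or> (\<exists>Y. enforcer_legal n Rl [] X Y \<and> win n b (goal n b) X Y)"
    if legal: "avoider_legal n Rl [] X" and le: "snd Rl 0 \<le> b" for Rl X
  proof -
    have X: "X \<subseteq> edges (complete_graph n)" using legal by (auto simp: avoider_legal_def unclaimed_def)
    from fr(2)[OF X le] show ?thesis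
    proof
      assume "\<exists>Y. Y \<subseteq> unclaimed n X {} \<and> card Y = snd Rl 0 \<and> win n b (goal n b) X Y"
      then obtain Y where Y: "Y \<subseteq> unclaimed n X {}" "card Y = snd Rl 0" "win n b (goal n b) X Y" by blast
      have "enforcer_legal n Rl [] X Y"
        using Y(1,2) card_mono[OF finite_unclaimed Y(1)]
        by (simp add: enforcer_legal_def avoider_edges_def enforcer_edges_def)
      then show ?thesis using Y(3) by blast
    qed blast
  qed
  show "enforcer_can_reach n (strict_rules b) (goal n b)"
    by (rule enforcer_can_reachI[where b = b, OF _ ne first]) (auto simp: strict_rules_def)
  show "enforcer_can_reach n (modified_rules b r) (goal n b)" if "r \<le> b"
    by (rule enforcer_can_reachI[where b = b, OF _ ne first]) (use that in \<open>auto simp: modified_rules_def\<close>)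
qed

end

theorem theorem1p3:
  fixes H :: "'v ugraph"
  assumes "is_tree H \<or> unicyclic H"
    and "card (edges H) \<ge> 2"
  shows "\<exists>\<gamma>::real. 0 < \<gamma> \<and> \<gamma> < 1 \<and>
    (\<forall>n b :: nat. n > 0 \<longrightarrow> b > 0 \<longrightarrow>
       8 * card (verts H) * n \<le> b + 1 \<longrightarrow>
       real (b + 1) \<le> \<gamma> * real n powr (real (card (edges H)) / (real (card (edges H)) - 1)) \<longrightarrow>
       (unicyclic H \<longrightarrow> even b) \<longrightarrow>
       enforcer_can_reach n (strict_rules b)
         (\<lambda>A B. enforcer_has_won n H A \<or>
            real (card (threats n H A B)) >
              \<gamma> ^ (card (edges H) - 1) * (real n ^ card (verts H) / real (b + 1) ^ (card (edges H) - 1))) \<and>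
       (\<forall>r\<in>{0..b}. enforcer_can_reach n (modified_rules b r)
         (\<lambda>A B. enforcer_has_won n H A \<or>
            real (card (threats n H A B)) >
              \<gamma> ^ (card (edges H) - 1) * (real n ^ card (verts H) / real (b + 1) ^ (card (edges H) - 1)))))"
proof -
  obtain V E where H: "H = (V, E)" by (cases H)
  \<comment> \<open>\<open>R\<close> is nonempty only if \<open>H\<close> is unicyclic, so the
    parity hypothesis is available exactly when \<open>labelled\<close> asks for it.\<close>
  obtain R where R: "pattern V E R" "R \<noteq> {} \<Longrightarrow> unicyclic H"
  proof (cases "is_tree H")
    case True
    then show ?thesis using that[of "{}"] pattern_tree assms(2) H by auto
  next
    case False
    then have u: "unicyclic (V, E)" using assms(1) H by simp
    moreover have "2 \<le> card E" using assms(2) H by simp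
    ultimately obtain r where "pattern V E {r}" by (rule pattern_unicyclic)
    then show ?thesis using that u H by simp
  qed
  interpret pattern V E R by (rule R(1))
  have goal: "goal n b = (\<lambda>A B. enforcer_has_won n H A \<or>
      real (card (threats n H A B)) > gam ^ (card E - 1) * (real n ^ card V / real (b + 1) ^ (card E - 1)))" for n b
    unfolding goal_def H by (intro ext) simp
  show ?thesis
  proof (intro exI[of _ gam] conjI allI impI ballI)
    fix n b :: nat
    assume nb: "0 < n" "0 < b" "8 * card (verts H) * n \<le> b + 1"
      "real (b + 1) \<le> gam * real n powr (real (card (edges H)) / (real (card (edges H)) - 1))"
      "unicyclic H \<longrightarrow> even b"
    have nb': "8 * card V * n \<le> b + 1" "R \<noteq> {} \<Longrightarrow> even b"
      "real (b + 1) \<le> gam * real n powr (real (card E) / (real (card E) - 1))" using nb R(2) H by simp_all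
    note reach = pattern_reach[OF nb(1,2) nb'(1,2,3)]
    show "enforcer_can_reach n (strict_rules b) (\<lambda>A B. enforcer_has_won n H A \<or>
        real (card (threats n H A B)) > gam ^ (card (edges H) - 1) *
          (real n ^ card (verts H) / real (b + 1) ^ (card (edges H) - 1)))"
      using reach(1) unfolding goal by (simp add: H)
    show "enforcer_can_reach n (modified_rules b r) (\<lambda>A B. enforcer_has_won n H A \<or>
        real (card (threats n H A B)) > gam ^ (card (edges H) - 1) *
          (real n ^ card (verts H) / real (b + 1) ^ (card (edges H) - 1)))" if "r \<in> {0..b}" for r
      using reach(2)[of r] that unfolding goal by (simp add: H)
  qed (rule gam_bounds)+
qed

end
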